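(* Let $\alpha,\beta>0$ with $\alpha\beta\le1$, let $g,\tilde g\in L^2(\mathbb{R}^d)$ be such that $\{g_{m,n}\}_{m,n\in\mathbb{Z}^d}$ is a Gabor frame for $L^2(\mathbb{R}^d)$ with dual Gabor frame $\{\tilde g_{m,n}\}_{m,n\in\mathbb{Z}^d}$. Then for every $T\in\mathbf{A}$ the limit $$\gamma(T)=\frac{1}{(\alpha\beta)^d}\lim_{M,N\to\infty}\frac{1}{(2M+1)^d(2N+1)^d}\sum_{|m|\le M}\sum_{|n|\le N}\langle Tg_{m,n},\tilde g_{m,n}\rangle$$ exists and does not depend on the choice of $\alpha,\beta,g,\tilde g$; for $T=\sum_\lambda c_\lambda U_\lambda\in\mathcal{A}$ one has $\gamma(T)=c_0$ (the coefficient at $\lambda=0$); and $\gamma$ is a faithful tracial state on $\mathbf{A}$.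
   Context: For $\lambda=(t,\omega)\in\mathbb{R}^d\times\mathbb{R}^d$, $U_{(t,\omega)}f(x)=e^{i\langle\omega,x\rangle}f(x-t)$ on $L^2(\mathbb{R}^d)$. $\mathcal{A}$ is the algebra of operators $T=\sum_{\lambda\in\mathbb{R}^{2d}}c_\lambda U_\lambda$ with $\sum_\lambda|c_\lambda|<\infty$, and $\mathbf{A}$ is the $C^*$-algebra obtained as the closure of $\mathcal{A}$ in operator norm in $B(L^2(\mathbb{R}^d))$. For $m,n\in\mathbb{Z}^d$, $g_{m,n}=U_{(\beta n,2\pi\alpha m)}g$ and $\tilde g_{m,n}=U_{(\beta n,2\pi\alpha m)}\tilde g$; "dual frame" means both systems are frames and $f=\sum_{m,n}\langle f,\tilde g_{m,n}\rangle g_{m,n}$ for all $f\in L^2(\mathbb{R}^d)$. $|m|$ is the max-norm on $\mathbb{Z}^d$. A faithful tracial state on a unital $C^*$-algebra is a linear functional $\gamma$ with $\gamma(1)=1$, $\gamma(T^*T)\ge0$, $\gamma(ST)=\gamma(TS)$, and $\gamma(T^*T)=0$ only if $T=0$. *)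

theory Defs
  imports "HOL-Analysis.Analysis"
begin

text \<open>Elements of L2(R^d) are represented by functions real^'n => complex
(d = CARD('n)), modulo almost-everywhere equality w.r.t. Lebesgue measure.\<close>

definition sqint :: "((real^'n) \<Rightarrow> complex) set" where
  "sqint = {f. f \<in> borel_measurable lebesgue \<and>
               integrable lebesgue (\<lambda>x. (cmod (f x))^2)}"

definition l2inner :: "((real^'n) \<Rightarrow> complex) \<Rightarrow> ((real^'n) \<Rightarrow> complex) \<Rightarrow> complex" where
  "l2inner f g = (LINT x|lebesgue. f x * cnj (g x))"

definition l2norm :: "((real^'n) \<Rightarrow> complex) \<Rightarrow> real" where
  "l2norm f = sqrt (LINT x|lebesgue. (cmod (f x))^2)"

definition ae_zero :: "((real^'n) \<Rightarrow> complex) \<Rightarrow> bool" where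
  "ae_zero f \<longleftrightarrow> (AE x in lebesgue. f x = 0)"

definition TF :: "(real^'n) \<times> (real^'n) \<Rightarrow> ((real^'n) \<Rightarrow> complex) \<Rightarrow> ((real^'n) \<Rightarrow> complex)" where
  "TF l f = (\<lambda>x. exp (\<i> * complex_of_real (snd l \<bullet> x)) * f (x - fst l))"

definition Aop :: "((real^'n) \<times> (real^'n) \<Rightarrow> complex) \<Rightarrow> ((real^'n) \<Rightarrow> complex) \<Rightarrow> ((real^'n) \<Rightarrow> complex)" where
  "Aop c f = (\<lambda>x. \<Sum>\<^sub>\<infinity>l. c l * TF l f x)"

text \<open>Membership in the C*-algebra bold-A: the operator-norm closure of calA
in B(L2).  A (representative of a) bounded operator maps L2 into L2; T lies in
the closure iff it is approximated arbitrarily well in operator norm by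
elements of calA.\<close>
definition in_boldA :: "(((real^'n) \<Rightarrow> complex) \<Rightarrow> ((real^'n) \<Rightarrow> complex)) \<Rightarrow> bool" where
  "in_boldA T \<longleftrightarrow> (\<forall>f\<in>sqint. T f \<in> sqint) \<and>
     (\<forall>e>0. \<exists>c. (\<lambda>l. norm (c l)) summable_on UNIV \<and>
        (\<forall>f\<in>sqint. l2norm (\<lambda>x. T f x - Aop c f x) \<le> e * l2norm f))"

definition is_adjoint :: "(((real^'n) \<Rightarrow> complex) \<Rightarrow> ((real^'n) \<Rightarrow> complex)) \<Rightarrow>
    (((real^'n) \<Rightarrow> complex) \<Rightarrow> ((real^'n) \<Rightarrow> complex)) \<Rightarrow> bool" where
  "is_adjoint S T \<longleftrightarrow> (\<forall>f\<in>sqint. S f \<in> sqint) \<and>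
     (\<forall>f\<in>sqint. \<forall>h\<in>sqint. l2inner (T f) h = l2inner f (S h))"

definition is_frame :: "('k \<Rightarrow> ((real^'n) \<Rightarrow> complex)) \<Rightarrow> bool" where
  "is_frame h \<longleftrightarrow> (\<forall>k. h k \<in> sqint) \<and>
     (\<exists>A B. 0 < A \<and> 0 < B \<and> (\<forall>f\<in>sqint.
        (\<lambda>k. (cmod (l2inner f (h k)))^2) summable_on UNIV \<and>
        A * (l2norm f)^2 \<le> (\<Sum>\<^sub>\<infinity>k. (cmod (l2inner f (h k)))^2) \<and>
        (\<Sum>\<^sub>\<infinity>k. (cmod (l2inner f (h k)))^2) \<le> B * (l2norm f)^2))"

definition is_dual_frame :: "('k \<Rightarrow> ((real^'n) \<Rightarrow> complex)) \<Rightarrow> ('k \<Rightarrow> ((real^'n) \<Rightarrow> complex)) \<Rightarrow> bool" where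
  "is_dual_frame h ht \<longleftrightarrow> is_frame h \<and> is_frame ht \<and>
     (\<forall>f\<in>sqint. \<forall>e>0. \<exists>F0. finite F0 \<and> (\<forall>F. finite F \<and> F0 \<subseteq> F \<longrightarrow>
        l2norm (\<lambda>x. f x - (\<Sum>k\<in>F. l2inner f (ht k) * h k x)) < e))"

definition lat :: "real \<Rightarrow> int^'n \<Rightarrow> real^'n" where
  "lat s n = (\<chi> i. s * of_int (n $ i))"

definition gabor :: "real \<Rightarrow> real \<Rightarrow> ((real^'n) \<Rightarrow> complex) \<Rightarrow> (int^'n) \<times> (int^'n) \<Rightarrow> ((real^'n) \<Rightarrow> complex)" where
  "gabor \<alpha> \<beta> g mn = TF (lat \<beta> (snd mn), lat (2 * pi * \<alpha>) (fst mn)) g"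

definition box :: "nat \<Rightarrow> (int^'n) set" where
  "box M = {m. \<forall>i. \<bar>m $ i\<bar> \<le> int M}"

definition gabor_avg :: "real \<Rightarrow> real \<Rightarrow> ((real^'n) \<Rightarrow> complex) \<Rightarrow> ((real^'n) \<Rightarrow> complex) \<Rightarrow>
    (((real^'n) \<Rightarrow> complex) \<Rightarrow> ((real^'n) \<Rightarrow> complex)) \<Rightarrow> nat \<Rightarrow> nat \<Rightarrow> complex" where
  "gabor_avg \<alpha> \<beta> g gt T M N =
     complex_of_real (1 / (\<alpha> * \<beta>) ^ CARD('n)) *
     (complex_of_real (1 / ((2 * real M + 1) ^ CARD('n) * (2 * real N + 1) ^ CARD('n))) *
      (\<Sum>m\<in>box M. \<Sum>n\<in>box N.
         l2inner (T (gabor \<alpha> \<beta> g (m, n))) (gabor \<alpha> \<beta> gt (m, n))))"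

definition faithful_tracial_state ::
    "((((real^'n) \<Rightarrow> complex) \<Rightarrow> ((real^'n) \<Rightarrow> complex)) \<Rightarrow> complex) \<Rightarrow> bool" where
  "faithful_tracial_state \<gamma> \<longleftrightarrow>
     (\<forall>S T a b. in_boldA S \<longrightarrow> in_boldA T \<longrightarrow>
        \<gamma> (\<lambda>f x. a * S f x + b * T f x) = a * \<gamma> S + b * \<gamma> T) \<and>
     \<gamma> (\<lambda>f. f) = 1 \<and>
     (\<forall>S T. in_boldA S \<longrightarrow> in_boldA T \<longrightarrow> \<gamma> (S \<circ> T) = \<gamma> (T \<circ> S)) \<and>
     (\<forall>T S. in_boldA T \<longrightarrow> is_adjoint S T \<longrightarrow>
        Im (\<gamma> (S \<circ> T)) = 0 \<and> 0 \<le> Re (\<gamma> (S \<circ> T)) \<and>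
        (\<gamma> (S \<circ> T) = 0 \<longrightarrow> (\<forall>f\<in>sqint. ae_zero (T f))))"

end

theory Submission
  imports Defs
begin

text \<open>
  The trace is \<open>\<gamma>(T) = lim c\<^sub>n(0)\<close> for any operators \<open>\<Sum>\<^sub>\<lambda> c\<^sub>n(\<lambda>) U\<^sub>\<lambda>\<close> converging to \<open>T\<close> in norm. This is
  well defined because conjugating by \<open>U\<^sub>\<mu>\<close> multiplies \<open>U\<^sub>\<lambda>\<close> by a character of \<open>\<mu>\<close>, so averaging
  \<open>\<langle>T U\<^sub>\<mu> f, U\<^sub>\<mu> f\<rangle>\<close> over \<open>\<mu> = kv\<close> with \<open>v\<close> generic isolates \<open>c(0) \<parallel>f\<parallel>\<^sup>2\<close>; in particular
  \<open>\<bar>c(0)\<bar> \<le> \<parallel>T\<parallel>\<close>. The same means give positivity, and together with a pigeonhole recurrence argument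
  faithfulness.

  Averaging instead over the Gabor lattice isolates the \<open>\<lambda>\<close> whose character is trivial on that
  lattice, that is, the adjoint lattice. For those the Wexler--Raz biorthogonality relations
  \<open>\<langle>U\<^sub>\<lambda> g, gt\<rangle> = (\<alpha>\<beta>)\<^sup>d \<delta>\<close> leave only \<open>\<lambda> = 0\<close>.
\<close>

section \<open>Square-integrable functions and time-frequency shifts\<close>

text \<open>Operators are bare maps on representatives, with no linearity assumed. Estimates
  therefore go through finite sums \<open>Fop F c\<close>, which are linear by construction, and the
  class \<open>finitely_approx\<close> of maps approximated by them in norm takes the place of
  \<open>in_boldA\<close>.

  Two limits have to be exchanged, norm approximation and averaging. This works because averages,
  divided by their number of terms, are bounded by the operator norm uniformly in length and
  direction.

  The constant (\<alpha>\<beta>)^d in the Wexler--Raz relations is a product: \<beta>^d is the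
  volume on which the two test functions overlap, and \<alpha>^d is the inverse of the Parseval
  constant of the cube of side 1/\<alpha>. Parseval's identity needs completeness of the
  exponentials on a cube, obtained here from Stone--Weierstrass on the torus.

  Faithfulness hinges on the order of choices. The generic direction depends on the accuracy
  demanded of the trace, while the density of return times must be known before that accuracy is
  set. The recurrence constant therefore has to be uniform over all directions, and the pigeonhole
  argument provides exactly that.\<close>

lemma sqint_borel [measurable_dest]: "f \<in> sqint \<Longrightarrow> f \<in> borel_measurable lebesgue"
  and sqint_integrable: "f \<in> sqint \<Longrightarrow> integrable lebesgue (\<lambda>x. (cmod (f x))\<^sup>2)"
  by (auto simp: sqint_def)

lemma sqintI:
  "f \<in> borel_measurable lebesgue \<Longrightarrow> integrable lebesgue (\<lambda>x. (cmod (f x))\<^sup>2) \<Longrightarrow> f \<in> sqint"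
  by (auto simp: sqint_def)

lemma sqint_bounded_by:
  assumes "f \<in> borel_measurable lebesgue" "integrable lebesgue h" "\<And>x. (cmod (f x))\<^sup>2 \<le> h x"
  shows "f \<in> sqint"
proof (rule sqintI)
  show "integrable lebesgue (\<lambda>x. (cmod (f x))\<^sup>2)"
    by (rule Bochner_Integration.integrable_bound[OF assms(2)])
      (use assms in \<open>auto intro!: AE_I2 intro: order_trans[OF _ abs_ge_self]\<close>)
qed (fact assms(1))

lemma sqint_add:
  assumes f: "f \<in> sqint" and g: "g \<in> sqint" shows "(\<lambda>x. f x + g x) \<in> sqint"
proof (rule sqint_bounded_by[where h="\<lambda>x. 2 * (cmod (f x))\<^sup>2 + 2 * (cmod (g x))\<^sup>2"])
  show "(\<lambda>x. f x + g x) \<in> borel_measurable lebesgue" using f g by measurable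
  show "integrable lebesgue (\<lambda>x. 2 * (cmod (f x))\<^sup>2 + 2 * (cmod (g x))\<^sup>2)"
    using f g by (intro Bochner_Integration.integrable_add integrable_mult_right sqint_integrable)
  fix x
  have "(cmod (f x + g x))\<^sup>2 \<le> (cmod (f x) + cmod (g x))\<^sup>2"
    by (intro power_mono norm_triangle_ineq) auto
  also have "\<dots> \<le> 2 * (cmod (f x))\<^sup>2 + 2 * (cmod (g x))\<^sup>2"
    using sum_squares_bound[of "cmod (f x)" "cmod (g x)"] by (simp add: power2_sum)
  finally show "(cmod (f x + g x))\<^sup>2 \<le> 2 * (cmod (f x))\<^sup>2 + 2 * (cmod (g x))\<^sup>2" .
qed

lemma sqint_cmul: assumes f: "f \<in> sqint" shows "(\<lambda>x. c * f x) \<in> sqint"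
proof (rule sqintI)
  show "(\<lambda>x. c * f x) \<in> borel_measurable lebesgue" using f by measurable
  show "integrable lebesgue (\<lambda>x. (cmod (c * f x))\<^sup>2)"
    using sqint_integrable[OF f] by (simp add: norm_mult power_mult_distrib)
qed

lemma sqint_diff:
  assumes f: "f \<in> sqint" and g: "g \<in> sqint" shows "(\<lambda>x. f x - g x) \<in> sqint"
  using sqint_add[OF f sqint_cmul[OF g, of "-1"]] by simp

lemma sqint_0: "(\<lambda>x. 0) \<in> sqint"
  by (rule sqintI) auto

lemma sqint_sum: "(\<And>k. k \<in> F \<Longrightarrow> f k \<in> sqint) \<Longrightarrow> (\<lambda>x. \<Sum>k\<in>F. f k x) \<in> sqint"
  by (induction F rule: infinite_finite_induct) (auto intro: sqint_0 sqint_add)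

lemma l2inner_integrable:
  assumes f: "f \<in> sqint" and g: "g \<in> sqint"
  shows "integrable lebesgue (\<lambda>x. f x * cnj (g x))"
proof (rule Bochner_Integration.integrable_bound[where f="\<lambda>x. (cmod (f x))\<^sup>2 + (cmod (g x))\<^sup>2"])
  show "integrable lebesgue (\<lambda>x. (cmod (f x))\<^sup>2 + (cmod (g x))\<^sup>2)"
    using f g by (intro Bochner_Integration.integrable_add sqint_integrable)
  show "(\<lambda>x. f x * cnj (g x)) \<in> borel_measurable lebesgue"
    using f g by (intro borel_measurable_times borel_measurable_continuous_on[where f=cnj] continuous_on_cnj continuous_on_id sqint_borel)
  have "norm (f x * cnj (g x)) \<le> norm ((cmod (f x))\<^sup>2 + (cmod (g x))\<^sup>2)" for x
  proof -
    have "cmod (f x) * cmod (g x) \<ge> 0" by simp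
    then have "cmod (f x) * cmod (g x) \<le> (cmod (f x))\<^sup>2 + (cmod (g x))\<^sup>2"
      using sum_squares_bound[of "cmod (f x)" "cmod (g x)"] by linarith
    then show ?thesis by (simp add: norm_mult)
  qed
  then show "AE x in lebesgue. norm (f x * cnj (g x)) \<le> norm ((cmod (f x))\<^sup>2 + (cmod (g x))\<^sup>2)"
    by auto
qed

lemma l2inner_add_left:
  "\<lbrakk>f \<in> sqint; g \<in> sqint; h \<in> sqint\<rbrakk> \<Longrightarrow> l2inner (\<lambda>x. f x + g x) h = l2inner f h + l2inner g h"
  by (simp add: l2inner_def distrib_right l2inner_integrable)

lemma l2inner_diff_left:
  "\<lbrakk>f \<in> sqint; g \<in> sqint; h \<in> sqint\<rbrakk> \<Longrightarrow> l2inner (\<lambda>x. f x - g x) h = l2inner f h - l2inner g h"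
  by (simp add: l2inner_def left_diff_distrib l2inner_integrable)

lemma l2inner_cmul_left: "l2inner (\<lambda>x. c * f x) h = c * l2inner f h"
  by (simp add: l2inner_def mult.assoc)

lemma l2inner_commute: "l2inner g f = cnj (l2inner f g)"
proof -
  have "(LINT x|lebesgue. g x * cnj (f x)) = (LINT x|lebesgue. cnj (f x * cnj (g x)))"
    by (simp add: mult.commute)
  then show ?thesis unfolding l2inner_def by (simp only: Bochner_Integration.integral_cnj)
qed

lemma l2inner_diff_right:
  "\<lbrakk>f \<in> sqint; g \<in> sqint; h \<in> sqint\<rbrakk> \<Longrightarrow> l2inner h (\<lambda>x. f x - g x) = l2inner h f - l2inner h g"
  by (simp add: l2inner_commute[of h] l2inner_diff_left)

lemma l2inner_cmul_right: "l2inner h (\<lambda>x. c * f x) = cnj c * l2inner h f"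
  by (simp add: l2inner_commute[of h] l2inner_cmul_left)

lemma l2inner_sum_left:
  assumes "\<And>k. k \<in> F \<Longrightarrow> f k \<in> sqint" "h \<in> sqint"
  shows "l2inner (\<lambda>x. \<Sum>k\<in>F. f k x) h = (\<Sum>k\<in>F. l2inner (f k) h)"
  using assms(1)
proof (induction F rule: infinite_finite_induct)
  case (insert a F)
  then show ?case
    by (simp add: l2inner_add_left sqint_sum assms(2))
qed (simp_all add: l2inner_def)

lemma l2inner_sum_right:
  assumes "\<And>k. k \<in> F \<Longrightarrow> f k \<in> sqint" "h \<in> sqint"
  shows "l2inner h (\<lambda>x. \<Sum>k\<in>F. f k x) = (\<Sum>k\<in>F. l2inner h (f k))"
  by (simp add: l2inner_commute[of h] l2inner_sum_left assms)

lemma l2norm_nonneg: "0 \<le> l2norm f"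
  by (simp add: l2norm_def)

lemma l2norm_sq: "(l2norm f)\<^sup>2 = (LINT x|lebesgue. (cmod (f x))\<^sup>2)"
  by (simp add: l2norm_def)

lemma l2inner_self: "l2inner f f = complex_of_real ((l2norm f)\<^sup>2)"
  unfolding l2norm_sq l2inner_def complex_norm_square[symmetric] by (rule integral_complex_of_real)

lemma l2norm_cmul: "l2norm (\<lambda>x. c * f x) = cmod c * l2norm f"
  by (simp add: l2norm_def norm_mult power_mult_distrib real_sqrt_mult)

lemma l2norm_diff_sq:
  assumes f: "f \<in> sqint" and g: "g \<in> sqint"
  shows "(l2norm (\<lambda>x. f x - g x))\<^sup>2 = (l2norm f)\<^sup>2 - 2 * Re (l2inner f g) + (l2norm g)\<^sup>2"
proof -
  have "complex_of_real ((l2norm (\<lambda>x. f x - g x))\<^sup>2)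
      = l2inner f f - l2inner f g - (l2inner g f - l2inner g g)"
    unfolding l2inner_self[symmetric] by (simp add: l2inner_diff_left l2inner_diff_right f g sqint_diff)
  also have "\<dots> = (l2norm f)\<^sup>2 - l2inner f g - (cnj (l2inner f g) - (l2norm g)\<^sup>2)"
    using l2inner_commute[of g f] by (simp only: l2inner_self of_real_power)
  finally have "Re (complex_of_real ((l2norm (\<lambda>x. f x - g x))\<^sup>2)) = Re \<dots>" by simp
  then show ?thesis by simp
qed

lemma l2_Cauchy_Schwarz:
  assumes f: "f \<in> sqint" and g: "g \<in> sqint"
  shows "cmod (l2inner f g) \<le> l2norm f * l2norm g"
proof -
  let ?z = "l2inner f g"
  \<comment> \<open>Expand the squared norm of \<open>s f - z g\<close>. Keeping \<open>s\<close>
    free also settles the case of a null \<open>g\<close>; otherwise \<open>s\<close> is taken to be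
    the squared norm of \<open>g\<close>.\<close>
  have main: "2 * s * (cmod ?z)\<^sup>2 \<le> s\<^sup>2 * (l2norm f)\<^sup>2 + (cmod ?z)\<^sup>2 * (l2norm g)\<^sup>2" for s :: real
  proof -
    have zz: "Re (cnj ?z * ?z) = (cmod ?z)\<^sup>2"
      unfolding cmod_power2 by (simp add: power2_eq_square)
    have "0 \<le> (l2norm (\<lambda>x. of_real s * f x - ?z * g x))\<^sup>2" by simp
    also have "\<dots> = s\<^sup>2 * (l2norm f)\<^sup>2 - 2 * s * (cmod ?z)\<^sup>2 + (cmod ?z)\<^sup>2 * (l2norm g)\<^sup>2"
      by (subst l2norm_diff_sq)
        (auto simp: sqint_cmul f g l2norm_cmul l2inner_cmul_left l2inner_cmul_right power_mult_distrib
            mult.assoc zz[simplified])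
    finally show ?thesis by simp
  qed
  show ?thesis
  proof (cases "l2norm g = 0")
    case True
    have "(cmod ?z)\<^sup>2 = 0"
    proof (rule ccontr)
      assume "(cmod ?z)\<^sup>2 \<noteq> 0"
      then have pos: "(cmod ?z)\<^sup>2 > 0" by simp
      define s where "s = (cmod ?z)\<^sup>2 / ((l2norm f)\<^sup>2 + 1)"
      have d: "(l2norm f)\<^sup>2 + 1 > 0" by (simp add: add_nonneg_pos)
      have "s > 0" using pos d by (simp add: s_def)
      have "2 * s * (cmod ?z)\<^sup>2 \<le> s * (s * (l2norm f)\<^sup>2)" using main[of s] True by (simp add: power2_eq_square mult_ac)
      then have "2 * (cmod ?z)\<^sup>2 \<le> s * (l2norm f)\<^sup>2" using \<open>s > 0\<close> by simp
      also have "\<dots> \<le> s * ((l2norm f)\<^sup>2 + 1)" using \<open>s > 0\<close> by simp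
      also have "\<dots> = (cmod ?z)\<^sup>2" using d by (simp add: s_def)
      finally show False using pos by simp
    qed
    then show ?thesis using True by simp
  next
    case False
    then have pos: "(l2norm g)\<^sup>2 > 0" by simp
    have "2 * (l2norm g)\<^sup>2 * (cmod ?z)\<^sup>2 \<le> (l2norm g)\<^sup>2 * ((l2norm g)\<^sup>2 * (l2norm f)\<^sup>2) + (cmod ?z)\<^sup>2 * (l2norm g)\<^sup>2"
      using main[of "(l2norm g)\<^sup>2"] by (simp add: power2_eq_square mult_ac)
    then have "(l2norm g)\<^sup>2 * (cmod ?z)\<^sup>2 \<le> (l2norm g)\<^sup>2 * ((l2norm g)\<^sup>2 * (l2norm f)\<^sup>2)"
      by (simp add: mult_ac)
    then have "(cmod ?z)\<^sup>2 \<le> (l2norm f * l2norm g)\<^sup>2"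
      using mult_le_cancel_left_pos[OF pos] by (simp add: power_mult_distrib mult.commute)
    then show ?thesis
      by (rule power2_le_imp_le) (simp add: l2norm_nonneg)
  qed
qed

lemma l2norm_triangle:
  assumes f: "f \<in> sqint" and g: "g \<in> sqint"
  shows "l2norm (\<lambda>x. f x + g x) \<le> l2norm f + l2norm g"
proof (rule power2_le_imp_le)
  have m: "(\<lambda>x. -1 * g x) \<in> sqint" by (rule sqint_cmul[OF g])
  have "(l2norm (\<lambda>x. f x + g x))\<^sup>2 = (l2norm (\<lambda>x. f x - (-1 * g x)))\<^sup>2" by simp
  also have "\<dots> = (l2norm f)\<^sup>2 + 2 * Re (l2inner f g) + (l2norm g)\<^sup>2"
    by (subst l2norm_diff_sq[OF f m]) (simp add: l2norm_cmul[of "-1", simplified] l2inner_cmul_right[of _ "-1", simplified])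
  also have "\<dots> \<le> (l2norm f)\<^sup>2 + 2 * (l2norm f * l2norm g) + (l2norm g)\<^sup>2"
    using l2_Cauchy_Schwarz[OF f g] complex_Re_le_cmod[of "l2inner f g"] by simp
  finally show "(l2norm (\<lambda>x. f x + g x))\<^sup>2 \<le> (l2norm f + l2norm g)\<^sup>2" by (simp add: power2_sum)
qed (simp add: l2norm_nonneg)

lemma l2norm_minus_commute: "l2norm (\<lambda>x. f x - g x) = l2norm (\<lambda>x. g x - f x)"
  by (simp add: l2norm_def norm_minus_commute)

lemma l2norm_triangle_diff:
  assumes "f \<in> sqint" "g \<in> sqint" "h \<in> sqint"
  shows "l2norm (\<lambda>x. f x - h x) \<le> l2norm (\<lambda>x. f x - g x) + l2norm (\<lambda>x. g x - h x)"
  using l2norm_triangle[OF sqint_diff[OF assms(1,2)] sqint_diff[OF assms(2,3)]] by simp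

lemma l2norm_sum_le:
  assumes "\<And>k. k \<in> F \<Longrightarrow> f k \<in> sqint"
  shows "l2norm (\<lambda>x. \<Sum>k\<in>F. f k x) \<le> (\<Sum>k\<in>F. l2norm (f k))"
  using assms
proof (induction F rule: infinite_finite_induct)
  case (insert a F)
  then have "l2norm (\<lambda>x. f a x + (\<Sum>k\<in>F. f k x)) \<le> l2norm (f a) + l2norm (\<lambda>x. \<Sum>k\<in>F. f k x)"
    by (intro l2norm_triangle sqint_sum) auto
  also have "\<dots> \<le> l2norm (f a) + (\<Sum>k\<in>F. l2norm (f k))" using insert by simp
  finally show ?case using insert by simp
qed (simp_all add: l2norm_def)

lemma l2norm_eq_0:
  assumes "f \<in> sqint" "l2norm f = 0" shows "ae_zero f"
proof -
  have "(LINT x|lebesgue. (cmod (f x))\<^sup>2) = 0" using assms(2) by (simp flip: l2norm_sq)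
  then have "AE x in lebesgue. (cmod (f x))\<^sup>2 = 0"
    by (subst (asm) integral_nonneg_eq_0_iff_AE[OF sqint_integrable[OF assms(1)]]) auto
  then show ?thesis by (simp add: ae_zero_def)
qed

section \<open>Translation invariance and unitarity of time-frequency shifts\<close>

lemma
  fixes t :: "'a :: euclidean_space"
  shows lebesgue_distr_diff: "distr lebesgue lebesgue (\<lambda>x. x - t) = lebesgue"
    and measurable_lebesgue_diff: "(\<lambda>x. x - t) \<in> lebesgue \<rightarrow>\<^sub>M lebesgue"
proof -
  have *: "(\<lambda>x::'a. - t + (\<Sum>j\<in>Basis. (1 * (x \<bullet> j)) *\<^sub>R j)) = (\<lambda>x. x - t)"
    by (simp add: euclidean_representation fun_eq_iff)
  show "(\<lambda>x. x - t) \<in> lebesgue \<rightarrow>\<^sub>M lebesgue"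
    using lebesgue_affine_measurable[of "\<lambda>_. 1" "-t"] unfolding * by simp
  show "distr lebesgue lebesgue (\<lambda>x. x - t) = lebesgue"
    using lebesgue_affine_euclidean[of "\<lambda>_. 1" "-t"] unfolding * by (simp add: density_1)
qed

lemma borel_measurable_lebesgue_shift:
  fixes f :: "'a :: euclidean_space \<Rightarrow> 'b :: topological_space"
  assumes "f \<in> borel_measurable lebesgue" shows "(\<lambda>x. f (x - t)) \<in> borel_measurable lebesgue"
  using measurable_compose[OF measurable_lebesgue_diff assms] .

lemma integral_lebesgue_shift:
  fixes f :: "'a :: euclidean_space \<Rightarrow> 'b :: {banach, second_countable_topology}"
  assumes "f \<in> borel_measurable lebesgue"
  shows "(LINT x|lebesgue. f (x - t)) = (LINT x|lebesgue. f x)"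
  using integral_distr[OF measurable_lebesgue_diff assms, of t] by (simp add: lebesgue_distr_diff)

lemma integrable_lebesgue_shift:
  fixes f :: "'a :: euclidean_space \<Rightarrow> 'b :: {banach, second_countable_topology}"
  assumes "integrable lebesgue f"
  shows "integrable lebesgue (\<lambda>x. f (x - t))"
  using integrable_distr_eq[OF measurable_lebesgue_diff borel_measurable_integrable[OF assms], of t]
    assms by (simp add: lebesgue_distr_diff)

lemma borel_measurable_exp_inner:
  "(\<lambda>x::real^'n. exp (\<i> * complex_of_real (w \<bullet> x))) \<in> borel_measurable lebesgue"
  by (rule measurable_completion) (auto intro!: borel_measurable_continuous_onI continuous_intros)

lemma TF_sqint: assumes "f \<in> sqint" shows "TF l f \<in> sqint"
proof (rule sqintI)
  show "TF l f \<in> borel_measurable lebesgue" unfolding TF_def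
    using assms by (intro borel_measurable_times borel_measurable_exp_inner borel_measurable_lebesgue_shift sqint_borel)
  show "integrable lebesgue (\<lambda>x. (cmod (TF l f x))\<^sup>2)"
    using integrable_lebesgue_shift[OF sqint_integrable[OF assms], of "fst l"] by (simp add: TF_def norm_mult)
qed

lemma l2norm_TF: assumes "f \<in> sqint" shows "l2norm (TF l f) = l2norm f"
  using integral_lebesgue_shift[OF borel_measurable_integrable[OF sqint_integrable[OF assms]], of "fst l"]
  by (simp add: TF_def norm_mult l2norm_def)

lemma exp_i_times_cnj: "exp (\<i> * complex_of_real a) * (z * (cnj (exp (\<i> * complex_of_real a)) * w)) = z * w"
proof -
  have "exp (\<i> * complex_of_real a) * cnj (exp (\<i> * complex_of_real a)) = 1"
    unfolding complex_norm_square[symmetric] by simp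
  moreover have "exp (\<i> * complex_of_real a) * (z * (cnj (exp (\<i> * complex_of_real a)) * w))
      = (exp (\<i> * complex_of_real a) * cnj (exp (\<i> * complex_of_real a))) * (z * w)"
    by (simp only: mult_ac)
  ultimately show ?thesis by simp
qed

lemma l2inner_TF_TF:
  assumes "f \<in> sqint" "h \<in> sqint" shows "l2inner (TF l f) (TF l h) = l2inner f h"
proof -
  have "l2inner (TF l f) (TF l h) = (LINT x|lebesgue. f (x - fst l) * cnj (h (x - fst l)))"
    unfolding l2inner_def TF_def complex_cnj_mult mult.assoc exp_i_times_cnj ..
  also have "\<dots> = l2inner f h"
    unfolding l2inner_def
    by (rule integral_lebesgue_shift[OF borel_measurable_integrable[OF l2inner_integrable[OF assms]]])
  finally show ?thesis .
qed

text \<open>Evaluating the modulation of \<open>l'\<close> at \<open>x - fst l\<close> leaves a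
  constant phase, so the shifts form only a projective representation of phase space. This cocycle
  reappears in \<open>conv0\<close> and \<open>Fop_adj\<close>.\<close>

lemma TF_TF: "TF l (TF l' f) = (\<lambda>x. exp (- \<i> * complex_of_real (snd l' \<bullet> fst l)) * TF (l + l') f x)"
proof
  fix x
  have "exp (\<i> * complex_of_real (snd l \<bullet> x)) * exp (\<i> * complex_of_real (snd l' \<bullet> (x - fst l)))
    = exp (- \<i> * complex_of_real (snd l' \<bullet> fst l)) * exp (\<i> * complex_of_real (snd (l + l') \<bullet> x))"
    unfolding exp_add[symmetric] by (simp add: inner_add_left inner_diff_right algebra_simps)
  moreover have "x - fst l - fst l' = x - fst (l + l')" by simp
  ultimately show "TF l (TF l' f) x = exp (- \<i> * complex_of_real (snd l' \<bullet> fst l)) * TF (l + l') f x"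
    unfolding TF_def by (simp only: mult.assoc[symmetric])
qed

lemma TF_0: "TF 0 f = f"
  by (simp add: TF_def)

text \<open>The standard symplectic form on phase space. For fixed \<open>l\<close> its exponential
  is a character in \<open>m\<close>.\<close>

definition sympl :: "(real^'n) \<times> (real^'n) \<Rightarrow> (real^'n) \<times> (real^'n) \<Rightarrow> real" where
  "sympl l m = snd l \<bullet> fst m - snd m \<bullet> fst l"

lemma TF_commute: "TF l (TF m f) = (\<lambda>x. exp (\<i> * complex_of_real (sympl l m)) * TF m (TF l f) x)"
proof
  fix x
  have "exp (- \<i> * complex_of_real (snd m \<bullet> fst l))
      = exp (\<i> * complex_of_real (sympl l m)) * exp (- \<i> * complex_of_real (snd l \<bullet> fst m))"
    unfolding exp_add[symmetric] by (simp add: sympl_def ring_distribs)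
  then show "TF l (TF m f) x = exp (\<i> * complex_of_real (sympl l m)) * TF m (TF l f) x"
    unfolding TF_TF by (simp add: add.commute[of m l] mult.assoc)
qed

text \<open>Move \<open>TF l\<close> past \<open>TF m\<close> and cancel \<open>TF m\<close> by
  unitarity. Two vectors are kept because the Gabor averages pair \<open>g\<close> with
  \<open>gt\<close>; the orbit means use \<open>f = h\<close>.\<close>

lemma l2inner_TF_conj:
  assumes "f \<in> sqint" "h \<in> sqint"
  shows "l2inner (TF l (TF m f)) (TF m h) = exp (\<i> * complex_of_real (sympl l m)) * l2inner (TF l f) h"
  unfolding TF_commute[of l m] by (simp add: l2inner_cmul_left l2inner_TF_TF TF_sqint assms)

section \<open>Absolutely convergent series of time-frequency shifts\<close>

text \<open>Holds because Lebesgue measure is complete. It makes \<open>Aop c f\<close> measurable,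
  whose defining series is controlled only almost everywhere.\<close>

lemma borel_measurable_lebesgue_AE_eq:
  fixes f g :: "'a::euclidean_space \<Rightarrow> 'b::topological_space"
  assumes f: "f \<in> borel_measurable lebesgue" and ae: "AE x in lebesgue. f x = g x"
  shows "g \<in> borel_measurable lebesgue"
proof (rule measurableI)
  fix A :: "'b set" assume A: "A \<in> sets borel"
  show "g -` A \<inter> space lebesgue \<in> sets lebesgue"
  proof (rule completion.in_sets_AE)
    show "AE x in lebesgue. (x \<in> f -` A \<inter> space lebesgue) = (x \<in> g -` A \<inter> space lebesgue)"
      using ae by eventually_elim auto
    show "f -` A \<inter> space lebesgue \<in> sets lebesgue" using f A by (rule measurable_sets)
  qed auto
qed auto

lemma nn_integral_sqint:
  assumes "f \<in> sqint"
  shows "(\<integral>\<^sup>+x. ennreal ((cmod (f x))\<^sup>2) \<partial>lebesgue) = ennreal ((l2norm f)\<^sup>2)"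
  unfolding l2norm_sq by (rule nn_integral_eq_integral[OF sqint_integrable[OF assms]]) auto

text \<open>Fatou's lemma for squared moduli. It carries norm bounds, and membership in L2 itself,
  from partial sums to a limit known only pointwise almost everywhere.\<close>

lemma l2_Fatou:
  fixes g :: "real^'n \<Rightarrow> complex"
  assumes s: "\<And>n. s n \<in> sqint" and K: "\<And>n. l2norm (s n) \<le> K"
    and lim: "AE x in lebesgue. (\<lambda>n. s n x) \<longlonglongrightarrow> g x"
  shows "g \<in> sqint" "l2norm g \<le> K"
proof -
  have "0 \<le> K" using K[of 0] l2norm_nonneg order_trans by blast
  have meas: "g \<in> borel_measurable lebesgue"
  proof (rule borel_measurable_lebesgue_AE_eq)
    \<comment> \<open>Where the sequence diverges \<open>lim\<close> has an unspecified value, yet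
      the function is measurable and equals \<open>g\<close> almost everywhere.\<close>
    show "(\<lambda>x. lim (\<lambda>n. s n x)) \<in> borel_measurable lebesgue"
      by (rule borel_measurable_lim_metric) (rule sqint_borel[OF s])
    show "AE x in lebesgue. lim (\<lambda>n. s n x) = g x" using lim by eventually_elim (rule limI)
  qed
  have "(\<integral>\<^sup>+x. ennreal ((cmod (g x))\<^sup>2) \<partial>lebesgue)
      = (\<integral>\<^sup>+x. liminf (\<lambda>n. ennreal ((cmod (s n x))\<^sup>2)) \<partial>lebesgue)"
  proof (rule nn_integral_cong_AE)
    show "AE x in lebesgue. ennreal ((cmod (g x))\<^sup>2) = liminf (\<lambda>n. ennreal ((cmod (s n x))\<^sup>2))"
      using lim
    proof eventually_elim
      case (elim x)
      then have "(\<lambda>n. ennreal ((cmod (s n x))\<^sup>2)) \<longlonglongrightarrow> ennreal ((cmod (g x))\<^sup>2)"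
        by (intro tendsto_intros)
      then show ?case by (rule lim_imp_Liminf[OF sequentially_bot, symmetric])
    qed
  qed
  also have "\<dots> \<le> liminf (\<lambda>n. \<integral>\<^sup>+x. ennreal ((cmod (s n x))\<^sup>2) \<partial>lebesgue)"
    by (rule nn_integral_liminf) (use s in measurable)
  also have "\<dots> \<le> ennreal (K\<^sup>2)"
  proof (rule Liminf_le)
    show "\<forall>\<^sub>F n in sequentially. (\<integral>\<^sup>+x. ennreal ((cmod (s n x))\<^sup>2) \<partial>lebesgue) \<le> ennreal (K\<^sup>2)"
      unfolding nn_integral_sqint[OF s]
      by (intro always_eventually allI ennreal_leI power_mono K l2norm_nonneg)
  qed simp
  finally have le: "(\<integral>\<^sup>+x. ennreal ((cmod (g x))\<^sup>2) \<partial>lebesgue) \<le> ennreal (K\<^sup>2)" .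
  have "integrable lebesgue (\<lambda>x. (cmod (g x))\<^sup>2)"
  proof (rule integrableI_bounded)
    show "(\<lambda>x. (cmod (g x))\<^sup>2) \<in> borel_measurable lebesgue" using meas by measurable
    show "(\<integral>\<^sup>+x. ennreal (norm ((cmod (g x))\<^sup>2)) \<partial>lebesgue) < \<infinity>"
      using le by (auto simp: le_less_trans)
  qed
  with meas show g: "g \<in> sqint" by (rule sqintI)
  have "ennreal ((l2norm g)\<^sup>2) \<le> ennreal (K\<^sup>2)" using le by (simp only: nn_integral_sqint[OF g])
  then have "(l2norm g)\<^sup>2 \<le> K\<^sup>2" by simp
  then show "l2norm g \<le> K" using \<open>0 \<le> K\<close> power2_le_imp_le by blast
qed

lemma finite_subset_incseq:
  assumes "incseq G" "finite X" "X \<subseteq> (\<Union>n::nat. G n)" shows "\<exists>n. X \<subseteq> G n"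
  using assms(2,3)
proof (induction X rule: finite_induct)
  case (insert a X)
  then obtain n m where "X \<subseteq> G n" "a \<in> G m" by auto
  moreover have "G n \<subseteq> G (max n m)" "G m \<subseteq> G (max n m)" using assms(1) by (auto simp: incseq_def)
  ultimately show ?case by blast
qed auto

text \<open>The support \<open>F\<close> is carried apart from \<open>c\<close>, so values of
  \<open>c\<close> off \<open>F\<close> do not enter; hence the side condition
  \<open>0 \<in> F\<close> wherever \<open>c 0\<close> is read as a coefficient.\<close>

definition Fop :: "((real^'n) \<times> (real^'n)) set \<Rightarrow> ((real^'n) \<times> (real^'n) \<Rightarrow> complex) \<Rightarrow>
    ((real^'n) \<Rightarrow> complex) \<Rightarrow> ((real^'n) \<Rightarrow> complex)" where
  "Fop F c f = (\<lambda>x. \<Sum>l\<in>F. c l * TF l f x)"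

lemma Fop_sqint: "f \<in> sqint \<Longrightarrow> Fop F c f \<in> sqint"
  unfolding Fop_def by (intro sqint_sum sqint_cmul TF_sqint)

lemma l2norm_Fop_le:
  assumes "f \<in> sqint" shows "l2norm (Fop F c f) \<le> (\<Sum>l\<in>F. cmod (c l)) * l2norm f"
proof -
  have "l2norm (Fop F c f) \<le> (\<Sum>l\<in>F. l2norm (\<lambda>x. c l * TF l f x))"
    unfolding Fop_def by (intro l2norm_sum_le sqint_cmul TF_sqint assms)
  also have "\<dots> = (\<Sum>l\<in>F. cmod (c l)) * l2norm f"
    by (simp add: l2norm_cmul l2norm_TF assms sum_distrib_right)
  finally show ?thesis .
qed

lemma l2norm_norm_of: "l2norm (\<lambda>x. complex_of_real (cmod (f x))) = l2norm f"
  by (simp add: l2norm_def)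

lemma sqint_norm: "f \<in> sqint \<Longrightarrow> (\<lambda>x. complex_of_real (cmod (f x))) \<in> sqint"
  by (rule sqintI) (auto simp: sqint_integrable intro: borel_measurable_of_real sqint_borel)

text \<open>On a null set the defining series of \<^const>\<open>Aop\<close> may diverge, and \<^const>\<open>infsum\<close> is then 0.\<close>

lemma Aop_AE_limit:
  fixes c :: "(real^'n) \<times> (real^'n) \<Rightarrow> complex"
  assumes c: "(\<lambda>l. norm (c l)) summable_on UNIV" and f: "f \<in> sqint"
    and G: "\<And>n. finite (G n)" "incseq G" "{l. c l \<noteq> 0} \<subseteq> (\<Union>n. G n)"
  shows "AE x in lebesgue. (\<lambda>n. Fop (G n) c f x) \<longlonglongrightarrow> Aop c f x"
proof -
  define C where "C = infsum (\<lambda>l. norm (c l)) UNIV"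
  have C: "(\<Sum>l\<in>F. cmod (c l)) \<le> C" if "finite F" for F
    unfolding C_def by (rule finite_sum_le_infsum) (use c that in auto)
  \<comment> \<open>Partial sums of moduli increase with \<open>n\<close> and have L2 norm at most
    \<open>C * l2norm f\<close>. Monotone convergence for their squares makes the supremum finite
    almost everywhere, and at such points the series converges absolutely.\<close>
  define r where "r n x = (\<Sum>l\<in>G n. cmod (c l) * cmod (TF l f x))" for n x
  have r_nonneg: "0 \<le> r n x" for n x by (simp add: r_def sum_nonneg)
  have r_mono: "r m x \<le> r n x" if "m \<le> n" for m n x
    unfolding r_def using G(1,2) that by (intro sum_mono2) (auto simp: incseq_def)
  have r_eq: "complex_of_real (r n x) = (\<Sum>l\<in>G n. of_real (cmod (c l)) * of_real (cmod (TF l f x)))" for n x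
    by (simp add: r_def)
  have r_sq: "(\<lambda>x. complex_of_real (r n x)) \<in> sqint" for n
    unfolding r_eq by (intro sqint_sum sqint_cmul sqint_norm TF_sqint f)
  have r_le: "l2norm (\<lambda>x. complex_of_real (r n x)) \<le> C * l2norm f" for n
  proof -
    have "l2norm (\<lambda>x. complex_of_real (r n x))
       \<le> (\<Sum>l\<in>G n. l2norm (\<lambda>x. of_real (cmod (c l)) * of_real (cmod (TF l f x))))"
      unfolding r_eq by (intro l2norm_sum_le sqint_cmul sqint_norm TF_sqint f)
    also have "\<dots> = (\<Sum>l\<in>G n. cmod (c l)) * l2norm f"
      by (simp add: l2norm_cmul l2norm_norm_of l2norm_TF f sum_distrib_right)
    also have "\<dots> \<le> C * l2norm f" by (intro mult_right_mono C G l2norm_nonneg)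
    finally show ?thesis .
  qed
  have r_meas: "(\<lambda>x. ennreal ((r n x)\<^sup>2)) \<in> borel_measurable lebesgue" for n
  proof -
    have "(\<lambda>x. ennreal ((cmod (complex_of_real (r n x)))\<^sup>2)) \<in> borel_measurable lebesgue"
      using r_sq[of n] by measurable
    then show ?thesis by simp
  qed
  have "(\<integral>\<^sup>+x. (SUP n. ennreal ((r n x)\<^sup>2)) \<partial>lebesgue) = (SUP n. \<integral>\<^sup>+x. ennreal ((r n x)\<^sup>2) \<partial>lebesgue)"
    by (intro nn_integral_monotone_convergence_SUP r_meas incseq_SucI le_funI ennreal_leI power_mono
        r_mono r_nonneg) simp
  also have "\<dots> \<le> ennreal ((C * l2norm f)\<^sup>2)"
  proof (rule SUP_least)
    fix n
    have "(\<integral>\<^sup>+x. ennreal ((r n x)\<^sup>2) \<partial>lebesgue) = ennreal ((l2norm (\<lambda>x. complex_of_real (r n x)))\<^sup>2)"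
      using nn_integral_sqint[OF r_sq[of n]] by simp
    also have "\<dots> \<le> ennreal ((C * l2norm f)\<^sup>2)"
      by (intro ennreal_leI power_mono r_le l2norm_nonneg)
    finally show "(\<integral>\<^sup>+x. ennreal ((r n x)\<^sup>2) \<partial>lebesgue) \<le> ennreal ((C * l2norm f)\<^sup>2)" .
  qed
  finally have "(\<integral>\<^sup>+x. (SUP n. ennreal ((r n x)\<^sup>2)) \<partial>lebesgue) \<noteq> \<infinity>"
    using le_less_trans[OF _ ennreal_less_top] by (simp add: less_top)
  then have "AE x in lebesgue. (SUP n. ennreal ((r n x)\<^sup>2)) \<noteq> \<infinity>"
    by (intro nn_integral_PInf_AE) (use r_meas in measurable)
  then show ?thesis
  proof eventually_elim
    case (elim x)
    define b where "b = enn2real (SUP n. ennreal ((r n x)\<^sup>2))"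
    have rb: "r n x \<le> sqrt b" for n
    proof (rule real_le_rsqrt)
      have "ennreal b = (SUP n. ennreal ((r n x)\<^sup>2))"
        unfolding b_def using elim by (simp only: ennreal_enn2real_if infinity_ennreal_def if_False)
      then have "ennreal ((r n x)\<^sup>2) \<le> ennreal b" by (metis (mono_tags) SUP_upper UNIV_I)
      then show "(r n x)\<^sup>2 \<le> b" by (simp add: b_def)
    qed
    have "(\<lambda>l. norm (c l * TF l f x)) summable_on UNIV"
    proof (rule nonneg_bdd_above_summable_on)
      show "bdd_above (sum (\<lambda>l. norm (c l * TF l f x)) ` {F. F \<subseteq> UNIV \<and> finite F})"
      proof (rule bdd_aboveI2)
        fix F :: "((real^'n) \<times> (real^'n)) set" assume "F \<in> {F. F \<subseteq> UNIV \<and> finite F}"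
        then have "finite F" by simp
        then have "finite {l\<in>F. c l \<noteq> 0}" "{l\<in>F. c l \<noteq> 0} \<subseteq> (\<Union>n. G n)" using G(3) by auto
        then obtain n where n: "{l\<in>F. c l \<noteq> 0} \<subseteq> G n"
          using finite_subset_incseq[OF G(2)] by blast
        have "(\<Sum>l\<in>F. norm (c l * TF l f x)) = (\<Sum>l\<in>{l\<in>F. c l \<noteq> 0}. norm (c l * TF l f x))"
          using \<open>finite F\<close> by (intro sum.mono_neutral_right) auto
        also have "\<dots> \<le> r n x"
          unfolding r_def norm_mult by (rule sum_mono2) (use G(1) n in auto)
        finally show "(\<Sum>l\<in>F. norm (c l * TF l f x)) \<le> sqrt b" using rb[of n] by linarith
      qed
    qed auto
    then have "(\<lambda>l. c l * TF l f x) summable_on UNIV" by (rule abs_summable_summable)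
    then have "(\<lambda>l. c l * TF l f x) summable_on (\<Union>n. G n)" by (rule summable_on_subset) auto
    then have lim: "(sum (\<lambda>l. c l * TF l f x) \<longlongrightarrow> infsum (\<lambda>l. c l * TF l f x) (\<Union>n. G n))
        (finite_subsets_at_top (\<Union>n. G n))"
      by (rule infsum_tendsto)
    have "infsum (\<lambda>l. c l * TF l f x) (\<Union>n. G n) = Aop c f x"
      unfolding Aop_def by (rule infsum_cong_neutral) (use G(3) in auto)
    \<comment> \<open>\<open>G\<close> is cofinal among the finite subsets of its union, so the
      unordered limit restricts to this sequence.\<close>
    moreover have "filterlim G (finite_subsets_at_top (\<Union>n. G n)) sequentially"
      unfolding filterlim_finite_subsets_at_top
    proof (intro allI impI)
      fix X assume X: "finite X \<and> X \<subseteq> (\<Union>n. G n)"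
      then obtain n where "X \<subseteq> G n" using finite_subset_incseq[OF G(2)] by blast
      then have "X \<subseteq> G k" if "k \<ge> n" for k using G(2) that by (auto simp: incseq_def)
      then show "\<forall>\<^sub>F y in sequentially. finite (G y) \<and> X \<subseteq> G y \<and> G y \<subseteq> \<Union> (range G)"
        using G(1) by (auto simp: eventually_sequentially)
    qed
    ultimately show ?case
      using filterlim_compose[OF lim] by (simp add: Fop_def)
  qed
qed

text \<open>Exhaust the support by finite sets \<open>G n\<close> containing \<open>F\<close>. The
  differences of partial sums are finite sums over \<open>G n - F\<close>, of norm at most the tail
  of the coefficients, and \<open>l2_Fatou\<close> transfers the bound to the limit.\<close>

lemma Aop_near_Fop:
  fixes c :: "(real^'n) \<times> (real^'n) \<Rightarrow> complex"
  assumes c: "(\<lambda>l. norm (c l)) summable_on UNIV" and f: "f \<in> sqint" and F: "finite F"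
  shows "Aop c f \<in> sqint"
    and "l2norm (\<lambda>x. Aop c f x - Fop F c f x) \<le> infsum (\<lambda>l. norm (c l)) (- F) * l2norm f"
proof -
  define S where "S = {l. c l \<noteq> 0}"
  \<comment> \<open>An absolutely summable family has countable support, so the exhaustion can be a
    sequence.\<close>
  have S: "countable S" using abs_summable_countable[OF c] by (simp add: S_def)
  define G where "G n = F \<union> {l\<in>S. to_nat_on S l < n}" for n
  have G: "finite (G n)" for n
  proof -
    have "inj_on (to_nat_on S) {l\<in>S. to_nat_on S l < n}"
      using inj_on_to_nat_on[OF S] by (rule inj_on_subset) auto
    then have "finite {l\<in>S. to_nat_on S l < n}"
      by (rule inj_on_finite[where B="{..<n}"]) auto
    then show ?thesis using F by (simp add: G_def)
  qed
  have incG: "incseq G" by (auto simp: incseq_def G_def)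
  have SG: "{l. c l \<noteq> 0} \<subseteq> (\<Union>n. G n)" by (auto simp: G_def S_def)
  note lim = Aop_AE_limit[OF c f G incG SG]
  define K where "K = infsum (\<lambda>l. norm (c l)) (- F)"
  have s: "(\<lambda>x. Fop (G n) c f x - Fop F c f x) = Fop (G n - F) c f" for n
    using F G[of n] by (auto simp: Fop_def fun_eq_iff G_def sum_diff)
  have *: "AE x in lebesgue. (\<lambda>n. Fop (G n - F) c f x) \<longlonglongrightarrow> Aop c f x - Fop F c f x"
    using lim
  proof eventually_elim
    case (elim x)
    then have "(\<lambda>n. Fop (G n) c f x - Fop F c f x) \<longlonglongrightarrow> Aop c f x - Fop F c f x"
      by (intro tendsto_intros)
    then show ?case using s by (simp add: fun_eq_iff)
  qed
  have "l2norm (Fop (G n - F) c f) \<le> K * l2norm f" for n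
  proof -
    have "(\<Sum>l\<in>G n - F. cmod (c l)) \<le> K"
      unfolding K_def by (rule finite_sum_le_infsum) (use G summable_on_subset[OF c] in auto)
    then show ?thesis
      using l2norm_Fop_le[OF f, of "G n - F" c] mult_right_mono[OF _ l2norm_nonneg[of f]] by fastforce
  qed
  note fatou = l2_Fatou[OF Fop_sqint[OF f] this, OF *]
  from fatou(2) show "l2norm (\<lambda>x. Aop c f x - Fop F c f x) \<le> infsum (\<lambda>l. norm (c l)) (- F) * l2norm f"
    by (simp add: K_def)
  show "Aop c f \<in> sqint"
    using sqint_add[OF fatou(1) Fop_sqint[OF f, of F c]] by simp
qed

section \<open>Approximation in operator norm by finite sums\<close>

definition near :: "(((real^'n) \<Rightarrow> complex) \<Rightarrow> ((real^'n) \<Rightarrow> complex)) \<Rightarrow>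
    (((real^'n) \<Rightarrow> complex) \<Rightarrow> ((real^'n) \<Rightarrow> complex)) \<Rightarrow> real \<Rightarrow> bool" where
  "near S T e \<longleftrightarrow> (\<forall>f\<in>sqint. l2norm (\<lambda>x. S f x - T f x) \<le> e * l2norm f)"

definition maps_l2 :: "(((real^'n) \<Rightarrow> complex) \<Rightarrow> ((real^'n) \<Rightarrow> complex)) \<Rightarrow> bool" where
  "maps_l2 T \<longleftrightarrow> (\<forall>f\<in>sqint. T f \<in> sqint)"

text \<open>The working substitute for \<open>in_boldA\<close>: finite sums compose and have
  adjoints by finite algebra, whereas with \<open>Aop\<close> each closure property would require
  rearranging infinite series.\<close>

definition finitely_approx :: "(((real^'n) \<Rightarrow> complex) \<Rightarrow> ((real^'n) \<Rightarrow> complex)) \<Rightarrow> bool" where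
  "finitely_approx T \<longleftrightarrow> maps_l2 T \<and> (\<forall>e>0. \<exists>F c. finite F \<and> 0 \<in> F \<and> near T (Fop F c) e)"

lemma Aop_near_finite:
  assumes c: "(\<lambda>l. norm (c l)) summable_on UNIV" and e: "e > 0"
  shows "\<exists>F. finite F \<and> 0 \<in> F \<and> near (Aop c) (Fop F c) e"
proof -
  have "\<forall>\<^sub>F F in finite_subsets_at_top UNIV.
      dist (sum (\<lambda>l. norm (c l)) F) (infsum (\<lambda>l. norm (c l)) UNIV) < e"
    by (rule tendstoD[OF infsum_tendsto[OF c] e])
  then obtain F0 where F0: "finite F0" "\<And>F. finite F \<Longrightarrow> F0 \<subseteq> F \<Longrightarrow>
      dist (sum (\<lambda>l. norm (c l)) F) (infsum (\<lambda>l. norm (c l)) UNIV) < e"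
    unfolding eventually_finite_subsets_at_top by auto
  define F where "F = insert 0 F0"
  have F: "finite F" and subset_F: "F0 \<subseteq> F" using F0 by (auto simp: F_def)
  have "infsum (\<lambda>l. norm (c l)) (UNIV - F) = infsum (\<lambda>l. norm (c l)) UNIV - sum (\<lambda>l. norm (c l)) F"
    using infsum_Diff[OF c, of F] F by (simp add: summable_on_finite)
  then have "infsum (\<lambda>l. norm (c l)) (- F) \<le> e"
    using F0(2)[OF F] by (simp add: F_def[symmetric] dist_real_def Compl_eq_Diff_UNIV subset_F)
  then have "near (Aop c) (Fop F c) e"
    unfolding near_def
    by (intro ballI order_trans[OF Aop_near_Fop(2)[OF c _ F]] mult_right_mono l2norm_nonneg)
  then show ?thesis using F by (auto simp: F_def)
qed

lemma near_trans:
  assumes "maps_l2 R" "maps_l2 S" "maps_l2 T" "near R S d" "near S T e" shows "near R T (d + e)"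
  unfolding near_def
proof
  fix f :: "real^'a \<Rightarrow> complex" assume f: "f \<in> sqint"
  have "l2norm (\<lambda>x. R f x - T f x) \<le> l2norm (\<lambda>x. R f x - S f x) + l2norm (\<lambda>x. S f x - T f x)"
    using assms(1-3) f by (intro l2norm_triangle_diff) (auto simp: maps_l2_def)
  also have "\<dots> \<le> d * l2norm f + e * l2norm f"
    using assms(4,5) f by (auto simp: near_def intro!: add_mono)
  finally show "l2norm (\<lambda>x. R f x - T f x) \<le> (d + e) * l2norm f" by (simp add: distrib_right)
qed

lemma near_sym: "near S T e \<Longrightarrow> near T S e"
  unfolding near_def l2norm_def by (simp add: norm_minus_commute)

lemma maps_l2_Fop: "maps_l2 (Fop F c)"
  by (simp add: maps_l2_def Fop_sqint)

lemma maps_l2_Aop: "(\<lambda>l. norm (c l)) summable_on UNIV \<Longrightarrow> maps_l2 (Aop c)"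
  unfolding maps_l2_def using Aop_near_Fop(1)[of c _ "{}"] by auto

lemma finitely_approx_Aop: "(\<lambda>l. norm (c l)) summable_on UNIV \<Longrightarrow> finitely_approx (Aop c)"
proof -
  assume c: "(\<lambda>l. norm (c l)) summable_on UNIV"
  have "\<exists>F c'. finite F \<and> 0 \<in> F \<and> near (Aop c) (Fop F c') e" if "e > 0" for e
    using Aop_near_finite[OF c that] by auto
  then show "finitely_approx (Aop c)" by (simp add: finitely_approx_def maps_l2_Aop[OF c])
qed

lemma in_boldA_finitely_approx:
  assumes "in_boldA T" shows "finitely_approx T"
  unfolding finitely_approx_def
proof (intro conjI allI impI)
  show T: "maps_l2 T" using assms by (simp add: in_boldA_def maps_l2_def)
  fix e :: real assume "e > 0"
  then have e: "e / 2 > 0" by simp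
  then obtain c where c: "(\<lambda>l. norm (c l)) summable_on UNIV" "near T (Aop c) (e / 2)"
    using assms unfolding in_boldA_def near_def by metis
  obtain F where F: "finite F" "0 \<in> F" "near (Aop c) (Fop F c) (e / 2)"
    using Aop_near_finite[OF c(1) e] by blast
  have "near T (Fop F c) (e / 2 + e / 2)"
    by (rule near_trans[OF T maps_l2_Aop[OF c(1)] maps_l2_Fop c(2) F(3)])
  then show "\<exists>F c. finite F \<and> 0 \<in> F \<and> near T (Fop F c) e" using F by auto
qed

section \<open>Lattice cubes and characters\<close>

text \<open>Half-open, so that lattice translates partition the space exactly, with no null set to
  discard.\<close>

definition cube :: "real \<Rightarrow> (real^'n) set" where
  "cube L = {x. \<forall>i. 0 \<le> x $ i \<and> x $ i < L}"

lemma cube_sets_borel: "(cube L :: (real^'n) set) \<in> sets borel"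
proof -
  have "cube L = (\<Inter>i. {x::real^'n. 0 \<le> x $ i} \<inter> {x. x $ i < L})" by (auto simp: cube_def)
  moreover have "{x::real^'n. 0 \<le> x $ i} \<in> sets borel" for i
    by (intro borel_closed closed_Collect_le continuous_intros)
  moreover have "{x::real^'n. x $ i < L} \<in> sets borel" for i
    by (intro borel_open open_Collect_less continuous_intros)
  ultimately show ?thesis by (auto intro!: sets.finite_INT)
qed

lemma cube_sets: "(cube L :: (real^'n) set) \<in> sets lebesgue"
  using cube_sets_borel[of L] by (metis sets_completionI_sets sets_lborel)

text \<open>Squeeze the cube between the open and the closed box, whose measures agree.\<close>

lemma cube_measure:
  assumes "0 \<le> L"
  shows "measure lebesgue (cube L :: (real^'n) set) = L ^ CARD('n)" and "(cube L :: (real^'n) set) \<in> lmeasurable"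
proof -
  have sub: "Topology_Euclidean_Space.box 0 (\<chi> i. L) \<subseteq> (cube L :: (real^'n) set)" "cube L \<subseteq> cbox 0 (\<chi> i::'n. L)"
    by (auto simp: cube_def mem_box_cart less_imp_le)
  show lm: "(cube L :: (real^'n) set) \<in> lmeasurable"
    using sub(2) cube_sets by (rule fmeasurableI2[OF lmeasurable_cbox])
  have basis: "(\<chi> i::'n. L) \<bullet> b = L" if "b \<in> Basis" for b
    using that by (auto simp: Basis_vec_def inner_axis)
  have c: "measure lebesgue (cbox 0 (\<chi> i::'n. L)) = L ^ CARD('n)"
    using assms by (simp add: measure_completion measure_lborel_cbox_eq basis)
  have b: "measure lebesgue (Topology_Euclidean_Space.box 0 (\<chi> i::'n. L)) = L ^ CARD('n)"
    using assms by (simp add: measure_completion measure_lborel_box_eq basis)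
  have "measure lebesgue (Topology_Euclidean_Space.box 0 (\<chi> i::'n. L)) \<le> measure lebesgue (cube L :: (real^'n) set)"
    by (rule measure_mono_fmeasurable[OF sub(1) _ lm]) simp
  moreover have "measure lebesgue (cube L :: (real^'n) set) \<le> measure lebesgue (cbox 0 (\<chi> i::'n. L))"
    by (rule measure_mono_fmeasurable[OF sub(2) cube_sets]) simp
  ultimately show "measure lebesgue (cube L :: (real^'n) set) = L ^ CARD('n)" unfolding b c by simp
qed

lemma lat_add: "lat s (m + n) = lat s m + lat s n"
  by (simp add: lat_def vec_eq_iff distrib_left)

lemma lat_minus: "lat s (- n) = - lat s n"
  by (simp add: lat_def vec_eq_iff)

lemma lat_0: "lat s 0 = 0"
  by (simp add: lat_def vec_eq_iff)

lemma lattice_tiling: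
  assumes "L > 0" shows "\<exists>!n. x + lat L n \<in> cube L"
proof -
  have *: "x + lat L n \<in> cube L \<longleftrightarrow> (\<forall>i. n $ i = - \<lfloor>x $ i / L\<rfloor>)" for n
  proof -
    have "0 \<le> x $ i + L * of_int (n $ i) \<and> x $ i + L * of_int (n $ i) < L \<longleftrightarrow> \<lfloor>x $ i / L\<rfloor> = - n $ i" for i
      unfolding floor_eq_iff using assms by (auto simp: field_simps)
    then show ?thesis by (auto simp: cube_def lat_def)
  qed
  show ?thesis
    by (rule ex1I[of _ "\<chi> i. - \<lfloor>x $ i / L\<rfloor>"]) (auto simp: * vec_eq_iff)
qed

lemma infinite_int_vec: "infinite (UNIV :: (int^'n) set)"
proof -
  have "inj (\<lambda>k::int. (\<chi> i. k) :: int^'n)" by (auto simp: inj_def vec_eq_iff)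
  then have "infinite (range (\<lambda>k::int. (\<chi> i. k) :: int^'n))" 
    by (metis finite_imageD infinite_UNIV_int)
  then show ?thesis using finite_subset[OF subset_UNIV] by auto
qed

text \<open>Countable additivity gives a series along one enumeration only. Bounding all finite sums
  of norms by the integral of the norm of \<open>f\<close> gives unordered summability, and the
  enumeration then identifies the value.\<close>

lemma has_sum_integral_partition:
  fixes f :: "'a::euclidean_space \<Rightarrow> complex" and A :: "int^'n \<Rightarrow> 'a set"
  assumes f: "integrable lebesgue f" and A: "\<And>n. A n \<in> sets lebesgue"
    and part: "\<And>x. \<exists>!n. x \<in> A n"
  shows "((\<lambda>n. LINT x|lebesgue. indicator (A n) x * f x) has_sum (LINT x|lebesgue. f x)) UNIV"
proof -
  define h where "h n = (LINT x|lebesgue. indicator (A n) x * f x)" for n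
  have h_scale: "h n = (LINT x:A n|lebesgue. f x)" for n
    unfolding h_def set_lebesgue_integral_def by (rule Bochner_Integration.integral_cong) (auto simp: indicator_def)
  have disj: "A m \<inter> A n = {}" if "m \<noteq> n" for m n using part that by blast
  have int: "set_integrable lebesgue (A n) f" for n
    unfolding set_integrable_def by (rule integrable_mult_indicator[OF A f])
  have "(\<lambda>n. norm (h n)) summable_on UNIV"
  proof (rule nonneg_bdd_above_summable_on)
    show "bdd_above (sum (\<lambda>n. norm (h n)) ` {F. F \<subseteq> UNIV \<and> finite F})"
    proof (rule bdd_aboveI2)
      fix F :: "(int^'n) set" assume "F \<in> {F. F \<subseteq> UNIV \<and> finite F}"
      then have F: "finite F" by simp
      have "(\<Sum>n\<in>F. norm (h n)) \<le> (\<Sum>n\<in>F. LINT x|lebesgue. indicator (A n) x * norm (f x))"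
        unfolding h_def
      proof (intro sum_mono)
        fix n
        have "norm (LINT x|lebesgue. indicator (A n) x * f x) \<le> (LINT x|lebesgue. norm (indicator (A n) x * f x))"
          by (rule integral_norm_bound)
        also have "\<dots> = (LINT x|lebesgue. indicator (A n) x * norm (f x))"
          by (rule Bochner_Integration.integral_cong) (auto simp: indicator_def)
        finally show "norm (LINT x|lebesgue. indicator (A n) x * f x) \<le> (LINT x|lebesgue. indicator (A n) x * norm (f x))" .
      qed
      also have "\<dots> = (LINT x|lebesgue. (\<Sum>n\<in>F. indicator (A n) x * norm (f x)))"
        using integrable_mult_indicator[OF A integrable_norm[OF f]]
        by (subst Bochner_Integration.integral_sum) auto
      also have "\<dots> \<le> (LINT x|lebesgue. norm (f x))"
      proof (rule integral_mono)
        show "integrable lebesgue (\<lambda>x. \<Sum>n\<in>F. indicat_real (A n) x * norm (f x))"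
          using integrable_mult_indicator[OF A integrable_norm[OF f]]
          by (intro Bochner_Integration.integrable_sum) simp
        show "integrable lebesgue (\<lambda>x. norm (f x))" using f by simp
        fix x
        obtain n0 where n0: "\<And>n. x \<in> A n \<Longrightarrow> n = n0" using part[of x] by auto
        have "(\<Sum>n\<in>F. indicat_real (A n) x) \<le> (\<Sum>n\<in>F. if n = n0 then 1 else 0)"
          using n0 by (intro sum_mono) (auto simp: indicator_def)
        also have "\<dots> \<le> 1" using F by (simp add: sum.delta)
        finally have "(\<Sum>n\<in>F. indicat_real (A n) x) * norm (f x) \<le> 1 * norm (f x)"
          by (intro mult_right_mono) auto
        then show "(\<Sum>n\<in>F. indicat_real (A n) x * norm (f x)) \<le> norm (f x)" by (simp add: sum_distrib_right)
      qed
      finally show "(\<Sum>n\<in>F. norm (h n)) \<le> (LINT x|lebesgue. norm (f x))" .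
    qed
  qed auto
  then have hs: "(h has_sum infsum h UNIV) UNIV"
    using abs_summable_summable has_sum_infsum by blast
  define e where "e = from_nat_into (UNIV :: (int^'n) set)"
  have e: "bij_betw e UNIV UNIV"
    unfolding e_def by (rule bij_betw_from_nat_into[OF _ infinite_int_vec]) simp
  have "((\<lambda>k. h (e k)) has_sum infsum h UNIV) UNIV"
    using hs by (simp only: has_sum_reindex_bij_betw[OF e])
  then have "(\<lambda>k. h (e k)) sums infsum h UNIV" by (rule has_sum_imp_sums)
  moreover have "(\<Sum>k. h (e k)) = (LINT x|lebesgue. f x)"
  proof -
    have U: "(\<Union>k. A (e k)) = UNIV"
    proof -
      have "(\<Union>k. A (e k)) = (\<Union>n\<in>range e. A n)" by blast
      also have "\<dots> = UNIV" using e ex1_implies_ex[OF part] by (auto simp: bij_betw_def)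
      finally show ?thesis .
    qed
    have "(LINT x:(\<Union>k. A (e k))|lebesgue. f x) = (\<Sum>k. (LINT x:A (e k)|lebesgue. f x))"
    proof (rule lebesgue_integral_countable_add)
      show "A (e i) \<inter> A (e j) = {}" if "i \<noteq> j" for i j
        using that e by (intro disj) (auto simp: bij_betw_def inj_eq)
      show "set_integrable lebesgue (\<Union>k. A (e k)) f"
        unfolding U using f by (simp add: set_integrable_def)
    qed (rule A)
    then show ?thesis unfolding U h_scale by (simp add: set_lebesgue_integral_def)
  qed
  ultimately have "infsum h UNIV = (LINT x|lebesgue. f x)" by (simp add: sums_iff)
  then show ?thesis using hs unfolding h_def by simp
qed

lemma has_sum_uminus_index:
  fixes f :: "'a::group_add \<Rightarrow> 'b::{comm_monoid_add, topological_space}"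
  shows "((\<lambda>n. f (- n)) has_sum s) UNIV \<longleftrightarrow> (f has_sum s) UNIV"
  by (rule has_sum_reindex_bij_betw) (auto intro!: bij_betwI[where g=uminus])

lemma cube_vimage_sets: "{x. x - t \<in> cube L} \<in> sets (lebesgue :: (real^'n) measure)"
  using measurable_sets[OF measurable_lebesgue_diff cube_sets, of t L] by (simp add: vimage_def)

lemma tiling_shifted:
  fixes f :: "real^'n \<Rightarrow> complex"
  assumes L: "L > 0" and f: "integrable lebesgue f"
  shows "((\<lambda>n. LINT x|lebesgue. indicator (cube L) (x - s - lat L n) * f x) has_sum (LINT x|lebesgue. f x)) UNIV"
proof -
  have "((\<lambda>n. LINT x|lebesgue. indicator {x. x - (s - lat L n) \<in> cube L} x * f x) has_sum (LINT x|lebesgue. f x)) UNIV"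
  proof (rule has_sum_integral_partition[OF f cube_vimage_sets])
    fix x show "\<exists>!n. x \<in> {x. x - (s - lat L n) \<in> cube L}"
      using lattice_tiling[OF L, of "x - s"] by (simp add: algebra_simps)
  qed
  then have "((\<lambda>n. LINT x|lebesgue. indicator (cube L) (x - s - lat L (- n)) * f x) has_sum (LINT x|lebesgue. f x)) UNIV"
    by (simp add: lat_minus indicator_def algebra_simps)
  then show ?thesis
    using has_sum_uminus_index[of "\<lambda>n. LINT x|lebesgue. indicator (cube L) (x - s - lat L n) * f x"] by simp
qed

text \<open>Translation invariance moves each cell of the partition back to one fixed cube; this is
  the unfolding step familiar from Poisson summation.\<close>

lemma tiling_unfold:
  fixes f :: "real^'n \<Rightarrow> complex"
  assumes L: "L > 0" and f: "integrable lebesgue f"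
  shows "((\<lambda>n. LINT x|lebesgue. indicator (cube L) x * f (x - lat L n)) has_sum (LINT x|lebesgue. f x)) UNIV"
proof -
  have "(LINT x|lebesgue. indicator (cube L) x * f (x - lat L n)) = (LINT x|lebesgue. indicator (cube L) (x - 0 - lat L (- n)) * f x)" for n
  proof -
    have m: "(\<lambda>x. indicator (cube L) x * f (x - lat L n)) \<in> borel_measurable lebesgue"
      using cube_sets by (intro borel_measurable_times borel_measurable_indicator borel_measurable_lebesgue_shift
          borel_measurable_integrable[OF f])
    show ?thesis using integral_lebesgue_shift[OF m, of "- lat L n"] by (simp add: lat_minus)
  qed
  then show ?thesis
    using tiling_shifted[OF L f, of 0]
      has_sum_uminus_index[of "\<lambda>n. LINT x|lebesgue. indicator (cube L) (x - 0 - lat L n) * f x"] by simp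
qed

section \<open>Characters and their orthogonality on a cube\<close>

definition chr :: "real^'n \<Rightarrow> real^'n \<Rightarrow> complex" where
  "chr w x = exp (\<i> * complex_of_real (w \<bullet> x))"

lemma chr_add_right: "chr w (x + y) = chr w x * chr w y"
  by (simp add: chr_def inner_add_right distrib_left exp_add)

lemma chr_add_left: "chr (v + w) x = chr v x * chr w x"
  by (simp add: chr_def inner_add_left distrib_left exp_add)

lemma chr_0: "chr 0 x = 1"
  by (simp add: chr_def)

lemma chr_minus_right: "chr w (- x) = cnj (chr w x)"
  by (simp add: chr_def exp_cnj)

lemma chr_minus_left: "chr (- w) x = cnj (chr w x)"
  by (simp add: chr_def exp_cnj)

lemma norm_chr [simp]: "cmod (chr w x) = 1"
  by (simp add: chr_def)

lemma chr_diff_right: "chr w (x - y) = chr w x * cnj (chr w y)"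
  using chr_add_right[of w x "- y"] by (simp add: chr_minus_right)

lemma borel_measurable_chr: "chr w \<in> borel_measurable lebesgue"
  unfolding chr_def by (rule borel_measurable_exp_inner)

lemma lat_inner: "lat a m \<bullet> lat b n = a * b * of_int (\<Sum>i\<in>UNIV. m $ i * n $ i)"
  by (simp add: lat_def inner_vec_def sum_distrib_left mult_ac)

lemma chr_lat_period:
  assumes "a * b = 2 * pi" shows "chr (lat a m) (lat b n) = 1"
proof -
  have "exp (\<i> * complex_of_real (2 * pi * of_int k)) = 1" for k
    unfolding exp_eq_1 by (auto simp: mult_ac)
  then show ?thesis unfolding chr_def lat_inner assms .
qed

text \<open>For \<open>m \<noteq> 0\<close> translate the cube by half a period in a coordinate
  where \<open>m\<close> is nonzero. Periodicity preserves the integral while the character changes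
  sign, so the integral is its own negative.\<close>

lemma integral_cube_chr:
  fixes m :: "int^'n"
  assumes L: "L > 0"
  shows "(LINT x|lebesgue. indicator (cube L) x * chr (lat (2 * pi / L) m) x) = (if m = 0 then of_real (L ^ CARD('n)) else 0)"
proof (cases "m = 0")
  case True
  have "(LINT x|lebesgue. indicator (cube L :: (real^'n) set) x :: complex) =
      (LINT x|lebesgue. complex_of_real (indicator (cube L :: (real^'n) set) x))"
    by (rule Bochner_Integration.integral_cong) (auto simp: indicator_def)
  also have "\<dots> = of_real (L ^ CARD('n))"
    unfolding integral_complex_of_real using cube_measure(1)[of L, where 'n='n] L by simp
  finally show ?thesis using True by (simp add: lat_0 chr_0)
next
  case False
  then obtain i where i: "m $ i \<noteq> 0" by (auto simp: vec_eq_iff)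
  let ?w = "lat (2 * pi / L) m"
  define s :: "real^'n" where "s = axis i (L / (2 * of_int (m $ i)))"
  have "?w \<bullet> s = pi" using i L by (simp add: s_def inner_axis lat_def)
  then have cs: "chr ?w s = - 1" by (simp add: chr_def mult.commute)
  define I where "I = (LINT x|lebesgue. indicator (cube L) x * chr ?w x)"
  have per: "chr ?w (lat L n) = 1" for n using L by (intro chr_lat_period) auto
  have int: "integrable lebesgue (\<lambda>x. indicator (cube L) (x - t) * chr ?w x)" for t
  proof (rule Bochner_Integration.integrable_bound)
    show "integrable lebesgue (\<lambda>x. indicat_real (cube L) (x - t))"
      using cube_measure(2)[of L, where 'n='n] L
      by (intro integrable_lebesgue_shift) (simp add: lmeasurable_iff_integrable)
    show "(\<lambda>x. indicator (cube L) (x - t) * chr ?w x) \<in> borel_measurable lebesgue"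
      using cube_sets by (intro borel_measurable_times borel_measurable_chr
          borel_measurable_lebesgue_shift[where f="indicator (cube L)"] borel_measurable_indicator)
  qed (auto simp: norm_mult indicator_def)
  \<comment> \<open>The integral over the shifted cube is unfolded onto the cube, the one over the
    cube itself is cut along the translates shifted by \<open>s\<close>; periodicity makes the two
    series equal term by term.\<close>
  have "((\<lambda>n. LINT x|lebesgue. indicator (cube L) x * (indicator (cube L) (x - lat L n - s) * chr ?w (x - lat L n)))
      has_sum (LINT x|lebesgue. indicator (cube L) (x - s) * chr ?w x)) UNIV"
    by (rule tiling_unfold[OF L int])
  moreover have "((\<lambda>n. LINT x|lebesgue. indicator (cube L) (x - s - lat L n) * (indicator (cube L) (x - 0) * chr ?w x))
      has_sum (LINT x|lebesgue. indicator (cube L) (x - 0) * chr ?w x)) UNIV"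
    by (rule tiling_shifted[OF L int])
  moreover have "indicator (cube L) x * (indicator (cube L) (x - lat L n - s) * chr ?w (x - lat L n))
      = indicator (cube L) (x - s - lat L n) * (indicator (cube L) (x - 0) * chr ?w x)" for x n
  proof -
    have eq: "x - lat L n - s = x - s - lat L n" by simp
    show ?thesis unfolding eq by (simp add: chr_diff_right per)
  qed
  ultimately have "(LINT x|lebesgue. indicator (cube L) (x - s) * chr ?w x) = I"
    unfolding I_def by (simp add: has_sum_unique)
  moreover have "(LINT x|lebesgue. indicator (cube L) (x - s) * chr ?w x) = (LINT x|lebesgue. indicator (cube L) x * chr ?w (x + s))"
    using integral_lebesgue_shift[OF borel_measurable_integrable[OF int[of s]], of "- s"] by simp
  ultimately have "I = - I"
    unfolding chr_add_right cs I_def by simp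
  then show ?thesis using False by (simp add: I_def)
qed

definition cube_chr :: "real \<Rightarrow> int^'n \<Rightarrow> real^'n \<Rightarrow> complex" where
  "cube_chr L m x = indicator (cube L) x * chr (lat (2 * pi / L) m) x"

lemma indicator_cube_sqint:
  assumes "L > 0" shows "(\<lambda>x. indicator (cube L) x :: complex) \<in> sqint"
proof (rule sqintI)
  show "(\<lambda>x. indicator (cube L) x :: complex) \<in> borel_measurable lebesgue"
    using cube_sets by (rule borel_measurable_indicator)
  have *: "(\<lambda>x. (cmod (indicator (cube L) x))\<^sup>2) = indicat_real (cube L)" by (auto simp: indicator_def)
  show "integrable lebesgue (\<lambda>x. (cmod (indicator (cube L) x))\<^sup>2)"
    unfolding * using cube_measure(2)[of L] assms by (simp add: lmeasurable_iff_integrable)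
qed

lemma sqint_mult_bounded:
  assumes f: "f \<in> sqint" and h: "h \<in> borel_measurable lebesgue" and b: "\<And>x. cmod (h x) \<le> B"
  shows "(\<lambda>x. f x * h x) \<in> sqint"
proof (rule sqint_bounded_by[where h="\<lambda>x. B\<^sup>2 * (cmod (f x))\<^sup>2"])
  show "(\<lambda>x. f x * h x) \<in> borel_measurable lebesgue" using f h by measurable
  show "integrable lebesgue (\<lambda>x. B\<^sup>2 * (cmod (f x))\<^sup>2)" using sqint_integrable[OF f] by simp
  fix x
  show "(cmod (f x * h x))\<^sup>2 \<le> B\<^sup>2 * (cmod (f x))\<^sup>2"
    using mult_right_mono[OF power_mono[OF b[of x], of 2], of "(cmod (f x))\<^sup>2"]
    by (simp add: norm_mult power_mult_distrib mult.commute)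
qed

lemma cube_chr_sqint: "L > 0 \<Longrightarrow> cube_chr L m \<in> sqint"
  unfolding cube_chr_def by (intro sqint_mult_bounded[where B=1] indicator_cube_sqint borel_measurable_chr) auto

lemma l2inner_cube_chr:
  fixes m m' :: "int^'n"
  assumes L: "L > 0"
  shows "l2inner (cube_chr L m) (cube_chr L m') = (if m = m' then of_real (L ^ CARD('n)) else 0)"
proof -
  have "cube_chr L m x * cnj (cube_chr L m' x) = indicator (cube L) x * chr (lat (2 * pi / L) (m + - m')) x" for x
    unfolding lat_add chr_add_left lat_minus chr_minus_left by (auto simp: cube_chr_def indicator_def)
  then have "l2inner (cube_chr L m) (cube_chr L m') = (LINT x|lebesgue. indicator (cube L) x * chr (lat (2 * pi / L) (m + - m')) x)"
    unfolding l2inner_def by simp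
  also have "\<dots> = (if m = m' then of_real (L ^ CARD('n)) else 0)"
    unfolding integral_cube_chr[OF L] by simp
  finally show ?thesis .
qed

section \<open>Density of trigonometric polynomials\<close>

lemma l2_dominated_convergence:
  fixes b :: "real^'n \<Rightarrow> complex"
  assumes s: "\<And>n. s n \<in> borel_measurable lebesgue" and b: "b \<in> borel_measurable lebesgue" and w: "w \<in> sqint"
    and lim: "AE x in lebesgue. (\<lambda>n. s n x) \<longlonglongrightarrow> b x"
    and sw: "\<And>n x. cmod (s n x) \<le> cmod (w x)" and bw: "\<And>x. cmod (b x) \<le> cmod (w x)"
  shows "(\<lambda>n. l2norm (\<lambda>x. b x - s n x)) \<longlonglongrightarrow> 0"
proof -
  have "(\<lambda>n. LINT x|lebesgue. (cmod (b x - s n x))\<^sup>2) \<longlonglongrightarrow> (LINT x|(lebesgue :: (real^'n) measure). (0::real))"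
  proof (rule integral_dominated_convergence[where w="\<lambda>x. 4 * (cmod (w x))\<^sup>2"])
    show "(\<lambda>x. (cmod (b x - s n x))\<^sup>2) \<in> borel_measurable lebesgue" for n using s b by measurable
    show "integrable lebesgue (\<lambda>x. 4 * (cmod (w x))\<^sup>2)" using sqint_integrable[OF w] by simp
    show "AE x in lebesgue. (\<lambda>n. (cmod (b x - s n x))\<^sup>2) \<longlonglongrightarrow> 0"
      using lim
    proof eventually_elim
      case (elim x)
      have "(\<lambda>n. (cmod (b x - s n x))\<^sup>2) \<longlonglongrightarrow> (cmod (b x - b x))\<^sup>2" by (intro tendsto_intros elim)
      then show ?case by simp
    qed
    fix n
    have "norm ((cmod (b x - s n x))\<^sup>2) \<le> 4 * (cmod (w x))\<^sup>2" for x
    proof -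
      have "cmod (b x - s n x) \<le> 2 * cmod (w x)"
        using norm_triangle_ineq4[of "b x" "s n x"] sw[of n x] bw[of x] by linarith
      then have "(cmod (b x - s n x))\<^sup>2 \<le> (2 * cmod (w x))\<^sup>2" by (rule power_mono) simp
      then show ?thesis by (simp add: power_mult_distrib)
    qed
    then show "AE x in lebesgue. norm ((cmod (b x - s n x))\<^sup>2) \<le> 4 * (cmod (w x))\<^sup>2" by simp
  qed simp
  then have "(\<lambda>n. sqrt (LINT x|lebesgue. (cmod (b x - s n x))\<^sup>2)) \<longlonglongrightarrow> sqrt 0"
    by (intro tendsto_intros) simp
  then show ?thesis by (simp add: l2norm_def)
qed

definition trigpoly :: "real \<Rightarrow> (real^'n \<Rightarrow> complex) \<Rightarrow> bool" where
  "trigpoly L q \<longleftrightarrow> (\<exists>F c. finite F \<and> q = (\<lambda>x. \<Sum>m\<in>F. c m * chr (lat (2 * pi / L) m) x))"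

lemma trigpoly_monom: "trigpoly L (\<lambda>x. a * chr (lat (2 * pi / L) m) x)"
  unfolding trigpoly_def by (intro exI[of _ "{m}"] exI[of _ "\<lambda>_. a"]) simp

lemma trigpoly_const: "trigpoly L (\<lambda>x. a)"
  using trigpoly_monom[of L a 0] by (simp add: lat_0 chr_0)

lemma trigpoly_add:
  fixes p :: "real^'n \<Rightarrow> complex"
  assumes "trigpoly L p" "trigpoly L q" shows "trigpoly L (\<lambda>x. p x + q x)"
proof -
  obtain F c where F: "finite F" and p: "p = (\<lambda>x. \<Sum>m\<in>F. c m * chr (lat (2 * pi / L) m) x)"
    using assms(1) unfolding trigpoly_def by auto
  obtain G d where G: "finite G" and q: "q = (\<lambda>x. \<Sum>m\<in>G. d m * chr (lat (2 * pi / L) m) x)"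
    using assms(2) unfolding trigpoly_def by auto
  define e where "e m = (if m \<in> F then c m else 0) + (if m \<in> G then d m else 0)" for m
  have "p x + q x = (\<Sum>m\<in>F \<union> G. e m * chr (lat (2 * pi / L) m) x)" for x
  proof -
    have "p x = (\<Sum>m\<in>F \<union> G. (if m \<in> F then c m else 0) * chr (lat (2 * pi / L) m) x)"
      unfolding p using F G by (intro sum.mono_neutral_cong_left) auto
    moreover have "q x = (\<Sum>m\<in>F \<union> G. (if m \<in> G then d m else 0) * chr (lat (2 * pi / L) m) x)"
      unfolding q using F G by (intro sum.mono_neutral_cong_left) auto
    ultimately show ?thesis by (simp only: e_def distrib_right sum.distrib)
  qed
  then show ?thesis unfolding trigpoly_def using F G by (intro exI[of _ "F \<union> G"] exI[of _ e]) auto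
qed

lemma trigpoly_sum: "(\<And>k. k \<in> K \<Longrightarrow> trigpoly L (p k)) \<Longrightarrow> trigpoly L (\<lambda>x. \<Sum>k\<in>K. p k x)"
  by (induction K rule: infinite_finite_induct) (auto intro: trigpoly_add trigpoly_const)

lemma trigpoly_mult:
  fixes p :: "real^'n \<Rightarrow> complex"
  assumes "trigpoly L p" "trigpoly L q" shows "trigpoly L (\<lambda>x. p x * q x)"
proof -
  obtain F c where F: "finite F" and p: "p = (\<lambda>x. \<Sum>m\<in>F. c m * chr (lat (2 * pi / L) m) x)"
    using assms(1) unfolding trigpoly_def by auto
  obtain G d where G: "finite G" and q: "q = (\<lambda>x. \<Sum>m\<in>G. d m * chr (lat (2 * pi / L) m) x)"
    using assms(2) unfolding trigpoly_def by auto
  have "p x * q x = (\<Sum>m\<in>F. \<Sum>n\<in>G. (c m * d n) * chr (lat (2 * pi / L) (m + n)) x)" for x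
    unfolding p q sum_product by (simp add: lat_add chr_add_left mult_ac)
  then show ?thesis by (simp add: trigpoly_sum trigpoly_monom)
qed

section \<open>Stone--Weierstrass on the torus\<close>

text \<open>The quotient of space by the lattice of mesh \<open>L\<close>, realized as a compact set
  in complex coordinates so that polynomial approximation on compact sets applies.\<close>

definition torus_map :: "real \<Rightarrow> real^'n \<Rightarrow> complex^'n" where
  "torus_map L x = (\<chi> i. exp (\<i> * complex_of_real (2 * pi / L * x $ i)))"

lemma torus_map_chr:
  "torus_map L x $ i = chr (lat (2 * pi / L) (axis i 1)) x"
proof -
  have "lat (2 * pi / L) (axis i 1) = axis i (2 * pi / L)" by (auto simp: lat_def vec_eq_iff axis_def)
  then show ?thesis by (simp add: torus_map_def chr_def inner_axis')
qed

lemma trigpoly_cnj_torus: "trigpoly L (\<lambda>x. cnj (torus_map L x $ i))"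
  unfolding torus_map_chr chr_minus_left[symmetric] lat_minus[symmetric]
  using trigpoly_monom[of L 1] by simp

lemma trigpoly_torus: "trigpoly L (\<lambda>x. torus_map L x $ i)"
  unfolding torus_map_chr using trigpoly_monom[of L 1] by simp

text \<open>Euler's formulas: real and imaginary parts of a coordinate are combinations of
  exponentials of frequency plus and minus one.\<close>

lemma trigpoly_torus_basis:
  assumes "b \<in> Basis" shows "trigpoly L (\<lambda>x. complex_of_real (torus_map L x \<bullet> b))"
proof -
  obtain i u where b: "b = axis i u" and u: "u = 1 \<or> u = \<i>"
    using assms by (auto simp: Basis_vec_def Basis_complex_def)
  from u show ?thesis
  proof
    assume "u = 1"
    then have "complex_of_real (torus_map L x \<bullet> b) = 1/2 * (torus_map L x $ i + cnj (torus_map L x $ i))" for x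
      by (simp add: b inner_axis inner_complex_def complex_eq_iff)
    then show ?thesis
      by (simp only:) (intro trigpoly_mult trigpoly_const trigpoly_add trigpoly_torus trigpoly_cnj_torus)
  next
    assume "u = \<i>"
    then have "complex_of_real (torus_map L x \<bullet> b) = -\<i>/2 * (torus_map L x $ i + (-1) * cnj (torus_map L x $ i))" for x
      by (simp add: b inner_axis inner_complex_def complex_eq_iff)
    then show ?thesis
      by (simp only:) (intro trigpoly_mult trigpoly_const trigpoly_add trigpoly_torus trigpoly_cnj_torus)
  qed
qed

text \<open>Real polynomials are generated from linear maps and constants by sums and products, and
  trigonometric polynomials are closed under both.\<close>

lemma trigpoly_real_polynomial:
  fixes p :: "complex^'n \<Rightarrow> real"
  assumes "real_polynomial_function p"
  shows "trigpoly L (\<lambda>x. complex_of_real (p (torus_map L x)))"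
  using assms
proof (induction rule: real_polynomial_function.induct)
  case (linear f)
  then interpret bounded_linear f .
  have "complex_of_real (f z) = (\<Sum>b\<in>Basis. complex_of_real (z \<bullet> b) * of_real (f b))" for z
  proof -
    have "f z = f (\<Sum>b\<in>Basis. (z \<bullet> b) *\<^sub>R b)" by (simp add: euclidean_representation)
    also have "\<dots> = (\<Sum>b\<in>Basis. (z \<bullet> b) * f b)" by (simp add: sum scaleR)
    finally show ?thesis by simp
  qed
  then have "(\<lambda>x. complex_of_real (f (torus_map L x))) =
      (\<lambda>x. \<Sum>b\<in>Basis. complex_of_real (torus_map L x \<bullet> b) * of_real (f b))" by (rule ext)
  moreover have "trigpoly L \<dots>" by (intro trigpoly_sum trigpoly_mult trigpoly_const trigpoly_torus_basis)
  ultimately show ?case by (simp only:)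
next
  case (const c)
  show ?case by (rule trigpoly_const)
next
  case (add f g)
  then show ?case by (simp add: trigpoly_add)
next
  case (mult f g)
  then show ?case by (simp add: trigpoly_mult)
qed

definition torus :: "(complex^'n) set" where
  "torus = {z. \<forall>i. cmod (z $ i) = 1}"

lemma torus_map_in: "torus_map L x \<in> torus"
  by (simp add: torus_def torus_map_def)

lemma compact_torus: "compact (torus :: (complex^'n) set)"
proof -
  have "norm z \<le> CARD('n)" if "z \<in> torus" for z :: "complex^'n"
  proof -
    have "norm z \<le> (\<Sum>i\<in>UNIV. norm (z $ i))"
      unfolding norm_vec_def by (rule L2_set_le_sum) simp
    then show ?thesis using that by (simp add: torus_def)
  qed
  then have "bounded (torus :: (complex^'n) set)" by (auto simp: bounded_iff)
  moreover have "closed (torus :: (complex^'n) set)"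
    unfolding torus_def by (intro closed_Collect_all closed_Collect_eq continuous_intros)
  ultimately show ?thesis by (simp add: compact_eq_bounded_closed)
qed

text \<open>The range of \<open>Arg2pi\<close> is the half-open interval from 0 to 2 pi, matching
  the half-open cube, so this inverts \<open>torus_map\<close> on all of the cube. It jumps where a
  coordinate equals 1.\<close>

definition torus_coord :: "real \<Rightarrow> complex^'n \<Rightarrow> real^'n" where
  "torus_coord L z = (\<chi> i. L / (2 * pi) * Arg2pi (z $ i))"

lemma torus_coord_map:
  assumes "L > 0" "x \<in> cube L" shows "torus_coord L (torus_map L x) = x"
proof -
  have "Arg2pi (torus_map L x $ i) = 2 * pi / L * x $ i" for i
  proof (rule Arg2pi_unique[where r=1])
    have "0 \<le> x $ i" "x $ i < L" using assms by (auto simp: cube_def)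
    then show "0 \<le> 2 * pi / L * x $ i" "2 * pi / L * x $ i < 2 * pi"
      using assms by (auto simp: field_simps)
  qed (auto simp: torus_map_def)
  then show ?thesis using assms by (simp add: torus_coord_def vec_eq_iff)
qed

text \<open>The cutoff vanishes exactly where \<^const>\<open>Arg2pi\<close> jumps, which makes the product continuous.\<close>

lemma continuous_on_torus_cutoff:
  fixes \<phi> :: "real^'n \<Rightarrow> complex"
  assumes cont: "continuous_on UNIV \<phi>" and bound: "\<And>x. cmod (\<phi> x) \<le> B"
  shows "continuous_on torus (\<lambda>z. \<phi> (torus_coord L z) * complex_of_real (min 1 (k * (\<Prod>i\<in>UNIV. cmod (z $ i - 1)))))"
    (is "continuous_on _ ?G")
  unfolding continuous_on_def
proof
  fix z :: "complex^'n" assume z: "z \<in> torus"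
  define \<kappa> :: "complex^'n \<Rightarrow> complex" where
    "\<kappa> = (\<lambda>z. complex_of_real (min 1 (k * (\<Prod>i\<in>UNIV. cmod (z $ i - 1)))))"
  have \<kappa>: "(\<kappa> \<longlongrightarrow> \<kappa> z) (at z within torus)"
    unfolding \<kappa>_def by (intro tendsto_intros)
  show "(?G \<longlongrightarrow> ?G z) (at z within torus)"
  proof (cases "\<forall>i. z $ i \<noteq> 1")
    case True
    have "isCont (\<lambda>w. Arg2pi (w $ i)) z" for i
    proof -
      have "z $ i \<notin> \<real>\<^sub>\<ge>\<^sub>0"
      proof
        assume "z $ i \<in> \<real>\<^sub>\<ge>\<^sub>0"
        then obtain r where r: "z $ i = of_real r" "r \<ge> 0" by (auto elim: nonneg_Reals_cases)
        moreover have "cmod (z $ i) = 1" using z by (simp add: torus_def)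
        ultimately show False using True by auto
      qed
      then have *: "isCont Arg2pi (z $ i)" by (rule continuous_at_Arg2pi)
      have "isCont (\<lambda>w. w $ i) z" by (intro continuous_intros)
      from isCont_o2[OF this *] show ?thesis .
    qed
    then have "((\<lambda>w. Arg2pi (w $ i)) \<longlongrightarrow> Arg2pi (z $ i)) (at z within torus)" for i
      unfolding isCont_def by (rule tendsto_within_subset) simp
    then have "(torus_coord L \<longlongrightarrow> torus_coord L z) (at z within torus)"
      unfolding torus_coord_def by (intro tendsto_intros)
    moreover have "isCont \<phi> (torus_coord L z)" using cont by (simp add: continuous_on_eq_continuous_at)
    ultimately have "((\<lambda>w. \<phi> (torus_coord L w)) \<longlongrightarrow> \<phi> (torus_coord L z)) (at z within torus)"
      by (rule isCont_tendsto_compose[rotated])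
    then show ?thesis using \<kappa> unfolding \<kappa>_def by (rule tendsto_mult)
  next
    case False
    then have *: "(\<Prod>i\<in>UNIV. cmod (z $ i - 1)) = 0" by (intro prod_zero) auto
    have "\<kappa> z = 0" unfolding \<kappa>_def * by simp
    then have k0: "(\<kappa> \<longlongrightarrow> 0) (at z within torus)" using \<kappa> by simp
    have "((\<lambda>w. \<phi> (torus_coord L w) * \<kappa> w) \<longlongrightarrow> 0) (at z within torus)"
    proof (rule Lim_null_comparison)
      show "\<forall>\<^sub>F w in at z within torus. norm (\<phi> (torus_coord L w) * \<kappa> w) \<le> B * cmod (\<kappa> w)"
        by (intro always_eventually allI) (simp add: norm_mult mult_right_mono bound)
      have "((\<lambda>w. B * cmod (\<kappa> w)) \<longlongrightarrow> B * cmod 0) (at z within torus)" by (intro tendsto_intros k0)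
      then show "((\<lambda>w. B * cmod (\<kappa> w)) \<longlongrightarrow> 0) (at z within torus)" by simp
    qed
    then show ?thesis using \<open>\<kappa> z = 0\<close> unfolding \<kappa>_def by simp
  qed
qed

lemma continuous_torus_approx:
  fixes G :: "complex^'n \<Rightarrow> complex"
  assumes G: "continuous_on torus G" and d: "d > 0"
  shows "\<exists>q. trigpoly L q \<and> (\<forall>x. cmod (G (torus_map L x) - q x) < d)"
proof -
  have d2: "d / 2 > 0" using d by simp
  obtain p where p: "real_polynomial_function p" "\<And>z. z \<in> torus \<Longrightarrow> \<bar>Re (G z) - p z\<bar> < d / 2"
    using Stone_Weierstrass_real_polynomial_function[OF compact_torus continuous_on_Re[OF G] d2] by blast
  obtain p' where p': "real_polynomial_function p'" "\<And>z. z \<in> torus \<Longrightarrow> \<bar>Im (G z) - p' z\<bar> < d / 2"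
    using Stone_Weierstrass_real_polynomial_function[OF compact_torus continuous_on_Im[OF G] d2] by blast
  define q where "q x = of_real (p (torus_map L x)) + \<i> * of_real (p' (torus_map L x))" for x
  have "trigpoly L q" unfolding q_def
    by (intro trigpoly_add trigpoly_mult trigpoly_const trigpoly_real_polynomial p p')
  moreover have "cmod (G (torus_map L x) - q x) < d" for x
  proof -
    have "cmod (G (torus_map L x) - q x) \<le> \<bar>Re (G (torus_map L x) - q x)\<bar> + \<bar>Im (G (torus_map L x) - q x)\<bar>"
      by (rule cmod_le)
    also have "\<dots> < d / 2 + d / 2"
      using p(2)[OF torus_map_in, of L x] p'(2)[OF torus_map_in, of L x] by (intro add_strict_mono) (auto simp: q_def)
    finally show ?thesis by simp
  qed
  ultimately show ?thesis by blast
qed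

text \<open>Two approximations are chained: \<open>b\<close> in L2 by continuous functions with a
  cutoff, and these uniformly by trigonometric polynomials. The cutoff is what makes a function on
  the cube continuous on the torus, where opposite faces are glued.\<close>

lemma trigpoly_dense_bounded:
  fixes b :: "real^'n \<Rightarrow> complex"
  assumes L: "L > 0" and b: "b \<in> borel_measurable lebesgue" and bound: "\<And>x. cmod (b x) \<le> B" and B: "B > 0"
    and van: "\<And>x. x \<notin> cube L \<Longrightarrow> b x = 0" and e: "e > 0"
  shows "\<exists>F c. finite F \<and> l2norm (\<lambda>x. b x - (\<Sum>m\<in>F. c m * cube_chr L m x)) < e"
proof -
  have "b measurable_on UNIV"
    using b measurable_on_iff_borel_measurable[of UNIV b] by (simp add: lebesgue_on_UNIV_eq)
  then obtain N g where N: "negligible N" and g: "\<And>n. continuous_on UNIV (g n)"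
    and lim: "\<And>x. x \<notin> N \<Longrightarrow> (\<lambda>n. g n x) \<longlonglongrightarrow> b x"
    unfolding measurable_on_def by auto
  \<comment> \<open>Radial truncation to the disc of radius \<open>B\<close>: continuous, bounded,
    and the identity on values of modulus at most \<open>B\<close>, so the limit is
    unchanged.\<close>
  define \<phi> where "\<phi> n x = g n x * complex_of_real (B / max B (cmod (g n x)))" for n :: nat and x
  have \<phi>_cont: "continuous_on UNIV (\<phi> n)" for n
    unfolding \<phi>_def using B by (intro continuous_intros g) (auto simp: max_def)
  have \<phi>_bound: "cmod (\<phi> n x) \<le> B" for n x
  proof -
    have "cmod (\<phi> n x) = cmod (g n x) * (B / max B (cmod (g n x)))"
      using B by (simp add: \<phi>_def norm_mult norm_divide)
    also have "\<dots> \<le> B" using B by (auto simp: field_simps max_def)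
    finally show ?thesis .
  qed
  define \<kappa> where "\<kappa> n x = complex_of_real (min 1 (real n * (\<Prod>i\<in>UNIV. cmod (torus_map L x $ i - 1))))"
    for n and x :: "real^'n"
  define G where "G n z = \<phi> n (torus_coord L z) * complex_of_real (min 1 (real n * (\<Prod>i\<in>UNIV. cmod (z $ i - 1))))"
    for n and z :: "complex^'n"
  have G_cont: "continuous_on torus (G n)" for n
    unfolding G_def by (rule continuous_on_torus_cutoff[OF \<phi>_cont \<phi>_bound])
  define s where "s n x = indicator (cube L) x * (\<phi> n x * \<kappa> n x)" for n x
  have s_G: "s n x = indicator (cube L) x * G n (torus_map L x)" for n x
    using torus_coord_map[OF L, of x] by (auto simp: s_def G_def \<kappa>_def indicator_def)
  have \<kappa>_norm: "cmod (\<kappa> n x) \<le> 1" for n x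
    by (simp add: \<kappa>_def prod_nonneg)
  have s_meas: "s n \<in> borel_measurable lebesgue" for n
  proof -
    have "continuous_on UNIV (\<lambda>x. \<phi> n x * \<kappa> n x)"
      unfolding \<kappa>_def torus_map_def using L by (auto intro!: continuous_intros \<phi>_cont)
    then have "(\<lambda>x. \<phi> n x * \<kappa> n x) \<in> borel_measurable lebesgue"
      by (intro measurable_completion) (simp add: borel_measurable_continuous_onI)
    then show ?thesis unfolding s_def
      by (rule borel_measurable_times[OF borel_measurable_indicator[OF cube_sets]])
  qed
  have "(\<lambda>n. l2norm (\<lambda>x. b x - s n x)) \<longlonglongrightarrow> 0"
  proof (rule l2_dominated_convergence[where w="\<lambda>x. of_real B * indicator (cube L) x"])
    show "(\<lambda>x. of_real B * indicator (cube L) x :: complex) \<in> sqint"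
      by (rule sqint_cmul[OF indicator_cube_sqint[OF L]])
    show "cmod (s n x) \<le> cmod (of_real B * indicator (cube L) x :: complex)" for n x
      using B mult_mono[OF \<phi>_bound[of n x] \<kappa>_norm[of n x]] by (auto simp: s_def indicator_def norm_mult)
    show "cmod (b x) \<le> cmod (of_real B * indicator (cube L) x :: complex)" for x
      using B bound[of x] van[of x] by (auto simp: indicator_def)
    \<comment> \<open>Inside the cube the cutoff is eventually 1 unless some coordinate is 0, which
      happens only on a null set.\<close>
    have "negligible (N \<union> (\<Union>i. {x::real^'n. x $ i = 0}))"
      by (intro negligible_Un N negligible_Union_nat negligible_countable_Union) (auto intro: negligible_standard_hyperplane_cart)
    then have "AE x in lebesgue. x \<notin> N \<union> (\<Union>i. {x::real^'n. x $ i = 0})"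
      by (intro AE_not_in) (simp add: negligible_iff_null_sets)
    then show "AE x in lebesgue. (\<lambda>n. s n x) \<longlonglongrightarrow> b x"
    proof eventually_elim
      case (elim x)
      show ?case
      proof (cases "x \<in> cube L")
        case False
        then show ?thesis by (simp add: s_def van)
      next
        case True
        have g_lim: "(\<lambda>n. g n x) \<longlonglongrightarrow> b x" using lim elim by auto
        have "(\<lambda>n. \<phi> n x) \<longlonglongrightarrow> b x * complex_of_real (B / max B (cmod (b x)))"
          unfolding \<phi>_def using B by (intro tendsto_intros g_lim) auto
        moreover have "max B (cmod (b x)) = B" using bound[of x] by simp
        ultimately have \<phi>_lim: "(\<lambda>n. \<phi> n x) \<longlonglongrightarrow> b x" using B by simp
        define P where "P = (\<Prod>i\<in>UNIV. cmod (torus_map L x $ i - 1))"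
        have "torus_map L x $ i \<noteq> 1" for i
        proof
          assume "torus_map L x $ i = 1"
          moreover have "x $ i = L / (2 * pi) * Arg2pi (torus_map L x $ i)"
            using torus_coord_map[OF L True] by (metis torus_coord_def vec_lambda_beta)
          ultimately show False using elim by (auto simp: Arg2pi_of_real[of 1, simplified])
        qed
        then have P: "P > 0" unfolding P_def by (intro prod_pos) auto
        obtain n0 :: nat where n0: "1 / P < real n0" using reals_Archimedean2 by blast
        have "\<kappa> n x = 1" if "n \<ge> n0" for n
        proof -
          have "1 / P \<le> real n" using n0 that by linarith
          then have "1 \<le> real n * P" using P by (simp add: field_simps)
          then show ?thesis by (simp add: \<kappa>_def P_def)
        qed
        then have "(\<lambda>n. \<kappa> n x) \<longlonglongrightarrow> 1"
          by (intro tendsto_eventually) (auto simp: eventually_sequentially)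
        from tendsto_mult[OF \<phi>_lim this] show ?thesis using True by (simp add: s_def)
      qed
    qed
  qed (use b s_meas in auto)
  then have "\<forall>\<^sub>F n in sequentially. l2norm (\<lambda>x. b x - s n x) < e / 2"
    by (rule order_tendstoD) (use e in simp)
  then obtain n where n: "l2norm (\<lambda>x. b x - s n x) < e / 2" by (auto simp: eventually_sequentially)
  define I where "I = l2norm (\<lambda>x. indicator (cube L :: (real^'n) set) x)"
  have I: "I \<ge> 0" by (simp add: I_def l2norm_nonneg)
  \<comment> \<open>A uniform error \<open>d\<close> on the cube costs at most \<open>d * I\<close>
    in L2 norm; the \<open>+ 1\<close> keeps the denominator positive without evaluating
    \<open>I\<close>.\<close>
  define d where "d = e / (2 * (I + 1))"
  have d: "d > 0" using e I by (simp add: d_def)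
  obtain q where q: "trigpoly L q" "\<And>x. cmod (G n (torus_map L x) - q x) < d"
    using continuous_torus_approx[OF G_cont d, of L n] by auto
  obtain F c where F: "finite F" "q = (\<lambda>x. \<Sum>m\<in>F. c m * chr (lat (2 * pi / L) m) x)"
    using q(1) unfolding trigpoly_def by auto
  define Q where "Q x = (\<Sum>m\<in>F. c m * cube_chr L m x)" for x
  have Q: "Q x = indicator (cube L) x * q x" for x
    by (simp add: Q_def F(2) cube_chr_def sum_distrib_left mult_ac)
  have Q_sq: "Q \<in> sqint" unfolding Q_def by (intro sqint_sum sqint_cmul cube_chr_sqint L)
  have ind: "(\<lambda>x. of_real B * indicator (cube L) x :: complex) \<in> sqint"
    by (rule sqint_cmul[OF indicator_cube_sqint[OF L]])
  have b_sq: "b \<in> sqint"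
    by (rule sqint_bounded_by[OF b sqint_integrable[OF ind]])
      (use B bound van in \<open>auto intro!: power_mono simp: indicator_def\<close>)
  have s_sq: "s n \<in> sqint"
  proof (rule sqint_bounded_by[OF s_meas sqint_integrable[OF ind]])
    fix x show "(cmod (s n x))\<^sup>2 \<le> (cmod (of_real B * indicator (cube L) x :: complex))\<^sup>2"
      using B mult_mono[OF \<phi>_bound[of n x] \<kappa>_norm[of n x]]
      by (intro power_mono) (auto simp: s_def indicator_def norm_mult)
  qed
  have "(l2norm (\<lambda>x. s n x - Q x))\<^sup>2 \<le> (l2norm (\<lambda>x. of_real d * indicator (cube L :: (real^'n) set) x))\<^sup>2"
    unfolding l2norm_sq
  proof (rule integral_mono)
    show "integrable lebesgue (\<lambda>x. (cmod (s n x - Q x))\<^sup>2)"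
      by (rule sqint_integrable[OF sqint_diff[OF s_sq Q_sq]])
    show "integrable lebesgue (\<lambda>x. (cmod (of_real d * indicator (cube L) x))\<^sup>2)"
      by (rule sqint_integrable[OF sqint_cmul[OF indicator_cube_sqint[OF L]]])
    fix x
    show "(cmod (s n x - Q x))\<^sup>2 \<le> (cmod (of_real d * indicator (cube L) x))\<^sup>2"
      using q(2)[of x] d by (intro power_mono) (auto simp: s_G Q indicator_def)
  qed
  then have "l2norm (\<lambda>x. s n x - Q x) \<le> d * I"
    using power2_le_imp_le[of _ "d * I"] d I by (simp add: l2norm_cmul I_def)
  also have "\<dots> < e / 2" using e I by (simp add: d_def field_simps)
  finally have "l2norm (\<lambda>x. b x - Q x) < e"
    using l2norm_triangle_diff[OF b_sq s_sq Q_sq] n by linarith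
  then show ?thesis unfolding Q_def using F(1) by auto
qed

text \<open>Setting \<open>b\<close> to 0 where it is large reduces to the bounded case, by
  dominated convergence with \<open>b\<close> itself as majorant.\<close>

lemma trigpoly_dense:
  fixes b :: "real^'n \<Rightarrow> complex"
  assumes L: "L > 0" and b: "b \<in> sqint" and van: "\<And>x. x \<notin> cube L \<Longrightarrow> b x = 0" and e: "e > 0"
  shows "\<exists>F c. finite F \<and> l2norm (\<lambda>x. b x - (\<Sum>m\<in>F. c m * cube_chr L m x)) < e"
proof -
  define t where "t n x = (if cmod (b x) \<le> real n then b x else 0)" for n x
  have t_meas: "t n \<in> borel_measurable lebesgue" for n
    unfolding t_def using sqint_borel[OF b] by measurable
  have "(\<lambda>n. l2norm (\<lambda>x. b x - t n x)) \<longlonglongrightarrow> 0"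
  proof (rule l2_dominated_convergence[where w=b])
    have "(\<lambda>n. t n x) \<longlonglongrightarrow> b x" for x
    proof (rule tendsto_eventually)
      obtain n0 :: nat where "cmod (b x) \<le> real n0" using real_arch_simple by blast
      then have "t n x = b x" if "n \<ge> n0" for n using that by (auto simp: t_def)
      then show "\<forall>\<^sub>F n in sequentially. t n x = b x" by (auto simp: eventually_sequentially)
    qed
    then show "AE x in lebesgue. (\<lambda>n. t n x) \<longlonglongrightarrow> b x" by simp
  qed (use b t_meas sqint_borel in \<open>auto simp: t_def\<close>)
  then have "\<forall>\<^sub>F n in sequentially. l2norm (\<lambda>x. b x - t n x) < e / 2"
    by (rule order_tendstoD) (use e in simp)
  then obtain n where n: "l2norm (\<lambda>x. b x - t n x) < e / 2" by (auto simp: eventually_sequentially)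
  \<comment> \<open>The bound has to be strictly positive and \<open>n\<close> may be 0, hence the
    \<open>+ 1\<close>.\<close>
  have bd: "cmod (t n x) \<le> real n + 1" for x by (simp add: t_def)
  have tv: "t n x = 0" if "x \<notin> cube L" for x using van[OF that] by (simp add: t_def)
  obtain F c where F: "finite F" "l2norm (\<lambda>x. t n x - (\<Sum>m\<in>F. c m * cube_chr L m x)) < e / 2"
    using trigpoly_dense_bounded[OF L t_meas bd _ tv, of "e / 2"] e by auto
  have t_sq: "t n \<in> sqint"
    by (rule sqint_bounded_by[OF t_meas sqint_integrable[OF b]]) (auto simp: t_def)
  have "l2norm (\<lambda>x. b x - (\<Sum>m\<in>F. c m * cube_chr L m x)) < e"
    using l2norm_triangle_diff[OF b t_sq, of "\<lambda>x. \<Sum>m\<in>F. c m * cube_chr L m x"] n F(2)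
    by (simp add: sqint_sum sqint_cmul cube_chr_sqint L)
  then show ?thesis using F(1) by auto
qed

section \<open>Parseval's identity\<close>

text \<open>\<open>P F\<close> is the orthogonal projection of \<open>b\<close> onto the span of the
  \<open>u k\<close> with \<open>k \<in> F\<close>, hence the best approximation there. One good
  approximant on \<open>F0\<close> therefore controls every larger finite set, which is unordered
  convergence; Cauchy--Schwarz then allows pairing with \<open>a\<close>.\<close>

lemma orthogonal_Parseval:
  fixes u :: "'k \<Rightarrow> real^'n \<Rightarrow> complex"
  assumes u: "\<And>k. u k \<in> sqint" and orth: "\<And>k l. l2inner (u k) (u l) = (if k = l then of_real R else 0)"
    and R: "R > 0" and a: "a \<in> sqint" and b: "b \<in> sqint"
    and dense: "\<And>e. e > 0 \<Longrightarrow> \<exists>F c. finite F \<and> l2norm (\<lambda>x. b x - (\<Sum>k\<in>F. c k * u k x)) < e"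
  shows "((\<lambda>k. l2inner a (u k) * l2inner (u k) b) has_sum of_real R * l2inner a b) UNIV"
proof -
  define P where "P F x = (\<Sum>k\<in>F. (l2inner b (u k) / of_real R) * u k x)" for F x
  have comb: "(\<lambda>x. \<Sum>k\<in>F. c k * u k x) \<in> sqint" for F and c :: "'k \<Rightarrow> complex"
    by (intro sqint_sum sqint_cmul u)
  have P: "P F \<in> sqint" for F unfolding P_def by (rule comb)
  have inner_comb: "l2inner v (\<lambda>x. \<Sum>k\<in>F. c k * u k x) = (\<Sum>k\<in>F. cnj (c k) * l2inner v (u k))"
    if "v \<in> sqint" for v F c
    using that by (simp add: l2inner_sum_right sqint_cmul u l2inner_cmul_right)
  have res: "l2inner (\<lambda>x. b x - P F x) (u k) = 0" if "finite F" "k \<in> F" for F k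
  proof -
    have "l2inner (P F) (u k) = (\<Sum>l\<in>F. l2inner b (u l) / of_real R * l2inner (u l) (u k))"
      unfolding P_def by (simp only: l2inner_sum_left sqint_cmul u l2inner_cmul_left)
    also have "\<dots> = l2inner b (u k)" using that R by (simp add: orth if_distrib[of "\<lambda>z. _ * z"] cong: if_cong)
    finally show ?thesis by (simp add: l2inner_diff_left b P u)
  qed
  have best: "l2norm (\<lambda>x. b x - P F x) \<le> l2norm (\<lambda>x. b x - (\<Sum>k\<in>F. c k * u k x))" if F: "finite F" for F c
  proof (rule power2_le_imp_le)
    let ?r = "\<lambda>x. b x - P F x" and ?v = "\<lambda>x. \<Sum>k\<in>F. (c k - l2inner b (u k) / of_real R) * u k x"
    have "(\<lambda>x. b x - (\<Sum>k\<in>F. c k * u k x)) = (\<lambda>x. ?r x - ?v x)"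
      by (simp add: P_def left_diff_distrib sum_subtractf)
    moreover have "l2inner ?r ?v = 0"
      using F by (subst inner_comb) (auto simp: sqint_diff b P res)
    ultimately have "(l2norm (\<lambda>x. b x - (\<Sum>k\<in>F. c k * u k x)))\<^sup>2 = (l2norm ?r)\<^sup>2 + (l2norm ?v)\<^sup>2"
      by (simp only: l2norm_diff_sq[OF sqint_diff[OF b P] comb]) simp
    then show "(l2norm ?r)\<^sup>2 \<le> (l2norm (\<lambda>x. b x - (\<Sum>k\<in>F. c k * u k x)))\<^sup>2" by simp
  qed (rule l2norm_nonneg)
  show ?thesis
    unfolding has_sum_def tendsto_iff eventually_finite_subsets_at_top
  proof (intro allI impI)
    fix e :: real assume e: "e > 0"
    define d where "d = e / (R * (l2norm a + 1))"
    have ap: "l2norm a + 1 > 0" using l2norm_nonneg[of a] by simp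
    have d: "d > 0" using e R ap by (simp add: d_def)
    obtain F0 c where F0: "finite F0" "l2norm (\<lambda>x. b x - (\<Sum>k\<in>F0. c k * u k x)) < d" using dense[OF d] by auto
    show "\<exists>X. finite X \<and> X \<subseteq> UNIV \<and> (\<forall>Y. finite Y \<and> X \<subseteq> Y \<and> Y \<subseteq> UNIV \<longrightarrow>
        dist (\<Sum>k\<in>Y. l2inner a (u k) * l2inner (u k) b) (of_real R * l2inner a b) < e)"
    proof (intro exI[of _ F0] conjI allI impI F0(1) subset_UNIV)
      fix F assume "finite F \<and> F0 \<subseteq> F \<and> F \<subseteq> UNIV"
      then have F: "finite F" "F0 \<subseteq> F" by auto
      have "(\<Sum>k\<in>F0. c k * u k x) = (\<Sum>k\<in>F. (if k \<in> F0 then c k else 0) * u k x)" for x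
        using F by (intro sum.mono_neutral_cong_left) auto
      then have "l2norm (\<lambda>x. b x - P F x) < d" using best[OF F(1), of "\<lambda>k. if k \<in> F0 then c k else 0"] F0(2) by simp
      then have Pd: "l2norm (\<lambda>x. P F x - b x) < d" by (simp add: l2norm_minus_commute[of b])
      have "of_real R * l2inner a (P F) = (\<Sum>k\<in>F. l2inner a (u k) * l2inner (u k) b)"
        unfolding P_def inner_comb[OF a] sum_distrib_left
        using R by (intro sum.cong) (auto simp: l2inner_commute[of "u _" b])
      then have "dist (\<Sum>k\<in>F. l2inner a (u k) * l2inner (u k) b) (of_real R * l2inner a b)
          = cmod (of_real R * l2inner a (\<lambda>x. P F x - b x))"
        by (simp add: dist_norm l2inner_diff_right a b P right_diff_distrib)
      also have "\<dots> \<le> R * (l2norm a * l2norm (\<lambda>x. P F x - b x))"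
        using l2_Cauchy_Schwarz[OF a sqint_diff[OF P b], of F] R by (simp add: norm_mult)
      also have "\<dots> \<le> R * (l2norm a * d)"
        using Pd R by (intro mult_left_mono l2norm_nonneg) auto
      also have "\<dots> < R * ((l2norm a + 1) * d)" using R d by simp
      also have "\<dots> = e" using R ap by (simp add: d_def)
      finally show "dist (\<Sum>k\<in>F. l2inner a (u k) * l2inner (u k) b) (of_real R * l2inner a b) < e" .
    qed
  qed
qed

lemma cube_Parseval:
  fixes a b :: "real^'n \<Rightarrow> complex"
  assumes L: "L > 0" and a: "a \<in> sqint" and b: "b \<in> sqint" and van: "\<And>x. x \<notin> cube L \<Longrightarrow> b x = 0"
  shows "((\<lambda>m. l2inner a (cube_chr L m) * l2inner (cube_chr L m) b) has_sum
    of_real (L ^ CARD('n)) * l2inner a b) UNIV"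
  by (rule orthogonal_Parseval[OF cube_chr_sqint[OF L] l2inner_cube_chr[OF L] _ a b trigpoly_dense[OF L b van]])
    (use L in auto)

section \<open>The Wexler--Raz relations\<close>

lemma gabor_eq_chr: "gabor \<alpha> \<beta> g (m, n) x = chr (lat (2 * pi * \<alpha>) m) x * g (x - lat \<beta> n)"
  by (simp add: gabor_def TF_def chr_def)

lemma sqint_shift: assumes "f \<in> sqint" shows "(\<lambda>x. f (x - t)) \<in> sqint"
  using TF_sqint[OF assms, of "(t, 0)"] by (simp add: TF_def)

lemma sqint_cnj: assumes "f \<in> sqint" shows "(\<lambda>x. cnj (f x)) \<in> sqint"
proof (rule sqintI)
  show "(\<lambda>x. cnj (f x)) \<in> borel_measurable lebesgue"
    using sqint_borel[OF assms] by (intro borel_measurable_continuous_on[where f=cnj] continuous_on_cnj continuous_on_id)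
qed (simp add: sqint_integrable assms)

text \<open>Unconditional norm convergence survives pairing with \<open>h\<close> by
  Cauchy--Schwarz. An unordered scalar sum is what lets \<open>Wexler_Raz\<close> sum over
  \<open>m\<close> first and over \<open>n\<close> afterwards.\<close>

lemma dual_frame_has_sum:
  assumes dual: "is_dual_frame u v" and f: "f \<in> sqint" and h: "h \<in> sqint"
  shows "((\<lambda>k. l2inner f (v k) * l2inner (u k) h) has_sum l2inner f h) UNIV"
  unfolding has_sum_def tendsto_iff eventually_finite_subsets_at_top
proof (intro allI impI)
  have u: "u k \<in> sqint" for k using dual by (simp add: is_dual_frame_def is_frame_def)
  fix e :: real assume e: "e > 0"
  have hp: "l2norm h + 1 > 0" using l2norm_nonneg[of h] by simp
  define d where "d = e / (l2norm h + 1)"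
  have d: "d > 0" using e hp by (simp add: d_def)
  have "\<forall>e>0. \<exists>F0. finite F0 \<and> (\<forall>F. finite F \<and> F0 \<subseteq> F \<longrightarrow>
      l2norm (\<lambda>x. f x - (\<Sum>k\<in>F. l2inner f (v k) * u k x)) < e)"
    using dual f unfolding is_dual_frame_def by simp
  then obtain F0 where F0: "finite F0" "\<And>F. finite F \<Longrightarrow> F0 \<subseteq> F \<Longrightarrow>
      l2norm (\<lambda>x. f x - (\<Sum>k\<in>F. l2inner f (v k) * u k x)) < d"
    using d by auto
  show "\<exists>X. finite X \<and> X \<subseteq> UNIV \<and> (\<forall>Y. finite Y \<and> X \<subseteq> Y \<and> Y \<subseteq> UNIV \<longrightarrow>
      dist (\<Sum>k\<in>Y. l2inner f (v k) * l2inner (u k) h) (l2inner f h) < e)"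
  proof (intro exI[of _ F0] conjI allI impI F0(1) subset_UNIV)
    fix F assume "finite F \<and> F0 \<subseteq> F \<and> F \<subseteq> UNIV"
    then have F: "finite F" "F0 \<subseteq> F" by auto
    let ?S = "\<lambda>x. \<Sum>k\<in>F. l2inner f (v k) * u k x"
    have S: "?S \<in> sqint" by (intro sqint_sum sqint_cmul u)
    have "l2inner ?S h = (\<Sum>k\<in>F. l2inner f (v k) * l2inner (u k) h)"
      by (simp add: l2inner_sum_left sqint_cmul u h l2inner_cmul_left)
    then have "dist (\<Sum>k\<in>F. l2inner f (v k) * l2inner (u k) h) (l2inner f h) = cmod (l2inner (\<lambda>x. f x - ?S x) h)"
      by (simp add: dist_norm norm_minus_commute[of "l2inner f h"] l2inner_diff_left f S h)
    also have "\<dots> \<le> l2norm (\<lambda>x. f x - ?S x) * l2norm h"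
      by (rule l2_Cauchy_Schwarz[OF sqint_diff[OF f S] h])
    also have "\<dots> \<le> d * l2norm h"
      using F0(2)[OF F] by (intro mult_right_mono l2norm_nonneg) auto
    also have "\<dots> < e" using e hp by (simp add: d_def field_simps)
    finally show "dist (\<Sum>k\<in>F. l2inner f (v k) * l2inner (u k) h) (l2inner f h) < e" .
  qed
qed

text \<open>Test the reconstruction formula against
  \<open>f = 1\<^bsub>[0,\<beta>)\<^esub> e\<^bsup>i\<omega>x\<^esup>\<close> and \<open>h = 1\<^bsub>[0,\<beta>)-t\<^esub>\<close>: the sum over modulations is Parseval's
  identity on the cube of side \<open>1/\<alpha>\<close> (here \<open>\<alpha>\<beta> \<le> 1\<close> enters), and the sum over translations tiles space.\<close>

lemma Wexler_Raz:
  fixes g gt :: "real^'n \<Rightarrow> complex" and j k :: "int^'n"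
  assumes \<alpha>: "0 < \<alpha>" and \<beta>: "0 < \<beta>" and \<alpha>\<beta>: "\<alpha> * \<beta> \<le> 1" and g: "g \<in> sqint" and gt: "gt \<in> sqint"
    and dual: "is_dual_frame (gabor \<alpha> \<beta> g) (gabor \<alpha> \<beta> gt)"
  shows "l2inner (TF (lat (1 / \<alpha>) j, lat (2 * pi / \<beta>) k) g) gt = (if j = 0 \<and> k = 0 then of_real ((\<alpha> * \<beta>) ^ CARD('n)) else 0)"
proof -
  define L where "L = 1 / \<alpha>"
  have L: "L > 0" using \<alpha> by (simp add: L_def)
  have \<beta>L: "\<beta> \<le> L" using \<alpha> \<alpha>\<beta> by (simp add: L_def field_simps)
  then have sub: "cube \<beta> \<subseteq> (cube L :: (real^'n) set)" by (auto simp: cube_def intro: less_le_trans)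
  define t where "t = lat L j"
  define \<omega> where "\<omega> = lat (2 * pi / \<beta>) k"
  define f where "f = cube_chr \<beta> k"
  define h :: "real^'n \<Rightarrow> complex" where "h x = indicator (cube \<beta>) (x + t)" for x
  have f: "f \<in> sqint" unfolding f_def by (rule cube_chr_sqint[OF \<beta>])
  have h: "h \<in> sqint" using sqint_shift[OF indicator_cube_sqint[OF \<beta>], of "- t"] by (simp add: h_def[abs_def])
  have f_eq: "f x = indicator (cube \<beta>) x * chr \<omega> x" for x by (simp add: f_def cube_chr_def \<omega>_def)
  define H where "H y = TF (t, \<omega>) g y * cnj (gt y)" for y
  have H: "integrable lebesgue H" unfolding H_def by (rule l2inner_integrable[OF TF_sqint[OF g] gt])
  have H_eq: "H y = chr \<omega> y * g (y - t) * cnj (gt y)" for y by (simp add: H_def TF_def chr_def)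
  have inner_sum: "((\<lambda>m. l2inner f (gabor \<alpha> \<beta> gt (m, n)) * l2inner (gabor \<alpha> \<beta> g (m, n)) h) has_sum
      of_real (L ^ CARD('n)) * (LINT x|lebesgue. indicator (cube \<beta>) x * H (x - lat \<beta> n))) UNIV" for n
  proof -
    \<comment> \<open>The factors are distributed so that the pairings with the two Gabor systems
      become Fourier coefficients on the cube of side \<open>L\<close>; both functions live on
      \<open>cube \<beta>\<close>, inside \<open>cube L\<close>.\<close>
    define a where "a x = cnj (gt (x - lat \<beta> n)) * f x" for x
    define b where "b x = cnj (g (x - (t + lat \<beta> n))) * indicator (cube \<beta>) x" for x
    have f_bd: "cmod (f x) \<le> 1" for x by (simp add: f_eq norm_mult indicator_def)
    have a: "a \<in> sqint" unfolding a_def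
      by (rule sqint_mult_bounded[OF sqint_cnj[OF sqint_shift[OF gt]] sqint_borel[OF f] f_bd])
    have b: "b \<in> sqint" unfolding b_def
      by (rule sqint_mult_bounded[where B=1, OF sqint_cnj[OF sqint_shift[OF g]] borel_measurable_indicator[OF cube_sets]])
        (simp add: indicator_def)
    have b0: "b x = 0" if "x \<notin> cube L" for x using that sub by (auto simp: b_def indicator_def)
    have freq: "2 * pi / L = 2 * pi * \<alpha>" using \<alpha> by (simp add: L_def)
    have e1: "l2inner f (gabor \<alpha> \<beta> gt (m, n)) = l2inner a (cube_chr L m)" for m
    proof -
      have "f x * cnj (gabor \<alpha> \<beta> gt (m, n) x) = a x * cnj (cube_chr L m x)" for x
        using sub by (auto simp: gabor_eq_chr a_def f_eq cube_chr_def freq indicator_def)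
      then show ?thesis by (simp add: l2inner_def)
    qed
    have e2: "l2inner (gabor \<alpha> \<beta> g (m, n)) h = l2inner (cube_chr L m) b" for m
    proof -
      have gs: "gabor \<alpha> \<beta> g (m, n) \<in> sqint" unfolding gabor_def by (rule TF_sqint[OF g])
      \<comment> \<open>The modulation has \<open>t\<close> as a period, so substituting
        \<open>x - t\<close> affects only the translate of \<open>g\<close>. This is where the time
        shift of \<open>TF (t, \<omega>) g\<close> comes from; its modulation is supplied by
        \<open>f\<close>.\<close>
      have per: "chr (lat (2 * pi * \<alpha>) m) t = 1"
        unfolding t_def by (rule chr_lat_period) (use \<alpha> in \<open>simp add: L_def\<close>)
      have "l2inner (gabor \<alpha> \<beta> g (m, n)) h = (LINT x|lebesgue. gabor \<alpha> \<beta> g (m, n) (x - t) * cnj (h (x - t)))"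
        unfolding l2inner_def
        by (rule integral_lebesgue_shift[OF borel_measurable_integrable[OF l2inner_integrable[OF gs h]], symmetric])
      also have "\<dots> = (LINT x|lebesgue. cube_chr L m x * cnj (b x))"
      proof (rule Bochner_Integration.integral_cong[OF refl])
        fix x
        show "gabor \<alpha> \<beta> g (m, n) (x - t) * cnj (h (x - t)) = cube_chr L m x * cnj (b x)"
          using sub by (auto simp: gabor_eq_chr h_def b_def cube_chr_def freq chr_diff_right per indicator_def diff_diff_eq)
      qed
      finally show ?thesis by (simp add: l2inner_def)
    qed
    have "l2inner a b = (LINT x|lebesgue. indicator (cube \<beta>) x * H (x - lat \<beta> n))"
      unfolding l2inner_def
    proof (rule Bochner_Integration.integral_cong[OF refl])
      fix x
      have "chr \<omega> (lat \<beta> n) = 1"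
        unfolding \<omega>_def by (rule chr_lat_period) (use \<beta> in simp)
      then show "a x * cnj (b x) = indicator (cube \<beta>) x * H (x - lat \<beta> n)"
        by (auto simp: a_def b_def f_eq H_eq chr_diff_right indicator_def diff_diff_eq add.commute)
    qed
    then show ?thesis
      using cube_Parseval[OF L a b b0] by (simp add: e1 e2)
  qed
  \<comment> \<open>With the inner sums over \<open>m\<close> evaluated, the sum over
    \<open>n\<close> unfolds the integral of \<open>H\<close>. Uniqueness of unordered sums equates
    it with the reconstructed pairing of \<open>f\<close> and \<open>h\<close>.\<close>
  have "((\<lambda>p. l2inner f (gabor \<alpha> \<beta> gt p) * l2inner (gabor \<alpha> \<beta> g p) h) has_sum l2inner f h) (UNIV \<times> UNIV)"
    using dual_frame_has_sum[OF dual f h] by simp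
  then have "((\<lambda>(n, m). l2inner f (gabor \<alpha> \<beta> gt (m, n)) * l2inner (gabor \<alpha> \<beta> g (m, n)) h) has_sum l2inner f h) (UNIV \<times> UNIV)"
    by (subst (asm) has_sum_swap)
  then have "((\<lambda>n. of_real (L ^ CARD('n)) * (LINT x|lebesgue. indicator (cube \<beta>) x * H (x - lat \<beta> n))) has_sum l2inner f h) UNIV"
    by (rule has_sum_SigmaD) (simp only: prod.case inner_sum)
  moreover have "((\<lambda>n. of_real (L ^ CARD('n)) * (LINT x|lebesgue. indicator (cube \<beta>) x * H (x - lat \<beta> n))) has_sum
      of_real (L ^ CARD('n)) * (LINT x|lebesgue. H x)) UNIV"
    by (rule has_sum_cmult_right[OF tiling_unfold[OF \<beta> H]])
  ultimately have eq: "of_real (L ^ CARD('n)) * (LINT x|lebesgue. H x) = l2inner f h"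
    using has_sum_unique by blast
  have "l2inner f h = (if j = 0 \<and> k = 0 then of_real (\<beta> ^ CARD('n)) else 0)"
  proof (cases "j = 0")
    case True
    then have "f x * cnj (h x) = indicator (cube \<beta>) x * chr (lat (2 * pi / \<beta>) k) x" for x
      by (simp add: f_eq h_def t_def lat_0 indicator_def \<omega>_def)
    then show ?thesis using True integral_cube_chr[OF \<beta>, of k] by (simp add: l2inner_def)
  next
    case False
    then obtain i where i: "j $ i \<noteq> 0" by (auto simp: vec_eq_iff)
    \<comment> \<open>Second use of \<alpha>\<beta> \<le> 1: for nonzero \<open>j\<close> the cube
      of side \<beta> moves by at least \<open>L \<ge> \<beta>\<close> in some coordinate, so the
      supports are disjoint.\<close>
    have "f x * cnj (h x) = 0" for x
    proof (rule ccontr)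
      assume "f x * cnj (h x) \<noteq> 0"
      then have "x \<in> cube \<beta>" "x + t \<in> cube \<beta>" by (auto simp: f_eq h_def indicator_def split: if_splits)
      then have "0 \<le> x $ i" "x $ i < \<beta>" "0 \<le> x $ i + t $ i" "x $ i + t $ i < \<beta>"
        by (auto simp: cube_def)
      then have "\<bar>t $ i\<bar> < \<beta>" by linarith
      moreover have "L * 1 \<le> L * \<bar>of_int (j $ i)\<bar>" using i L by (intro mult_left_mono) (auto simp flip: of_int_abs)
      then have "L \<le> \<bar>t $ i\<bar>" using L by (simp add: t_def lat_def abs_mult)
      ultimately show False using \<beta>L by simp
    qed
    then have "l2inner f h = (LINT x|(lebesgue :: (real^'n) measure). 0)" unfolding l2inner_def by (simp only:)
    then show ?thesis using False by simp
  qed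
  then have "of_real (L ^ CARD('n)) * l2inner (TF (t, \<omega>) g) gt = (if j = 0 \<and> k = 0 then of_real (\<beta> ^ CARD('n)) else 0)"
    using eq by (simp add: l2inner_def H_def[abs_def])
  then have "of_real (\<alpha> ^ CARD('n)) * (of_real (L ^ CARD('n)) * l2inner (TF (t, \<omega>) g) gt)
      = of_real (\<alpha> ^ CARD('n)) * (if j = 0 \<and> k = 0 then of_real (\<beta> ^ CARD('n)) else 0)" by simp
  moreover have "complex_of_real (\<alpha> ^ CARD('n)) * (of_real (L ^ CARD('n)) * z) = z" for z
    using \<alpha> by (simp add: L_def power_divide)
  ultimately have "l2inner (TF (t, \<omega>) g) gt = of_real (\<alpha> ^ CARD('n)) * (if j = 0 \<and> k = 0 then of_real (\<beta> ^ CARD('n)) else 0)"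
    by metis
  then show ?thesis by (simp add: t_def \<omega>_def L_def power_mult_distrib)
qed

section \<open>Means along orbits of time-frequency shifts\<close>

lemma norm_sum_powers_le:
  fixes z :: complex
  assumes "cmod z = 1" "z \<noteq> 1" shows "cmod (\<Sum>k<n. z ^ k) \<le> 2 / cmod (1 - z)"
proof -
  have "(\<Sum>k<n. z ^ k) = (1 - z ^ n) / (1 - z)" using assms by (simp add: sum_gp_strict)
  moreover have "cmod (1 - z ^ n) \<le> 2"
    using norm_triangle_ineq4[of 1 "z ^ n"] assms by (simp add: norm_power)
  ultimately show ?thesis using assms by (simp add: norm_divide divide_right_mono)
qed

lemma mean_powers_tendsto:
  fixes z :: complex
  assumes "cmod z = 1"
  shows "(\<lambda>n. (\<Sum>k<n. z ^ k) / of_nat n) \<longlonglongrightarrow> (if z = 1 then 1 else 0)"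
proof (cases "z = 1")
  case True
  have "(\<lambda>n. (\<Sum>k<n. z ^ k) / of_nat n) \<longlonglongrightarrow> 1"
    using True by (intro tendsto_eventually) (auto simp: eventually_sequentially intro!: exI[of _ 1])
  then show ?thesis using True by simp
next
  case False
  have "(\<lambda>n. (\<Sum>k<n. z ^ k) / of_nat n) \<longlonglongrightarrow> 0"
  proof (rule Lim_null_comparison)
    show "\<forall>\<^sub>F n in sequentially. norm ((\<Sum>k<n. z ^ k) / of_nat n) \<le> 2 / cmod (1 - z) * (1 / real n)"
    proof (intro always_eventually allI)
      fix n :: nat
      have "cmod (\<Sum>k<n. z ^ k) / real n \<le> 2 / cmod (1 - z) / real n"
        by (intro divide_right_mono norm_sum_powers_le assms False) simp
      then show "norm ((\<Sum>k<n. z ^ k) / of_nat n) \<le> 2 / cmod (1 - z) * (1 / real n)" by (simp add: norm_divide)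
    qed
    have "(\<lambda>n. 2 / cmod (1 - z) * (1 / real n)) \<longlonglongrightarrow> 2 / cmod (1 - z) * 0"
      by (intro tendsto_intros lim_1_over_n)
    then show "(\<lambda>n. 2 / cmod (1 - z) * (1 / real n)) \<longlonglongrightarrow> 0" by simp
  qed
  then show ?thesis using False by simp
qed

text \<open>Pigeonhole: times in the same cell of a grid on the torus differ by a return time.\<close>

lemma simultaneous_recurrence:
  fixes F :: "'l set"
  assumes F: "finite F" and \<eta>: "\<eta> > 0"
  shows "\<exists>L>0. \<forall>z :: 'l \<Rightarrow> complex. (\<forall>l. cmod (z l) = 1) \<longrightarrow>
    (\<forall>n::nat. n \<le> L * card {k\<in>{..<n}. \<forall>l\<in>F. cmod (z l ^ k - 1) \<le> \<eta>})"
proof -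
  \<comment> \<open>Half of \<eta>, because real and imaginary part each contribute one cell
    width.\<close>
  define \<delta> where "\<delta> = \<eta> / 2"
  have \<delta>: "\<delta> > 0" using \<eta> by (simp add: \<delta>_def)
  define N where "N = \<lceil>1 / \<delta>\<rceil> + 1"
  define Y where "Y = PiE F (\<lambda>_. {-N..N} \<times> {-N..N})"
  have finY: "finite Y" unfolding Y_def using F by (intro finite_PiE) auto
  have fl: "\<lfloor>x / \<delta>\<rfloor> \<in> {-N..N}" if "\<bar>x\<bar> \<le> 1" for x
  proof -
    have "x / \<delta> \<le> 1 / \<delta>" "- (1 / \<delta>) \<le> x / \<delta>" using that \<delta> by (auto simp: field_simps)
    then show ?thesis unfolding N_def by (auto; linarith)
  qed
  have "n \<le> card Y * card {k\<in>{..<n}. \<forall>l\<in>F. cmod (z l ^ k - 1) \<le> \<eta>}"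
    if z: "\<And>l. cmod (z l) = 1" for z :: "'l \<Rightarrow> complex" and n :: nat
  proof -
    let ?E = "{k\<in>{..<n}. \<forall>l\<in>F. cmod (z l ^ k - 1) \<le> \<eta>}"
    define C where "C k = restrict (\<lambda>l. (\<lfloor>Re (z l ^ k) / \<delta>\<rfloor>, \<lfloor>Im (z l ^ k) / \<delta>\<rfloor>)) F" for k :: nat
    have znorm: "cmod (z l ^ k) = 1" for l k using z by (simp add: norm_power)
    have CY: "C k \<in> Y" for k
    proof -
      have "\<bar>Re (z l ^ k)\<bar> \<le> 1" "\<bar>Im (z l ^ k)\<bar> \<le> 1" for l
        using abs_Re_le_cmod[of "z l ^ k"] abs_Im_le_cmod[of "z l ^ k"] znorm by auto
      then have "(\<lfloor>Re (z l ^ k) / \<delta>\<rfloor>, \<lfloor>Im (z l ^ k) / \<delta>\<rfloor>) \<in> {-N..N} \<times> {-N..N}" for l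
        using fl by blast
      then show ?thesis unfolding C_def Y_def by (intro restrict_PiE_iff[THEN iffD2]) blast
    qed
    \<comment> \<open>Subtracting the earliest time \<open>k0\<close> spent in a cell maps its times
      injectively to return times below \<open>n\<close>, since the numbers z l are
      unimodular.\<close>
    have fibre: "card {k\<in>{..<n}. C k = y} \<le> card ?E" for y
    proof (cases "{k\<in>{..<n}. C k = y} = {}")
      case True
      then show ?thesis by (simp only: card.empty le0)
    next
      case False
      define k0 where "k0 = Min {k\<in>{..<n}. C k = y}"
      have fin: "finite {k\<in>{..<n}. C k = y}" by simp
      have k0: "k0 \<in> {k\<in>{..<n}. C k = y}" unfolding k0_def by (rule Min_in[OF fin False])
      have le: "k0 \<le> k" if "k \<in> {k\<in>{..<n}. C k = y}" for k unfolding k0_def by (rule Min_le[OF fin that])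
      show ?thesis
      proof (rule card_inj_on_le[where f="\<lambda>k. k - k0"])
        show "inj_on (\<lambda>k. k - k0) {k\<in>{..<n}. C k = y}"
        proof (rule inj_onI)
          fix i j assume "i \<in> {k\<in>{..<n}. C k = y}" "j \<in> {k\<in>{..<n}. C k = y}" "i - k0 = j - k0"
          then show "i = j" using le[of i] le[of j] by arith
        qed
        show "(\<lambda>k. k - k0) ` {k\<in>{..<n}. C k = y} \<subseteq> ?E"
        proof (rule image_subsetI)
          fix k assume k: "k \<in> {k\<in>{..<n}. C k = y}"
          have "cmod (z l ^ (k - k0) - 1) \<le> \<eta>" if l: "l \<in> F" for l
          proof -
            have "C k l = C k0 l" using k k0 by auto
            then have flo: "\<lfloor>Re (z l ^ k) / \<delta>\<rfloor> = \<lfloor>Re (z l ^ k0) / \<delta>\<rfloor>" "\<lfloor>Im (z l ^ k) / \<delta>\<rfloor> = \<lfloor>Im (z l ^ k0) / \<delta>\<rfloor>"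
              using l by (auto simp: C_def)
            have close: "\<bar>a - b\<bar> \<le> \<delta>" if "\<lfloor>a / \<delta>\<rfloor> = \<lfloor>b / \<delta>\<rfloor>" for a b
            proof -
              have "\<bar>a / \<delta> - b / \<delta>\<bar> \<le> 1" using that by linarith
              then have "\<bar>a - b\<bar> / \<delta> \<le> 1" using \<delta> by (simp add: abs_divide flip: diff_divide_distrib)
              then show ?thesis using \<delta> by (simp add: field_simps)
            qed
            have "cmod (z l ^ (k - k0) - 1) = cmod (z l ^ k0 * (z l ^ (k - k0) - 1))"
              using znorm by (simp add: norm_mult)
            also have "z l ^ k0 * (z l ^ (k - k0) - 1) = z l ^ k - z l ^ k0"
              using le[OF k] by (simp add: right_diff_distrib flip: power_add)
            also have "cmod \<dots> \<le> \<bar>Re (z l ^ k) - Re (z l ^ k0)\<bar> + \<bar>Im (z l ^ k) - Im (z l ^ k0)\<bar>"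
              using cmod_le[of "z l ^ k - z l ^ k0"] by simp
            also have "\<dots> \<le> \<delta> + \<delta>" using flo by (intro add_mono close)
            finally show ?thesis by (simp add: \<delta>_def)
          qed
          then show "k - k0 \<in> ?E" using k by auto
        qed
      qed simp
    qed
    have "n = card (\<Union>y\<in>Y. {k\<in>{..<n}. C k = y})"
    proof -
      have "(\<Union>y\<in>Y. {k\<in>{..<n}. C k = y}) = {..<n}" using CY by auto
      then show ?thesis by simp
    qed
    also have "\<dots> \<le> (\<Sum>y\<in>Y. card {k\<in>{..<n}. C k = y})" by (rule card_UN_le[OF finY])
    also have "\<dots> \<le> card Y * card ?E" using sum_bounded_above[of Y _ "card ?E"] fibre by simp
    finally show ?thesis .
  qed
  note main = this
  \<comment> \<open>\<open>card Y\<close> depends neither on \<open>z\<close> nor on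
    \<open>n\<close>; the \<open>+ 1\<close> gives positivity without showing that \<open>Y\<close>
    is nonempty.\<close>
  show ?thesis
  proof (intro exI[of _ "card Y + 1"] conjI allI impI)
    fix z :: "'l \<Rightarrow> complex" and n assume "\<forall>l. cmod (z l) = 1"
    then have "n \<le> card Y * card {k\<in>{..<n}. \<forall>l\<in>F. cmod (z l ^ k - 1) \<le> \<eta>}" by (intro main) simp
    also have "\<dots> \<le> (card Y + 1) * card {k\<in>{..<n}. \<forall>l\<in>F. cmod (z l ^ k - 1) \<le> \<eta>}"
      by (rule mult_le_mono1) simp
    finally show "n \<le> (card Y + 1) * card {k\<in>{..<n}. \<forall>l\<in>F. cmod (z l ^ k - 1) \<le> \<eta>}" .
  qed simp
qed

lemma sympl_scaleR: "sympl l (r *\<^sub>R v) = r * sympl l v"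
  by (simp add: sympl_def right_diff_distrib)

lemma exp_sympl_power: "exp (\<i> * complex_of_real (sympl l (real k *\<^sub>R v))) = exp (\<i> * complex_of_real (sympl l v)) ^ k"
  by (simp add: sympl_scaleR mult_ac flip: exp_of_nat_mult)

text \<open>For nonzero \<open>l\<close> the phase is trivial only on countably many hyperplanes,
  where the symplectic pairing is a multiple of 2 pi. Finitely many such families form a null set,
  so some \<open>v\<close> avoids them all.\<close>

lemma exists_generic_direction:
  fixes F :: "((real^'n) \<times> (real^'n)) set"
  assumes "finite F"
  shows "\<exists>v. \<forall>l\<in>F. l \<noteq> 0 \<longrightarrow> exp (\<i> * complex_of_real (sympl l v)) \<noteq> 1"
proof -
  define B where "B = (\<Union>l\<in>F - {0}. \<Union>j::int. {v. (snd l, - fst l) \<bullet> v = of_int (2 * j) * pi})"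
  have "negligible {v. (snd l, - fst l) \<bullet> v = b}" if "l \<noteq> 0" for l :: "(real^'n) \<times> (real^'n)" and b
    using that by (intro negligible_hyperplane) (auto simp: prod_eq_iff)
  then have "negligible (\<Union>j::int. {v. (snd l, - fst l) \<bullet> v = of_int (2 * j) * pi})" if "l \<noteq> 0"
    for l :: "(real^'n) \<times> (real^'n)" using that by (intro negligible_countable_Union) auto
  then have "negligible B"
    unfolding B_def using assms by (intro negligible_countable_Union) (auto simp: countable_finite)
  then have "B \<noteq> UNIV" using open_not_negligible[OF open_UNIV] by auto
  then obtain v where v: "v \<notin> B" by auto
  have "exp (\<i> * complex_of_real (sympl l v)) \<noteq> 1" if "l \<in> F" "l \<noteq> 0" for l
  proof
    assume "exp (\<i> * complex_of_real (sympl l v)) = 1"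
    then obtain j :: int where "sympl l v = of_int (2 * j) * pi" by (auto simp: exp_eq_1)
    then have "(snd l, - fst l) \<bullet> v = of_int (2 * j) * pi"
      by (simp add: sympl_def inner_prod_def inner_commute)
    then show False using v that by (auto simp: B_def)
  qed
  then show ?thesis by blast
qed

text \<open>Multiples of a single vector suffice: a generic direction already separates finitely
  many \<open>l\<close> from 0, which reduces the means to geometric sums.\<close>

definition orbit_mean :: "(((real^'n) \<Rightarrow> complex) \<Rightarrow> ((real^'n) \<Rightarrow> complex)) \<Rightarrow> (real^'n) \<times> (real^'n) \<Rightarrow>
    ((real^'n) \<Rightarrow> complex) \<Rightarrow> nat \<Rightarrow> complex" where
  "orbit_mean T v f n =
    (\<Sum>k<n. l2inner (T (TF (real k *\<^sub>R v) f)) (TF (real k *\<^sub>R v) f)) / of_nat n"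

lemma l2inner_Fop_conj:
  assumes "f \<in> sqint" "h \<in> sqint"
  shows "l2inner (Fop F c (TF m f)) (TF m h) = (\<Sum>l\<in>F. c l * (exp (\<i> * complex_of_real (sympl l m)) * l2inner (TF l f) h))"
  unfolding Fop_def using assms
  by (simp add: l2inner_sum_left sqint_cmul TF_sqint l2inner_cmul_left l2inner_TF_conj)

text \<open>Conjugation weights the term of \<open>l\<close> by a mean of powers of a unimodular
  number, which tends to 0 unless that number is 1; genericity leaves \<open>l = 0\<close>
  alone.\<close>

lemma orbit_mean_Fop_tendsto:
  assumes F: "finite F" "0 \<in> F" and v: "\<forall>l\<in>F. l \<noteq> 0 \<longrightarrow> exp (\<i> * complex_of_real (sympl l v)) \<noteq> 1"
    and f: "f \<in> sqint"
  shows "orbit_mean (Fop F c) v f \<longlonglongrightarrow> c 0 * of_real ((l2norm f)\<^sup>2)"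
proof -
  have "orbit_mean (Fop F c) v f = (\<lambda>n. \<Sum>l\<in>F. c l * l2inner (TF l f) f * ((\<Sum>k<n. exp (\<i> * complex_of_real (sympl l v)) ^ k) / of_nat n))"
  proof
    fix n
    have "(\<Sum>k<n. \<Sum>l\<in>F. c l * (exp (\<i> * complex_of_real (sympl l v)) ^ k * l2inner (TF l f) f))
      = (\<Sum>l\<in>F. c l * l2inner (TF l f) f * (\<Sum>k<n. exp (\<i> * complex_of_real (sympl l v)) ^ k))"
      by (subst sum.swap) (simp add: sum_distrib_left mult_ac)
    then show "orbit_mean (Fop F c) v f n = (\<Sum>l\<in>F. c l * l2inner (TF l f) f * ((\<Sum>k<n. exp (\<i> * complex_of_real (sympl l v)) ^ k) / of_nat n))"
      unfolding orbit_mean_def l2inner_Fop_conj[OF f f] exp_sympl_power times_divide_eq_right sum_divide_distrib[symmetric]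
      by (simp only:)
  qed
  moreover have "\<dots> \<longlonglongrightarrow> (\<Sum>l\<in>F. c l * l2inner (TF l f) f * (if exp (\<i> * complex_of_real (sympl l v)) = 1 then 1 else 0))"
    by (intro tendsto_intros mean_powers_tendsto) simp
  moreover have "(\<Sum>l\<in>F. c l * l2inner (TF l f) f * (if exp (\<i> * complex_of_real (sympl l v)) = 1 then 1 else 0))
      = (\<Sum>l\<in>F. if l = 0 then c 0 * of_real ((l2norm f)\<^sup>2) else 0)"
    by (rule sum.cong) (use v in \<open>auto simp: sympl_def TF_0 l2inner_self\<close>)
  ultimately show ?thesis using F by simp
qed

lemma orbit_mean_near:
  assumes S: "maps_l2 S" and T: "maps_l2 T" and near: "near S T e" and e: "e \<ge> 0" and f: "f \<in> sqint"
  shows "cmod (orbit_mean S v f n - orbit_mean T v f n) \<le> e * (l2norm f)\<^sup>2"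
proof (cases "n = 0")
  \<comment> \<open>For \<open>n = 0\<close> both means are 0 by the convention for division by
    zero.\<close>
  case True
  then show ?thesis using e by (simp add: orbit_mean_def)
next
  case False
  have pointwise: "cmod (l2inner (S (TF m f)) (TF m f) - l2inner (T (TF m f)) (TF m f)) \<le> e * (l2norm f)\<^sup>2" for m
  proof -
    have mf: "TF m f \<in> sqint" by (rule TF_sqint[OF f])
    have sq: "S (TF m f) \<in> sqint" "T (TF m f) \<in> sqint" using S T mf by (auto simp: maps_l2_def)
    have "cmod (l2inner (S (TF m f)) (TF m f) - l2inner (T (TF m f)) (TF m f))
      = cmod (l2inner (\<lambda>x. S (TF m f) x - T (TF m f) x) (TF m f))" by (simp add: l2inner_diff_left sq mf)
    also have "\<dots> \<le> l2norm (\<lambda>x. S (TF m f) x - T (TF m f) x) * l2norm (TF m f)"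
      by (rule l2_Cauchy_Schwarz[OF sqint_diff[OF sq] mf])
    also have "\<dots> \<le> (e * l2norm (TF m f)) * l2norm (TF m f)"
      using near mf by (intro mult_right_mono l2norm_nonneg) (auto simp: near_def)
    also have "\<dots> = e * (l2norm f)\<^sup>2" by (simp add: l2norm_TF f power2_eq_square)
    finally show ?thesis .
  qed
  have "orbit_mean S v f n - orbit_mean T v f n = (\<Sum>k<n. l2inner (S (TF (real k *\<^sub>R v) f)) (TF (real k *\<^sub>R v) f)
      - l2inner (T (TF (real k *\<^sub>R v) f)) (TF (real k *\<^sub>R v) f)) / of_nat n"
    by (simp add: orbit_mean_def sum_subtractf diff_divide_distrib)
  also have "cmod \<dots> \<le> (\<Sum>k<n. e * (l2norm f)\<^sup>2) / of_nat n"
    unfolding norm_divide norm_of_nat by (intro divide_right_mono sum_norm_le pointwise) simp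
  also have "\<dots> = e * (l2norm f)\<^sup>2" using False by simp
  finally show ?thesis .
qed

lemma exists_unit_sqint: "\<exists>f::real^'n \<Rightarrow> complex. f \<in> sqint \<and> l2norm f = 1"
proof -
  let ?f = "cube_chr 1 0 :: real^'n \<Rightarrow> complex"
  have f: "?f \<in> sqint" by (rule cube_chr_sqint) simp
  have "complex_of_real ((l2norm ?f)\<^sup>2) = 1"
    using l2inner_cube_chr[of 1 0 "0::int^'n"] by (simp add: l2inner_self[symmetric] del: of_real_power)
  then have "(l2norm ?f)\<^sup>2 = 1" by (simp only: of_real_eq_1_iff)
  then have "l2norm ?f = 1" using l2norm_nonneg[of ?f] by (simp add: power2_eq_1_iff)
  then show ?thesis using f by blast
qed

text \<open>A direction generic for both supports at once lets the two means be compared along the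
  same orbit, and the bound passes to the limit.\<close>

lemma coefficient_le_op_norm:
  fixes F G :: "((real^'n) \<times> (real^'n)) set"
  assumes F: "finite F" "0 \<in> F" and G: "finite G" "0 \<in> G" and near: "near (Fop F c) (Fop G d) e" and e: "e \<ge> 0"
  shows "cmod (c 0 - d 0) \<le> e"
proof -
  obtain f :: "real^'n \<Rightarrow> complex" where f: "f \<in> sqint" "l2norm f = 1" using exists_unit_sqint by blast
  obtain v where v: "\<forall>l\<in>F \<union> G. l \<noteq> 0 \<longrightarrow> exp (\<i> * complex_of_real (sympl l v)) \<noteq> 1"
    using exists_generic_direction[of "F \<union> G"] F G by auto
  have "(\<lambda>n. cmod (orbit_mean (Fop F c) v f n - orbit_mean (Fop G d) v f n)) \<longlonglongrightarrow>
      cmod (c 0 * of_real ((l2norm f)\<^sup>2) - d 0 * of_real ((l2norm f)\<^sup>2))"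
    by (intro tendsto_intros orbit_mean_Fop_tendsto F G f) (use v in auto)
  then have "(\<lambda>n. cmod (orbit_mean (Fop F c) v f n - orbit_mean (Fop G d) v f n)) \<longlonglongrightarrow> cmod (c 0 - d 0)"
    by (simp add: f(2))
  then show ?thesis
    by (rule LIMSEQ_le_const2)
      (use orbit_mean_near[OF maps_l2_Fop maps_l2_Fop near e f(1)] f(2) in auto)
qed

section \<open>The trace\<close>

text \<open>Characterized by its error estimates instead of as the limit of a chosen sequence, so
  that it depends on \<open>T\<close> alone and any approximant can be used directly.\<close>

definition trace_state :: "(((real^'n) \<Rightarrow> complex) \<Rightarrow> ((real^'n) \<Rightarrow> complex)) \<Rightarrow> complex" where
  "trace_state T = (SOME z. \<forall>e F c. 0 \<le> e \<longrightarrow> finite F \<longrightarrow> 0 \<in> F \<longrightarrow> near T (Fop F c) e \<longrightarrow> cmod (c 0 - z) \<le> e)"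

lemma finitely_approx_maps: "finitely_approx T \<Longrightarrow> maps_l2 T"
  by (simp add: finitely_approx_def)

lemma finitely_approxE:
  assumes "finitely_approx T" "e > 0"
  obtains F c where "finite F" "0 \<in> F" "near T (Fop F c) e"
  using assms unfolding finitely_approx_def by metis

text \<open>Shows that a number as chosen in \<open>trace_state\<close> exists: coefficients at 0 of
  approximants with errors \<open>1 / real (Suc n)\<close> are Cauchy by
  \<open>coefficient_le_op_norm\<close>, and their limit meets every estimate.\<close>

lemma trace_state_near:
  assumes T: "finitely_approx T" and F: "finite F" "0 \<in> F" "near T (Fop F c) e" and e: "e \<ge> 0"
  shows "cmod (c 0 - trace_state T) \<le> e"
proof -
  have mT: "maps_l2 T" by (rule finitely_approx_maps[OF T])
  have cmp: "cmod (c 0 - d 0) \<le> e + e'"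
    if "finite F" "0 \<in> F" "near T (Fop F c) e" "finite G" "0 \<in> G" "near T (Fop G d) e'" "e \<ge> 0" "e' \<ge> 0"
    for F G c d e e'
    by (rule coefficient_le_op_norm[OF that(1,2,4,5) near_trans[OF maps_l2_Fop mT maps_l2_Fop near_sym[OF that(3)] that(6)]])
      (use that in simp)
  have "\<exists>F c. finite F \<and> 0 \<in> F \<and> near T (Fop F c) (1 / real (Suc n))" for n
    by (rule finitely_approxE[OF T, of "1 / real (Suc n)"]) auto
  then obtain Fn cn where n: "\<And>n. finite (Fn n)" "\<And>n. 0 \<in> Fn n" "\<And>n. near T (Fop (Fn n) (cn n)) (1 / real (Suc n))"
    by metis
  have lim0: "(\<lambda>n. 1 / real (Suc n)) \<longlonglongrightarrow> 0" using LIMSEQ_inverse_real_of_nat by (simp add: inverse_eq_divide)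
  have "Cauchy (\<lambda>n. cn n 0)"
  proof (rule metric_CauchyI)
    fix r :: real assume "r > 0"
    then obtain N where N: "1 / real (Suc N) < r / 2" using nat_approx_posE[of "r / 2"] by auto
    have "dist (cn m 0) (cn k 0) < r" if "m \<ge> N" "k \<ge> N" for m k
    proof -
      have "dist (cn m 0) (cn k 0) \<le> 1 / real (Suc m) + 1 / real (Suc k)"
        unfolding dist_norm by (rule cmp[OF n(1-3) n(1-3)]) auto
      also have "\<dots> \<le> 1 / real (Suc N) + 1 / real (Suc N)"
        using that by (intro add_mono divide_left_mono) auto
      finally show ?thesis using N by simp
    qed
    then show "\<exists>M. \<forall>m\<ge>M. \<forall>n\<ge>M. dist (cn m 0) (cn n 0) < r" by blast
  qed
  then obtain z where z: "(\<lambda>n. cn n 0) \<longlonglongrightarrow> z" using Cauchy_convergent convergent_def by blast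
  have "cmod (c 0 - z) \<le> e" if "0 \<le> e" "finite F" "0 \<in> F" "near T (Fop F c) e" for e F c
  proof (rule LIMSEQ_le)
    show "(\<lambda>n. cmod (c 0 - cn n 0)) \<longlonglongrightarrow> cmod (c 0 - z)" by (intro tendsto_intros z)
    have "(\<lambda>n. e + 1 / real (Suc n)) \<longlonglongrightarrow> e + 0" by (intro tendsto_intros lim0)
    then show "(\<lambda>n. e + 1 / real (Suc n)) \<longlonglongrightarrow> e" by simp
    show "\<exists>N. \<forall>n\<ge>N. cmod (c 0 - cn n 0) \<le> e + 1 / real (Suc n)"
      using cmp[OF that(2-4) n that(1)] by simp
  qed
  then have "\<forall>e F c. 0 \<le> e \<longrightarrow> finite F \<longrightarrow> 0 \<in> F \<longrightarrow> near T (Fop F c) e \<longrightarrow> cmod (c 0 - z) \<le> e" by simp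
  then have "\<forall>e F c. 0 \<le> e \<longrightarrow> finite F \<longrightarrow> 0 \<in> F \<longrightarrow> near T (Fop F c) e \<longrightarrow> cmod (c 0 - trace_state T) \<le> e"
    unfolding trace_state_def by (rule someI)
  then show ?thesis using F e by simp
qed

lemma trace_state_eqI:
  assumes T: "finitely_approx T"
    and "\<And>e. e > 0 \<Longrightarrow> \<exists>F c. finite F \<and> 0 \<in> F \<and> near T (Fop F c) e \<and> cmod (c 0 - z) \<le> e"
  shows "trace_state T = z"
proof -
  have "dist (trace_state T) z \<le> 2 * e" if e: "e > 0" for e
  proof -
    obtain F c where F: "finite F" "0 \<in> F" "near T (Fop F c) e" "cmod (c 0 - z) \<le> e" using assms(2)[OF e] by auto
    have "cmod (c 0 - trace_state T) \<le> e" by (rule trace_state_near[OF T F(1-3)]) (use e in simp)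
    then show ?thesis using F(4) norm_triangle_ineq4[of "c 0 - z" "c 0 - trace_state T"] by (simp add: dist_norm)
  qed
  then have "dist (trace_state T) z \<le> 0 + e" if "e > 0" for e using that[THEN half_gt_zero] by fastforce
  then have "dist (trace_state T) z \<le> 0" by (rule field_le_epsilon)
  then show ?thesis by simp
qed

lemma trace_state_Aop:
  assumes "(\<lambda>l. norm (c l)) summable_on UNIV" shows "trace_state (Aop c) = c 0"
proof (rule trace_state_eqI[OF finitely_approx_Aop[OF assms]])
  fix e :: real assume "e > 0"
  then show "\<exists>F c'. finite F \<and> 0 \<in> F \<and> near (Aop c) (Fop F c') e \<and> cmod (c' 0 - c 0) \<le> e"
    using Aop_near_finite[OF assms] by (metis diff_self norm_zero less_imp_le)
qed

lemma Fop_extend: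
  assumes "finite F" "finite G"
  shows "Fop F c = Fop (F \<union> G) (\<lambda>l. if l \<in> F then c l else 0)"
  unfolding Fop_def using assms by (intro ext sum.mono_neutral_cong_left) auto

lemma trace_state_linear:
  assumes S: "finitely_approx S" and T: "finitely_approx T"
  shows "trace_state (\<lambda>f x. a * S f x + b * T f x) = a * trace_state S + b * trace_state T"
proof -
  let ?R = "\<lambda>f x. a * S f x + b * T f x"
  have mS: "maps_l2 S" and mT: "maps_l2 T" using S T by (auto intro: finitely_approx_maps)
  have mR: "maps_l2 ?R" unfolding maps_l2_def
    using mS mT by (auto simp: maps_l2_def intro!: sqint_add sqint_cmul)
  have main: "\<exists>F c. finite F \<and> 0 \<in> F \<and> near ?R (Fop F c) e \<and> cmod (c 0 - (a * trace_state S + b * trace_state T)) \<le> e"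
    if e: "e > 0" for e
  proof -
    \<comment> \<open>The errors add up to \<open>(cmod a + cmod b) * d\<close>; the
      \<open>+ 1\<close> covers \<open>a = b = 0\<close>.\<close>
    define d where "d = e / (cmod a + cmod b + 1)"
    have K: "cmod a + cmod b + 1 > 0" by (simp add: add_nonneg_pos)
    have d: "d > 0" using e K by (simp add: d_def)
    have d_le: "cmod a * d + cmod b * d \<le> e"
    proof -
      have "(cmod a + cmod b) * d \<le> (cmod a + cmod b + 1) * d" using d by simp
      also have "\<dots> = e" using K by (simp add: d_def)
      finally show ?thesis by (simp add: distrib_right)
    qed
    obtain F c where F: "finite F" "0 \<in> F" "near S (Fop F c) d" by (rule finitely_approxE[OF S d])
    obtain G c' where G: "finite G" "0 \<in> G" "near T (Fop G c') d" by (rule finitely_approxE[OF T d])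
    define h where "h l = a * (if l \<in> F then c l else 0) + b * (if l \<in> G then c' l else 0)" for l
    have h: "Fop (F \<union> G) h f x = a * Fop F c f x + b * Fop G c' f x" for f x
      unfolding Fop_extend[OF F(1) G(1), of c] Fop_extend[OF G(1) F(1), of c'] Un_commute[of G F]
      by (simp add: Fop_def h_def sum_distrib_left distrib_right sum.distrib mult.assoc del: mult_if_delta)
    have "near ?R (Fop (F \<union> G) h) e"
      unfolding near_def
    proof
      fix f :: "real^'a \<Rightarrow> complex" assume f: "f \<in> sqint"
      have sq: "(\<lambda>x. S f x - Fop F c f x) \<in> sqint" "(\<lambda>x. T f x - Fop G c' f x) \<in> sqint"
        using mS mT f by (auto simp: maps_l2_def intro!: sqint_diff Fop_sqint)
      have "(\<lambda>x. ?R f x - Fop (F \<union> G) h f x) = (\<lambda>x. a * (S f x - Fop F c f x) + b * (T f x - Fop G c' f x))"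
        by (simp add: h algebra_simps)
      then have "l2norm (\<lambda>x. ?R f x - Fop (F \<union> G) h f x) \<le>
          cmod a * l2norm (\<lambda>x. S f x - Fop F c f x) + cmod b * l2norm (\<lambda>x. T f x - Fop G c' f x)"
        using l2norm_triangle[OF sqint_cmul[OF sq(1), of a] sqint_cmul[OF sq(2), of b]] by (simp add: l2norm_cmul)
      also have "\<dots> \<le> cmod a * (d * l2norm f) + cmod b * (d * l2norm f)"
        using F(3) G(3) f by (intro add_mono mult_left_mono) (auto simp: near_def)
      also have "\<dots> = (cmod a * d + cmod b * d) * l2norm f" by (simp add: algebra_simps)
      also have "\<dots> \<le> e * l2norm f" by (intro mult_right_mono d_le l2norm_nonneg)
      finally show "l2norm (\<lambda>x. ?R f x - Fop (F \<union> G) h f x) \<le> e * l2norm f" .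
    qed
    moreover have "cmod (h 0 - (a * trace_state S + b * trace_state T)) \<le> e"
    proof -
      have "h 0 - (a * trace_state S + b * trace_state T) = a * (c 0 - trace_state S) + b * (c' 0 - trace_state T)"
        using F(2) G(2) by (simp add: h_def algebra_simps)
      also have "cmod \<dots> \<le> cmod a * cmod (c 0 - trace_state S) + cmod b * cmod (c' 0 - trace_state T)"
        using norm_triangle_ineq by (simp add: norm_mult[symmetric])
      also have "\<dots> \<le> cmod a * d + cmod b * d"
        using trace_state_near[OF S F] trace_state_near[OF T G] d by (intro add_mono mult_left_mono) auto
      finally show ?thesis using d_le by simp
    qed
    ultimately show ?thesis using F G by (intro exI[of _ "F \<union> G"] exI[of _ h]) auto
  qed
  then have "finitely_approx ?R" unfolding finitely_approx_def using mR by meson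
  then show ?thesis by (rule trace_state_eqI) (rule main)
qed

lemma finitely_approx_bounded:
  assumes T: "finitely_approx T"
  shows "\<exists>K\<ge>0. \<forall>f\<in>sqint. l2norm (T f) \<le> K * l2norm f"
proof -
  have mT: "maps_l2 T" by (rule finitely_approx_maps[OF T])
  obtain F c where F: "near T (Fop F c) 1" by (rule finitely_approxE[OF T zero_less_one])
  let ?K = "1 + (\<Sum>l\<in>F. cmod (c l))"
  have "l2norm (T f) \<le> ?K * l2norm f" if f: "f \<in> sqint" for f
  proof -
    have "l2norm (T f) = l2norm (\<lambda>x. (T f x - Fop F c f x) + Fop F c f x)" by simp
    also have "\<dots> \<le> l2norm (\<lambda>x. T f x - Fop F c f x) + l2norm (Fop F c f)"
      using mT f by (intro l2norm_triangle sqint_diff Fop_sqint) (auto simp: maps_l2_def)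
    also have "\<dots> \<le> 1 * l2norm f + (\<Sum>l\<in>F. cmod (c l)) * l2norm f"
      using F f l2norm_Fop_le[OF f] by (intro add_mono) (auto simp: near_def)
    finally show ?thesis by (simp add: distrib_right)
  qed
  then show ?thesis by (intro exI[of _ ?K]) (auto intro!: add_nonneg_nonneg sum_nonneg)
qed

section \<open>Products of finite sums and the trace property\<close>

text \<open>The twisted convolution of \<open>c\<close> and \<open>d\<close> evaluated at 0, that
  is, the coefficient of the identity in the product; the phase is the cocycle of
  \<open>TF_TF\<close>.\<close>

definition conv0 :: "((real^'n) \<times> (real^'n)) set \<Rightarrow> ((real^'n) \<times> (real^'n) \<Rightarrow> complex) \<Rightarrow>
    ((real^'n) \<times> (real^'n)) set \<Rightarrow> ((real^'n) \<times> (real^'n) \<Rightarrow> complex) \<Rightarrow> complex" where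
  "conv0 F c G d = (\<Sum>l\<in>F. \<Sum>m\<in>G. if l + m = 0 then c l * d m * exp (- \<i> * complex_of_real (snd m \<bullet> fst l)) else 0)"

text \<open>For \<open>m = - l\<close> the cocycle takes the same value in both orders. This is the
  whole algebraic content of the trace property.\<close>

lemma conv0_commute:
  fixes F G :: "((real^'n) \<times> (real^'n)) set"
  shows "conv0 F c G d = conv0 G d F c"
proof -
  have sym: "snd m \<bullet> fst l = snd l \<bullet> fst m" if "l + m = 0" for l m :: "(real^'n) \<times> (real^'n)"
  proof -
    have "m = - l" using that by (simp add: add_eq_0_iff)
    then show ?thesis by simp
  qed
  have "conv0 F c G d = (\<Sum>m\<in>G. \<Sum>l\<in>F. if l + m = 0 then c l * d m * exp (- \<i> * complex_of_real (snd m \<bullet> fst l)) else 0)"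
    unfolding conv0_def by (rule sum.swap)
  also have "\<dots> = conv0 G d F c"
    unfolding conv0_def by (intro sum.cong refl) (auto simp: add.commute mult.commute dest: sym)
  finally show ?thesis .
qed

lemma TF_sum: "TF l (\<lambda>x. \<Sum>m\<in>G. c m * u m x) x = (\<Sum>m\<in>G. c m * TF l (u m) x)"
  by (simp add: TF_def sum_distrib_left mult_ac)

text \<open>Collect the terms of equal index. \<open>0\<close> is inserted into \<open>H\<close> so
  that \<open>h 0\<close> is a coefficient, with value 0, even when no two indices cancel.\<close>

lemma Fop_comp:
  fixes F G :: "((real^'n) \<times> (real^'n)) set"
  assumes F: "finite F" and G: "finite G"
  shows "\<exists>H h. finite H \<and> 0 \<in> H \<and> Fop F c \<circ> Fop G d = Fop H h \<and> h 0 = conv0 F c G d"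
proof -
  define ph where "ph l m = exp (- \<i> * complex_of_real (snd m \<bullet> fst l))" for l m :: "(real^'n) \<times> (real^'n)"
  define H where "H = insert 0 ((\<lambda>(l, m). l + m) ` (F \<times> G))"
  define h where "h k = (\<Sum>l\<in>F. \<Sum>m\<in>G. if l + m = k then c l * d m * ph l m else 0)" for k
  have finH: "finite H" using F G by (simp add: H_def)
  have "(Fop F c \<circ> Fop G d) f x = Fop H h f x" for f x
  proof -
    have "Fop H h f x = (\<Sum>k\<in>H. \<Sum>l\<in>F. \<Sum>m\<in>G. if l + m = k then c l * d m * ph l m * TF k f x else 0)"
      unfolding Fop_def h_def sum_distrib_right by (intro sum.cong refl) auto
    also have "\<dots> = (\<Sum>l\<in>F. \<Sum>m\<in>G. \<Sum>k\<in>H. if l + m = k then c l * d m * ph l m * TF k f x else 0)"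
      by (rule trans[OF sum.swap], rule sum.cong[OF refl], rule sum.swap)
    also have "\<dots> = (\<Sum>l\<in>F. \<Sum>m\<in>G. c l * d m * ph l m * TF (l + m) f x)"
    proof (intro sum.cong refl)
      fix l m assume "l \<in> F" "m \<in> G"
      then have "l + m \<in> H" by (auto simp: H_def)
      then show "(\<Sum>k\<in>H. if l + m = k then c l * d m * ph l m * TF k f x else 0) = c l * d m * ph l m * TF (l + m) f x"
        using finH by simp
    qed
    also have "\<dots> = (Fop F c \<circ> Fop G d) f x"
      by (simp add: Fop_def TF_sum TF_TF sum_distrib_left mult_ac ph_def)
    finally show ?thesis by simp
  qed
  then have "Fop F c \<circ> Fop G d = Fop H h" by (intro ext)
  moreover have "h 0 = conv0 F c G d" unfolding h_def conv0_def ph_def ..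
  ultimately show ?thesis using finH by (intro exI[of _ H] exI[of _ h]) (simp add: H_def)
qed

lemma Fop_diff: "Fop F c (\<lambda>x. f x - g x) = (\<lambda>x. Fop F c f x - Fop F c g x)"
  by (simp add: Fop_def TF_def right_diff_distrib sum_subtractf)

text \<open>With P and Q the approximants, ST - PQ = (S - P)T + P(T - Q). Only the finite sum P is
  moved through a difference, \<open>S\<close> not being assumed linear. As P has norm at most
  \<open>K + 1\<close>, the error is \<open>d * K + (K + 1) * d\<close>, whence the factor
  \<open>2 * K + 1\<close>.\<close>

lemma near_comp:
  assumes S: "maps_l2 S" and T: "maps_l2 T" and SP: "near S (Fop F c) d" and TQ: "near T (Fop G c') d"
    and K: "\<And>f. f \<in> sqint \<Longrightarrow> l2norm (S f) \<le> K * l2norm f" "\<And>f. f \<in> sqint \<Longrightarrow> l2norm (T f) \<le> K * l2norm f"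
    and d: "0 \<le> d" "d \<le> 1" "(2 * K + 1) * d \<le> e" and K0: "K \<ge> 0"
  shows "near (S \<circ> T) (Fop F c \<circ> Fop G c') e"
  unfolding near_def
proof
  fix f :: "real^'a \<Rightarrow> complex" assume f: "f \<in> sqint"
  let ?P = "Fop F c" and ?Q = "Fop G c'"
  have Tf: "T f \<in> sqint" and STf: "S (T f) \<in> sqint" using S T f by (auto simp: maps_l2_def)
  have Pb: "l2norm (?P h) \<le> (K + 1) * l2norm h" if h: "h \<in> sqint" for h
  proof -
    have Sh: "S h \<in> sqint" using S h by (simp add: maps_l2_def)
    have "l2norm (?P h) = l2norm (\<lambda>x. (?P h x - S h x) + S h x)" by simp
    also have "\<dots> \<le> l2norm (\<lambda>x. ?P h x - S h x) + l2norm (S h)"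
      using h Sh by (intro l2norm_triangle sqint_diff Fop_sqint)
    also have "\<dots> \<le> d * l2norm h + K * l2norm h"
      using near_sym[OF SP] K(1) h by (intro add_mono) (auto simp: near_def)
    also have "\<dots> \<le> 1 * l2norm h + K * l2norm h"
      using d by (intro add_right_mono mult_right_mono l2norm_nonneg)
    finally show ?thesis by (simp add: algebra_simps)
  qed
  have "l2norm (\<lambda>x. S (T f) x - ?P (?Q f) x) \<le> l2norm (\<lambda>x. S (T f) x - ?P (T f) x) + l2norm (\<lambda>x. ?P (T f) x - ?P (?Q f) x)"
    using Tf STf f by (intro l2norm_triangle_diff Fop_sqint)
  also have "\<dots> \<le> d * l2norm (T f) + (K + 1) * l2norm (\<lambda>x. T f x - ?Q f x)"
    using SP Tf f Pb[OF sqint_diff[OF Tf Fop_sqint[OF f]], of G c'] by (intro add_mono) (auto simp: near_def Fop_diff)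
  also have "\<dots> \<le> d * (K * l2norm f) + (K + 1) * (d * l2norm f)"
    using K(2)[OF f] TQ f d K0 by (intro add_mono mult_left_mono) (auto simp: near_def)
  also have "\<dots> = (2 * K + 1) * d * l2norm f" by (simp add: algebra_simps)
  also have "\<dots> \<le> e * l2norm f" by (intro mult_right_mono d l2norm_nonneg)
  finally show "l2norm (\<lambda>x. (S \<circ> T) f x - (?P \<circ> ?Q) f x) \<le> e * l2norm f" by simp
qed

text \<open>One pair of approximants serves both orders of composition, so that
  \<open>conv0_commute\<close> can compare their coefficients at 0.\<close>

lemma common_approx_comp:
  assumes S: "finitely_approx S" and T: "finitely_approx T" and e: "e > 0"
  shows "\<exists>F c G d. finite F \<and> finite G \<and> near (S \<circ> T) (Fop F c \<circ> Fop G d) e \<and> near (T \<circ> S) (Fop G d \<circ> Fop F c) e"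
proof -
  have mS: "maps_l2 S" and mT: "maps_l2 T" using S T by (auto intro: finitely_approx_maps)
  obtain K1 where K1: "K1 \<ge> 0" "\<And>f. f \<in> sqint \<Longrightarrow> l2norm (S f) \<le> K1 * l2norm f"
    using finitely_approx_bounded[OF S] by auto
  obtain K2 where K2: "K2 \<ge> 0" "\<And>f. f \<in> sqint \<Longrightarrow> l2norm (T f) \<le> K2 * l2norm f"
    using finitely_approx_bounded[OF T] by auto
  define K where "K = max K1 K2"
  have K0: "K \<ge> 0" using K1 by (simp add: K_def)
  have KS: "l2norm (S f) \<le> K * l2norm f" if "f \<in> sqint" for f
    using K1(2)[OF that] mult_right_mono[OF _ l2norm_nonneg[of f], of K1 K] by (simp add: K_def)
  have KT: "l2norm (T f) \<le> K * l2norm f" if "f \<in> sqint" for f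
    using K2(2)[OF that] mult_right_mono[OF _ l2norm_nonneg[of f], of K2 K] by (simp add: K_def)
  define d where "d = min 1 (e / (2 * K + 1))"
  have d: "d > 0" "d \<le> 1" using e K0 by (auto simp: d_def)
  have "(2 * K + 1) * d \<le> (2 * K + 1) * (e / (2 * K + 1))" using K0 by (intro mult_left_mono) (auto simp: d_def)
  then have de: "(2 * K + 1) * d \<le> e" using K0 by simp
  obtain F c where F: "finite F" "near S (Fop F c) d" by (rule finitely_approxE[OF S d(1)])
  obtain G c' where G: "finite G" "near T (Fop G c') d" by (rule finitely_approxE[OF T d(1)])
  have "near (S \<circ> T) (Fop F c \<circ> Fop G c') e"
    by (rule near_comp[OF mS mT F(2) G(2) KS KT]) (use d de K0 in auto)
  moreover have "near (T \<circ> S) (Fop G c' \<circ> Fop F c) e"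
    by (rule near_comp[OF mT mS G(2) F(2) KT KS]) (use d de K0 in auto)
  ultimately show ?thesis using F(1) G(1) by metis
qed

lemma finitely_approx_comp:
  assumes S: "finitely_approx S" and T: "finitely_approx T" shows "finitely_approx (S \<circ> T)"
  unfolding finitely_approx_def
proof (intro conjI allI impI)
  show "maps_l2 (S \<circ> T)" using finitely_approx_maps[OF S] finitely_approx_maps[OF T] by (simp add: maps_l2_def)
  fix e :: real assume e: "e > 0"
  obtain F c G d where F: "finite F" "finite G" "near (S \<circ> T) (Fop F c \<circ> Fop G d) e"
    using common_approx_comp[OF S T e] by auto
  obtain H h where "finite H" "0 \<in> H" "Fop F c \<circ> Fop G d = Fop H h" using Fop_comp[OF F(1,2)] by metis
  then show "\<exists>F c. finite F \<and> 0 \<in> F \<and> near (S \<circ> T) (Fop F c) e" using F(3) by metis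
qed

lemma trace_state_comp_commute:
  assumes S: "finitely_approx S" and T: "finitely_approx T"
  shows "trace_state (S \<circ> T) = trace_state (T \<circ> S)"
proof (rule trace_state_eqI[OF finitely_approx_comp[OF S T]])
  fix e :: real assume e: "e > 0"
  obtain F c G d where F: "finite F" "finite G" "near (S \<circ> T) (Fop F c \<circ> Fop G d) e" "near (T \<circ> S) (Fop G d \<circ> Fop F c) e"
    using common_approx_comp[OF S T e] by auto
  obtain H h where H: "finite H" "0 \<in> H" "Fop F c \<circ> Fop G d = Fop H h" "h 0 = conv0 F c G d"
    using Fop_comp[OF F(1,2)] by metis
  obtain H' h' where H': "finite H'" "0 \<in> H'" "Fop G d \<circ> Fop F c = Fop H' h'" "h' 0 = conv0 G d F c"
    using Fop_comp[OF F(2,1)] by metis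
  have "cmod (h' 0 - trace_state (T \<circ> S)) \<le> e"
    by (rule trace_state_near[OF finitely_approx_comp[OF T S] H'(1,2)]) (use F(4) H'(3) e in auto)
  then have "cmod (h 0 - trace_state (T \<circ> S)) \<le> e" by (simp add: H(4) H'(4) conv0_commute[of F])
  then show "\<exists>F c. finite F \<and> 0 \<in> F \<and> near (S \<circ> T) (Fop F c) e \<and> cmod (c 0 - trace_state (T \<circ> S)) \<le> e"
    using H F(3) by metis
qed

section \<open>Adjoints\<close>

text \<open>The adjoint of \<open>TF l\<close> is \<open>TF (- l)\<close> times the conjugate of the
  phase in \<open>l2inner_TF_adj\<close>; hence the reflected index, the conjugation and the
  exponential.\<close>

definition Fop_adj :: "((real^'n) \<times> (real^'n) \<Rightarrow> complex) \<Rightarrow> (real^'n) \<times> (real^'n) \<Rightarrow> complex" where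
  "Fop_adj c k = cnj (c (- k) * exp (\<i> * complex_of_real (snd k \<bullet> fst k)))"

lemma l2inner_TF_adj:
  assumes "f \<in> sqint" "h \<in> sqint"
  shows "l2inner (TF l f) h = exp (\<i> * complex_of_real (snd l \<bullet> fst l)) * l2inner f (TF (- l) h)"
proof -
  have "l2inner (TF l f) h = l2inner (TF (- l) (TF l f)) (TF (- l) h)"
    by (simp add: l2inner_TF_TF TF_sqint assms)
  also have "TF (- l) (TF l f) = (\<lambda>x. exp (\<i> * complex_of_real (snd l \<bullet> fst l)) * f x)"
    by (simp add: TF_TF TF_0)
  finally show ?thesis by (simp add: l2inner_cmul_left)
qed

lemma l2inner_Fop_adj:
  assumes f: "f \<in> sqint" and h: "h \<in> sqint"
  shows "l2inner (Fop F c f) h = l2inner f (Fop (uminus ` F) (Fop_adj c) h)"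
proof -
  have "l2inner f (Fop (uminus ` F) (Fop_adj c) h) = (\<Sum>k\<in>uminus ` F. cnj (Fop_adj c k) * l2inner f (TF k h))"
    unfolding Fop_def by (simp add: l2inner_sum_right sqint_cmul TF_sqint f h l2inner_cmul_right)
  also have "\<dots> = (\<Sum>l\<in>F. cnj (Fop_adj c (- l)) * l2inner f (TF (- l) h))"
    by (subst sum.reindex) (auto simp: inj_on_def)
  also have "\<dots> = (\<Sum>l\<in>F. c l * l2inner (TF l f) h)"
    by (simp add: Fop_adj_def l2inner_TF_adj[OF f h] mult.assoc)
  also have "\<dots> = l2inner (Fop F c f) h"
    unfolding Fop_def by (simp add: l2inner_sum_left sqint_cmul TF_sqint f h l2inner_cmul_left)
  finally show ?thesis by simp
qed

text \<open>With \<open>w\<close> the error \<open>S h - ?P' h\<close>, duality turns its squared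
  norm into the pairing of \<open>T w - Fop F c w\<close> with \<open>h\<close>, at most
  \<open>e * l2norm w * l2norm h\<close>. Cancelling one norm of \<open>w\<close> brings
  \<open>S\<close>, known only through duality, into the class.\<close>

lemma finitely_approx_adjoint:
  assumes T: "finitely_approx T" and adj: "is_adjoint S T" shows "finitely_approx S"
  unfolding finitely_approx_def
proof (intro conjI allI impI)
  show mS: "maps_l2 S" using adj by (simp add: is_adjoint_def maps_l2_def)
  have mT: "maps_l2 T" by (rule finitely_approx_maps[OF T])
  fix e :: real assume e: "e > 0"
  obtain F c where F: "finite F" "0 \<in> F" "near T (Fop F c) e" by (rule finitely_approxE[OF T e])
  let ?P' = "Fop (uminus ` F) (Fop_adj c)"
  have "near S ?P' e" unfolding near_def
  proof
    fix h :: "real^'a \<Rightarrow> complex" assume h: "h \<in> sqint"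
    define w where "w x = S h x - ?P' h x" for x
    have Sh: "S h \<in> sqint" using mS h by (simp add: maps_l2_def)
    have w: "w \<in> sqint" unfolding w_def by (rule sqint_diff[OF Sh Fop_sqint[OF h]])
    have Tw: "T w \<in> sqint" using mT w by (simp add: maps_l2_def)
    have "l2inner w w = l2inner w (S h) - l2inner w (?P' h)"
      using l2inner_diff_right[OF Sh Fop_sqint[OF h] w] by (simp add: w_def[abs_def])
    also have "l2inner w (S h) = l2inner (T w) h" using adj w h by (simp add: is_adjoint_def)
    also have "l2inner w (?P' h) = l2inner (Fop F c w) h" by (rule l2inner_Fop_adj[OF w h, symmetric])
    also have "l2inner (T w) h - l2inner (Fop F c w) h = l2inner (\<lambda>x. T w x - Fop F c w x) h"
      by (rule l2inner_diff_left[OF Tw Fop_sqint[OF w] h, symmetric])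
    finally have "(l2norm w)\<^sup>2 = cmod (l2inner (\<lambda>x. T w x - Fop F c w x) h)"
      by (metis l2inner_self norm_of_real abs_of_nonneg zero_le_power2)
    also have "\<dots> \<le> l2norm (\<lambda>x. T w x - Fop F c w x) * l2norm h"
      by (rule l2_Cauchy_Schwarz[OF sqint_diff[OF Tw Fop_sqint[OF w]] h])
    also have "\<dots> \<le> (e * l2norm w) * l2norm h"
      using F(3) w by (intro mult_right_mono l2norm_nonneg) (auto simp: near_def)
    finally have le: "l2norm w * l2norm w \<le> l2norm w * (e * l2norm h)" by (simp add: power2_eq_square mult_ac)
    have "l2norm w \<le> e * l2norm h"
    proof (cases "l2norm w = 0")
      case True
      then show ?thesis using e by (simp add: l2norm_nonneg)
    next
      case False
      then have "l2norm w > 0" using l2norm_nonneg[of w] by simp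
      then show ?thesis using le by simp
    qed
    then show "l2norm (\<lambda>x. S h x - ?P' h x) \<le> e * l2norm h" by (simp add: w_def[abs_def])
  qed
  moreover have "finite (uminus ` F)" "0 \<in> uminus ` F" using F by force+
  ultimately show "\<exists>F c. finite F \<and> 0 \<in> F \<and> near S (Fop F c) e" by metis
qed

section \<open>Positivity and faithfulness\<close>

text \<open>The direction is generic only for the support of one approximant and so is chosen after
  \<open>e\<close>; its users must argue uniformly in \<open>v\<close>. The three thirds of
  \<open>e\<close> pay for replacing \<open>A\<close> by \<open>Fop F c\<close>, for the limit of
  the mean, and for \<open>c 0\<close> against the trace.\<close>

lemma orbit_mean_approx_trace:
  assumes A: "finitely_approx A" and f: "f \<in> sqint" and e: "e > 0"
  shows "\<exists>v. \<forall>\<^sub>F n in sequentially. cmod (orbit_mean A v f n - trace_state A * of_real ((l2norm f)\<^sup>2)) \<le> e"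
proof -
  define R where "R = (l2norm f)\<^sup>2"
  have R: "R \<ge> 0" by (simp add: R_def)
  define d where "d = e / 3 * inverse (R + 1)"
  have d: "d > 0" using e R by (simp add: d_def)
  have dR: "d * R \<le> e / 3"
  proof -
    have "d * R \<le> d * (R + 1)" using d by simp
    also have "\<dots> = e / 3" using R by (simp add: d_def mult.assoc)
    finally show ?thesis .
  qed
  obtain F c where F: "finite F" "0 \<in> F" "near A (Fop F c) d" by (rule finitely_approxE[OF A d])
  obtain v where v: "\<forall>l\<in>F. l \<noteq> 0 \<longrightarrow> exp (\<i> * complex_of_real (sympl l v)) \<noteq> 1"
    using exists_generic_direction[OF F(1)] by auto
  have "\<forall>\<^sub>F n in sequentially. dist (orbit_mean (Fop F c) v f n) (c 0 * of_real R) < e / 3"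
    unfolding R_def by (rule tendstoD[OF orbit_mean_Fop_tendsto[OF F(1,2) v f]]) (use e in simp)
  then have "\<forall>\<^sub>F n in sequentially. cmod (orbit_mean A v f n - trace_state A * of_real R) \<le> e"
  proof eventually_elim
    case (elim n)
    have 1: "cmod (orbit_mean A v f n - orbit_mean (Fop F c) v f n) \<le> e / 3"
      using orbit_mean_near[OF finitely_approx_maps[OF A] maps_l2_Fop F(3) _ f, of v n] d dR by (simp add: R_def)
    have "cmod (c 0 * of_real R - trace_state A * of_real R) = cmod (c 0 - trace_state A) * R"
      using R by (simp add: norm_mult flip: left_diff_distrib)
    also have "\<dots> \<le> d * R"
      using trace_state_near[OF A F] d R by (intro mult_right_mono) auto
    finally have 2: "cmod (c 0 * of_real R - trace_state A * of_real R) \<le> e / 3" using dR by simp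
    have "orbit_mean A v f n - trace_state A * of_real R = (orbit_mean A v f n - orbit_mean (Fop F c) v f n)
        + ((orbit_mean (Fop F c) v f n - c 0 * of_real R) + (c 0 * of_real R - trace_state A * of_real R))" by simp
    also have "cmod \<dots> \<le> e / 3 + (e / 3 + e / 3)"
      using elim by (intro norm_triangle_le add_mono 1 2) (simp add: dist_norm)
    finally show ?case by simp
  qed
  then show ?thesis unfolding R_def by blast
qed

text \<open>A positive quadratic form makes every orbit mean a nonnegative real, and the trace lies
  within every \<open>e > 0\<close> of such numbers.\<close>

lemma trace_state_nonneg:
  fixes A :: "((real^'n) \<Rightarrow> complex) \<Rightarrow> ((real^'n) \<Rightarrow> complex)"
  assumes A: "finitely_approx A" and pos: "\<And>f. f \<in> sqint \<Longrightarrow> l2inner (A f) f = complex_of_real (\<rho> f) \<and> \<rho> f \<ge> 0"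
  shows "Im (trace_state A) = 0" "0 \<le> Re (trace_state A)"
proof -
  obtain f :: "real^'n \<Rightarrow> complex" where f: "f \<in> sqint" "l2norm f = 1" using exists_unit_sqint by blast
  have mean: "orbit_mean A v f n = complex_of_real ((\<Sum>k<n. \<rho> (TF (real k *\<^sub>R v) f)) / real n)" for v n
    using pos[OF TF_sqint[OF f(1)]] by (simp add: orbit_mean_def)
  have mean_nonneg: "0 \<le> (\<Sum>k<n. \<rho> (TF (real k *\<^sub>R v) f)) / real n" for v n
    using pos[OF TF_sqint[OF f(1)]] by (intro divide_nonneg_nonneg sum_nonneg) auto
  have approx: "\<exists>r\<ge>0. cmod (complex_of_real r - trace_state A) \<le> e" if e: "e > 0" for e
  proof -
    obtain v where "\<forall>\<^sub>F n in sequentially. cmod (orbit_mean A v f n - trace_state A * of_real ((l2norm f)\<^sup>2)) \<le> e"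
      using orbit_mean_approx_trace[OF A f(1) e] by auto
    then obtain n where "cmod (orbit_mean A v f n - trace_state A) \<le> e"
      using f(2) by (auto simp: eventually_sequentially)
    then show ?thesis unfolding mean using mean_nonneg by blast
  qed
  have "\<bar>Im (trace_state A)\<bar> \<le> 0 + e" if "e > 0" for e
    using approx[OF that] abs_Im_le_cmod[of "complex_of_real _ - trace_state A"] order_trans by fastforce
  then have "\<bar>Im (trace_state A)\<bar> \<le> 0" by (rule field_le_epsilon)
  then show "Im (trace_state A) = 0" by simp
  have "0 \<le> Re (trace_state A) + e" if "e > 0" for e
  proof -
    obtain r where "r \<ge> 0" "cmod (complex_of_real r - trace_state A) \<le> e" using approx[OF \<open>e > 0\<close>] by auto
    then show ?thesis using abs_Re_le_cmod[of "complex_of_real r - trace_state A"] by simp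
  qed
  then show "0 \<le> Re (trace_state A)" by (rule field_le_epsilon)
qed

text \<open>If \<open>\<langle>A f, f\<rangle> > 0\<close>, the almost periodic function \<open>m \<mapsto> \<langle>A U\<^sub>m f, U\<^sub>m f\<rangle>\<close> stays above half this value
  on a set of times of positive density along every direction, so its mean cannot vanish.\<close>

lemma trace_state_faithful:
  fixes A :: "((real^'n) \<Rightarrow> complex) \<Rightarrow> ((real^'n) \<Rightarrow> complex)"
  assumes A: "finitely_approx A" and pos: "\<And>f. f \<in> sqint \<Longrightarrow> l2inner (A f) f = complex_of_real (\<rho> f) \<and> \<rho> f \<ge> 0"
    and zero: "trace_state A = 0" and f: "f \<in> sqint"
  shows "\<rho> f = 0"
proof (rule ccontr)
  assume "\<rho> f \<noteq> 0"
  then have r: "\<rho> f > 0" using pos[OF f] by simp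
  define R where "R = (l2norm f)\<^sup>2"
  have R: "R \<ge> 0" by (simp add: R_def)
  \<comment> \<open>Comparing \<open>A\<close> at \<open>f\<close> and at a shifted \<open>f\<close>
    costs three errors of \<open>\<rho> f / 8\<close>: one at each end for passing to
    \<open>Fop F c\<close>, one for the imperfect recurrence. Their sum stays below
    \<open>\<rho> f / 2\<close>.\<close>
  define d where "d = \<rho> f / 8 * inverse (R + 1)"
  have d: "d > 0" using r R by (simp add: d_def)
  have dR: "d * R \<le> \<rho> f / 8"
  proof -
    have "d * R \<le> d * (R + 1)" using d by simp
    also have "\<dots> = \<rho> f / 8" using R by (simp add: d_def mult.assoc)
    finally show ?thesis .
  qed
  obtain F c where F: "finite F" "0 \<in> F" "near A (Fop F c) d" by (rule finitely_approxE[OF A d])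
  define C where "C = (\<Sum>l\<in>F. cmod (c l) * R)"
  have C: "C \<ge> 0" unfolding C_def using R by (intro sum_nonneg) simp
  define \<eta> where "\<eta> = inverse (C + 1) * (\<rho> f / 8)"
  have \<eta>: "\<eta> > 0" using r C by (simp add: \<eta>_def)
  have \<eta>C: "C * \<eta> \<le> \<rho> f / 8"
  proof -
    have "C * \<eta> \<le> (C + 1) * \<eta>" using \<eta> by simp
    also have "\<dots> = \<rho> f / 8" using C by (simp add: \<eta>_def flip: mult.assoc)
    finally show ?thesis .
  qed
  \<comment> \<open>\<open>L\<close> is fixed by \<open>F\<close> and \<open>\<eta>\<close> before
    any direction is chosen.\<close>
  obtain L :: nat where L: "L > 0" "\<And>(z :: (real^'n) \<times> (real^'n) \<Rightarrow> complex) n. (\<And>l. cmod (z l) = 1) \<Longrightarrow>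
      n \<le> L * card {k\<in>{..<n}. \<forall>l\<in>F. cmod (z l ^ k - 1) \<le> \<eta>}"
    using simultaneous_recurrence[OF F(1) \<eta>] by auto
  have P_near: "cmod (l2inner (A (TF m f)) (TF m f) - l2inner (Fop F c (TF m f)) (TF m f)) \<le> \<rho> f / 8" for m
  proof -
    have mf: "TF m f \<in> sqint" by (rule TF_sqint[OF f])
    have Amf: "A (TF m f) \<in> sqint" using finitely_approx_maps[OF A] mf by (simp add: maps_l2_def)
    have "cmod (l2inner (A (TF m f)) (TF m f) - l2inner (Fop F c (TF m f)) (TF m f))
      = cmod (l2inner (\<lambda>x. A (TF m f) x - Fop F c (TF m f) x) (TF m f))"
      by (simp add: l2inner_diff_left Amf mf Fop_sqint)
    also have "\<dots> \<le> l2norm (\<lambda>x. A (TF m f) x - Fop F c (TF m f) x) * l2norm (TF m f)"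
      by (rule l2_Cauchy_Schwarz[OF sqint_diff[OF Amf Fop_sqint[OF mf]] mf])
    also have "\<dots> \<le> (d * l2norm (TF m f)) * l2norm (TF m f)"
      using F(3) mf by (intro mult_right_mono l2norm_nonneg) (auto simp: near_def)
    also have "\<dots> = d * R" by (simp add: l2norm_TF f power2_eq_square R_def)
    finally show ?thesis using dR by simp
  qed
  have recur: "\<rho> f / 2 \<le> \<rho> (TF (real k *\<^sub>R v) f)"
    if k: "\<forall>l\<in>F. cmod (exp (\<i> * complex_of_real (sympl l v)) ^ k - 1) \<le> \<eta>" for k v
  proof -
    let ?m = "real k *\<^sub>R v"
    have "l2inner (Fop F c (TF ?m f)) (TF ?m f) - l2inner (Fop F c (TF 0 f)) (TF 0 f)
        = (\<Sum>l\<in>F. c l * ((exp (\<i> * complex_of_real (sympl l v)) ^ k - 1) * l2inner (TF l f) f))"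
      unfolding l2inner_Fop_conj[OF f f] exp_sympl_power
      by (simp add: sympl_def left_diff_distrib right_diff_distrib sum_subtractf)
    also have "cmod \<dots> \<le> (\<Sum>l\<in>F. cmod (c l) * R * \<eta>)"
    proof (rule sum_norm_le)
      fix l assume l: "l \<in> F"
      have "cmod (l2inner (TF l f) f) \<le> R"
        using l2_Cauchy_Schwarz[OF TF_sqint[OF f] f, of l] by (simp add: l2norm_TF f R_def power2_eq_square)
      then have "cmod (exp (\<i> * complex_of_real (sympl l v)) ^ k - 1) * cmod (l2inner (TF l f) f) \<le> \<eta> * R"
        using k l \<eta> by (intro mult_mono) auto
      then show "cmod (c l * ((exp (\<i> * complex_of_real (sympl l v)) ^ k - 1) * l2inner (TF l f) f)) \<le> cmod (c l) * R * \<eta>"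
        by (simp add: norm_mult mult.assoc mult.commute[of R] mult_left_mono)
    qed
    also have "\<dots> = C * \<eta>" by (simp add: C_def sum_distrib_right)
    finally have "cmod (l2inner (Fop F c (TF ?m f)) (TF ?m f) - l2inner (Fop F c (TF 0 f)) (TF 0 f)) \<le> \<rho> f / 8"
      using \<eta>C by simp
    moreover have "cmod (a - b) \<le> cmod (a - p) + (cmod (q - p) + cmod (b - q))" for a b p q
      using dist_triangle[of a b p] dist_triangle[of p b q] by (simp add: dist_norm norm_minus_commute)
    note this[of "l2inner (A (TF 0 f)) (TF 0 f)" "l2inner (A (TF ?m f)) (TF ?m f)"
        "l2inner (Fop F c (TF 0 f)) (TF 0 f)" "l2inner (Fop F c (TF ?m f)) (TF ?m f)"]
    moreover note P_near[of 0] P_near[of ?m]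
    ultimately have "cmod (l2inner (A (TF 0 f)) (TF 0 f) - l2inner (A (TF ?m f)) (TF ?m f)) \<le> \<rho> f / 2" using r by linarith
    moreover have "l2inner (A (TF 0 f)) (TF 0 f) - l2inner (A (TF ?m f)) (TF ?m f) = of_real (\<rho> f - \<rho> (TF ?m f))"
      using pos[OF TF_sqint[OF f], of ?m] pos[OF f] by (simp add: TF_0)
    ultimately have "\<bar>\<rho> f - \<rho> (TF ?m f)\<bar> \<le> \<rho> f / 2" by (simp only: norm_of_real)
    then show ?thesis by linarith
  qed
  \<comment> \<open>At least a fraction \<open>1 / L\<close> of the times contributes
    \<open>\<rho> f / 2\<close> or more, and all other terms are nonnegative.\<close>
  have lower: "\<rho> f / (2 * real L) \<le> cmod (orbit_mean A v f n)" if n: "n > 0" for v n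
  proof -
    define E where "E = {k\<in>{..<n}. \<forall>l\<in>F. cmod (exp (\<i> * complex_of_real (sympl l v)) ^ k - 1) \<le> \<eta>}"
    have "n \<le> L * card E" unfolding E_def by (rule L(2)) simp
    then have nE: "real n \<le> real L * real (card E)" by (metis of_nat_le_iff of_nat_mult)
    have "real (card E) * (\<rho> f / 2) = (\<Sum>k\<in>E. \<rho> f / 2)" by simp
    also have "\<dots> \<le> (\<Sum>k\<in>E. \<rho> (TF (real k *\<^sub>R v) f))" by (rule sum_mono, rule recur) (simp add: E_def)
    also have "\<dots> \<le> (\<Sum>k<n. \<rho> (TF (real k *\<^sub>R v) f))"
      using pos[OF TF_sqint[OF f]] by (intro sum_mono2) (auto simp: E_def)
    finally have sum_ge: "real (card E) * (\<rho> f / 2) \<le> (\<Sum>k<n. \<rho> (TF (real k *\<^sub>R v) f))" .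
    have "real n * (\<rho> f / 2) \<le> real L * real (card E) * (\<rho> f / 2)" using nE r by (intro mult_right_mono) auto
    also have "\<dots> \<le> real L * (\<Sum>k<n. \<rho> (TF (real k *\<^sub>R v) f))"
      using sum_ge by (simp add: mult.assoc mult_left_mono)
    finally have "\<rho> f / (2 * real L) \<le> (\<Sum>k<n. \<rho> (TF (real k *\<^sub>R v) f)) / real n"
      using L(1) n by (simp add: field_simps)
    also have "\<dots> \<le> cmod (complex_of_real ((\<Sum>k<n. \<rho> (TF (real k *\<^sub>R v) f)) / real n))"
      unfolding norm_of_real by (rule abs_ge_self)
    also have "complex_of_real ((\<Sum>k<n. \<rho> (TF (real k *\<^sub>R v) f)) / real n) = orbit_mean A v f n"
      using pos[OF TF_sqint[OF f]] by (simp add: orbit_mean_def)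
    finally show ?thesis .
  qed
  \<comment> \<open>Half of the lower bound. The direction belonging to this accuracy is covered
    because \<open>lower\<close> holds for every \<open>v\<close>.\<close>
  have "\<rho> f / (4 * real L) > 0" using r L(1) by simp
  from orbit_mean_approx_trace[OF A f this] obtain v N where
    N: "\<And>n. n \<ge> N \<Longrightarrow> cmod (orbit_mean A v f n - trace_state A * of_real ((l2norm f)\<^sup>2)) \<le> \<rho> f / (4 * real L)"
    by (auto simp: eventually_sequentially)
  have "\<rho> f / (2 * real L) \<le> \<rho> f / (4 * real L)"
    using lower[of "Suc N" v] N[of "Suc N"] by (simp add: zero)
  then show False using r L(1) by (simp add: field_simps)
qed

lemma trace_state_id: "trace_state (\<lambda>f. f :: real^'n \<Rightarrow> complex) = 1"
proof (rule trace_state_eqI)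
  have n: "near (\<lambda>f. f :: real^'n \<Rightarrow> complex) (Fop {0} (\<lambda>_. 1)) e" if "e > 0" for e
    unfolding near_def Fop_def using that by (auto simp: TF_0 l2norm_def)
  then show "finitely_approx (\<lambda>f. f :: real^'n \<Rightarrow> complex)"
    unfolding finitely_approx_def by (auto simp: maps_l2_def intro!: exI[of _ "{0}"] exI[of _ "\<lambda>_. 1"])
  fix e :: real assume "e > 0"
  then show "\<exists>F c. finite F \<and> 0 \<in> F \<and> near (\<lambda>f. f :: real^'n \<Rightarrow> complex) (Fop F c) e \<and> cmod (c 0 - 1) \<le> e"
    using n by (intro exI[of _ "{0}"] exI[of _ "\<lambda>_. 1"]) auto
qed

lemma faithful_tracial_state_trace_state:
  "faithful_tracial_state (trace_state :: (((real^'n) \<Rightarrow> complex) \<Rightarrow> ((real^'n) \<Rightarrow> complex)) \<Rightarrow> complex)"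
  unfolding faithful_tracial_state_def
proof (intro conjI allI impI)
  fix S T :: "((real^'n) \<Rightarrow> complex) \<Rightarrow> ((real^'n) \<Rightarrow> complex)" and a b
  assume ST: "in_boldA S" "in_boldA T"
  note S = in_boldA_finitely_approx[OF ST(1)] and T = in_boldA_finitely_approx[OF ST(2)]
  show "trace_state (\<lambda>f x. a * S f x + b * T f x) = a * trace_state S + b * trace_state T"
    by (rule trace_state_linear[OF S T])
  show "trace_state (S \<circ> T) = trace_state (T \<circ> S)" by (rule trace_state_comp_commute[OF S T])
next
  show "trace_state (\<lambda>f. f :: real^'n \<Rightarrow> complex) = 1" by (rule trace_state_id)
next
  fix T S :: "((real^'n) \<Rightarrow> complex) \<Rightarrow> ((real^'n) \<Rightarrow> complex)"
  assume "in_boldA T" and adj: "is_adjoint S T"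
  then have T: "finitely_approx T" by (intro in_boldA_finitely_approx)
  have A: "finitely_approx (S \<circ> T)" by (rule finitely_approx_comp[OF finitely_approx_adjoint[OF T adj] T])
  have Tf: "T f \<in> sqint" if "f \<in> sqint" for f using finitely_approx_maps[OF T] that by (simp add: maps_l2_def)
  \<comment> \<open>The quadratic form of the composite is the squared norm of \<open>T f\<close>,
    which plays the part of \<open>\<rho>\<close> in the two preceding results.\<close>
  have pos: "l2inner ((S \<circ> T) f) f = complex_of_real ((l2norm (T f))\<^sup>2) \<and> (l2norm (T f))\<^sup>2 \<ge> 0" if f: "f \<in> sqint" for f
  proof -
    have "l2inner f (S (T f)) = l2inner (T f) (T f)" using adj f Tf[OF f] by (simp add: is_adjoint_def)
    then show ?thesis by (simp add: l2inner_commute[of "S (T f)" f] l2inner_self)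
  qed
  show "Im (trace_state (S \<circ> T)) = 0" "0 \<le> Re (trace_state (S \<circ> T))"
    by (rule trace_state_nonneg[OF A pos], assumption)+
  assume zero: "trace_state (S \<circ> T) = 0"
  show "\<forall>f\<in>sqint. ae_zero (T f)"
  proof
    fix f :: "real^'n \<Rightarrow> complex" assume f: "f \<in> sqint"
    have "(l2norm (T f))\<^sup>2 = 0" by (rule trace_state_faithful[OF A pos zero f])
    then show "ae_zero (T f)" by (intro l2norm_eq_0 Tf f) simp
  qed
qed

section \<open>Averages over the Gabor lattice\<close>

text \<open>The symmetric sum is a geometric sum of length \<open>2 * M + 1\<close> times a power of
  \<open>cnj z\<close>. That factor is unimodular, so it cannot disturb a limit 0, and it is 1 when
  \<open>z = 1\<close>.\<close>

lemma symmetric_mean_tendsto: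
  "(\<lambda>M. (\<Sum>j\<in>{- int M..int M}. exp (\<i> * complex_of_real (\<theta> * of_int j))) / of_nat (2 * M + 1))
    \<longlonglongrightarrow> (if exp (\<i> * complex_of_real \<theta>) = 1 then 1 else 0)"
proof -
  define z where "z = exp (\<i> * complex_of_real \<theta>)"
  have z: "cmod z = 1" by (simp add: z_def)
  have eq: "(\<Sum>j\<in>{- int M..int M}. exp (\<i> * complex_of_real (\<theta> * of_int j))) = cnj z ^ M * (\<Sum>k<2 * M + 1. z ^ k)" for M
  proof -
    have bij: "bij_betw (\<lambda>k. int k - int M) {..<2 * M + 1} {- int M..int M}"
      by (rule bij_betwI[where g="\<lambda>j. nat (j + int M)"]) auto
    have "(\<Sum>j\<in>{- int M..int M}. exp (\<i> * complex_of_real (\<theta> * of_int j)))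
        = (\<Sum>k<2 * M + 1. exp (\<i> * complex_of_real (\<theta> * of_int (int k - int M))))"
      by (rule sum.reindex_bij_betw[OF bij, symmetric])
    also have "\<dots> = (\<Sum>k<2 * M + 1. cnj z ^ M * z ^ k)"
    proof (rule sum.cong[OF refl])
      fix k
      have "cnj z = exp (- (\<i> * complex_of_real \<theta>))" by (simp add: z_def exp_cnj)
      then have "cnj z ^ M * z ^ k = exp (of_nat M * (- (\<i> * complex_of_real \<theta>))) * exp (of_nat k * (\<i> * complex_of_real \<theta>))"
        by (simp only: z_def exp_of_nat_mult)
      also have "\<dots> = exp (\<i> * complex_of_real (\<theta> * of_int (int k - int M)))"
        unfolding exp_add[symmetric] by (simp add: algebra_simps)
      finally show "exp (\<i> * complex_of_real (\<theta> * of_int (int k - int M))) = cnj z ^ M * z ^ k" by simp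
    qed
    finally show ?thesis by (simp only: sum_distrib_left)
  qed
  have "filterlim (\<lambda>M::nat. 2 * M + 1) sequentially sequentially"
    by (rule filterlim_subseq) (simp add: strict_mono_def)
  from filterlim_compose[OF mean_powers_tendsto[OF z] this]
  have lim: "(\<lambda>M. (\<Sum>k<2 * M + 1. z ^ k) / of_nat (2 * M + 1)) \<longlonglongrightarrow> (if z = 1 then 1 else 0)" .
  have "(\<lambda>M. cnj z ^ M * ((\<Sum>k<2 * M + 1. z ^ k) / of_nat (2 * M + 1))) \<longlonglongrightarrow> (if z = 1 then 1 else 0)"
  proof (cases "z = 1")
    case True
    then show ?thesis using lim by simp
  next
    case False
    then have "(\<lambda>M. (\<Sum>k<2 * M + 1. z ^ k) / of_nat (2 * M + 1)) \<longlonglongrightarrow> 0" using lim by simp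
    then have "(\<lambda>M. cnj z ^ M * ((\<Sum>k<2 * M + 1. z ^ k) / of_nat (2 * M + 1))) \<longlonglongrightarrow> 0"
      by (rule Lim_null_comparison[rotated, OF tendsto_norm_zero])
        (simp only: norm_mult norm_power complex_mod_cnj z power_one mult_1_left order_refl eventually_True)
    then show ?thesis using False by simp
  qed
  then show ?thesis unfolding eq z_def[symmetric] by simp
qed

lemma sum_box_prod:
  fixes u :: "'n::finite \<Rightarrow> int \<Rightarrow> 'a::comm_semiring_1"
  shows "(\<Sum>m\<in>Defs.box M. \<Prod>i\<in>UNIV. u i (m $ i)) = (\<Prod>i\<in>UNIV. \<Sum>j\<in>{- int M..int M}. u i j)"
proof -
  have bij: "bij_betw vec_nth (Defs.box M :: (int^'n) set) (PiE UNIV (\<lambda>_. {- int M..int M}))"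
  proof (rule bij_betwI[where g=vec_lambda])
    show "vec_nth \<in> (Defs.box M :: (int^'n) set) \<rightarrow> PiE UNIV (\<lambda>_. {- int M..int M})"
      by (simp add: Defs.box_def Pi_def PiE_iff abs_le_iff minus_le_iff)
    show "vec_lambda \<in> PiE UNIV (\<lambda>_. {- int M..int M}) \<rightarrow> (Defs.box M :: (int^'n) set)"
      by (simp add: Defs.box_def Pi_def PiE_iff abs_le_iff minus_le_iff)
  qed (simp_all add: fun_eq_iff)
  have "(\<Prod>i\<in>UNIV. \<Sum>j\<in>{- int M..int M}. u i j) = (\<Sum>g\<in>PiE UNIV (\<lambda>_. {- int M..int M}). \<Prod>i\<in>UNIV. u i (g i))"
    by (rule prod_sum_PiE) auto
  also have "\<dots> = (\<Sum>m\<in>Defs.box M. \<Prod>i\<in>UNIV. u i (m $ i))"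
    by (rule sum.reindex_bij_betw[OF bij, symmetric])
  finally show ?thesis by simp
qed

lemma card_box: "card (Defs.box M :: (int^'n) set) = (2 * M + 1) ^ CARD('n)"
proof -
  have "card (Defs.box M :: (int^'n) set) = (\<Sum>m\<in>(Defs.box M :: (int^'n) set). \<Prod>i\<in>(UNIV::'n set). 1)" by simp
  also have "\<dots> = (\<Prod>i\<in>(UNIV::'n set). \<Sum>j\<in>{- int M..int M}. 1)"
    using sum_box_prod[of "\<lambda>_ _. 1::nat" M] .
  also have "\<dots> = (2 * M + 1) ^ CARD('n)" by (simp add: nat_add_distrib nat_mult_distrib)
  finally show ?thesis .
qed

text \<open>A character factors over coordinates and the box is a product of intervals, so the mean
  is a product of one-dimensional means.\<close>

lemma box_mean_tendsto:
  fixes w :: "real^'n"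
  shows "(\<lambda>M. (\<Sum>m\<in>Defs.box M. chr w (lat s m)) / of_nat ((2 * M + 1) ^ CARD('n)))
    \<longlonglongrightarrow> (if \<forall>i. exp (\<i> * complex_of_real (s * w $ i)) = 1 then 1 else 0)"
proof -
  have chr_prod: "chr w (lat s m) = (\<Prod>i\<in>UNIV. exp (\<i> * complex_of_real (s * w $ i * of_int (m $ i))))" for m
    by (simp add: chr_def inner_vec_def lat_def sum_distrib_left mult_ac exp_sum[symmetric])
  have "(\<Sum>m\<in>Defs.box M. chr w (lat s m)) / of_nat ((2 * M + 1) ^ CARD('n))
      = (\<Prod>i\<in>UNIV. (\<Sum>j\<in>{- int M..int M}. exp (\<i> * complex_of_real (s * w $ i * of_int j))) / of_nat (2 * M + 1))" for M
    unfolding chr_prod by (subst sum_box_prod) (simp only: prod_dividef prod_constant of_nat_power)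
  moreover have "(\<lambda>M. \<Prod>i\<in>UNIV. (\<Sum>j\<in>{- int M..int M}. exp (\<i> * complex_of_real (s * w $ i * of_int j))) / of_nat (2 * M + 1))
      \<longlonglongrightarrow> (\<Prod>i\<in>UNIV. if exp (\<i> * complex_of_real (s * w $ i)) = 1 then 1 else 0)"
    by (intro tendsto_prod symmetric_mean_tendsto)
  moreover have "(\<Prod>i\<in>UNIV. if exp (\<i> * complex_of_real (s * w $ i)) = 1 then 1 else 0 :: complex)
      = (if \<forall>i. exp (\<i> * complex_of_real (s * w $ i)) = 1 then 1 else 0)"
    by (auto intro!: prod_zero)
  ultimately show ?thesis by simp
qed

text \<open>Identifies the annihilator of a lattice with the dual lattice; applied to both
  components of \<open>l\<close> it yields the adjoint lattice.\<close>

lemma exp_eq_1_lattice: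
  fixes w :: "real^'n"
  assumes "s \<noteq> 0" "\<forall>i. exp (\<i> * complex_of_real (s * w $ i)) = 1"
  shows "\<exists>k. w = lat (2 * pi / s) k"
proof -
  have "\<exists>k::int. s * w $ i = of_int (2 * k) * pi" for i using assms(2) by (simp add: exp_eq_1)
  then obtain k :: "'n \<Rightarrow> int" where k: "\<And>i. s * w $ i = of_int (2 * k i) * pi" by metis
  have "w $ i = 2 * pi / s * of_int (k i)" for i using k[of i] assms(1) by (simp add: field_simps)
  then have "w = lat (2 * pi / s) (\<chi> i. k i)" by (simp add: lat_def vec_eq_iff)
  then show ?thesis ..
qed

text \<open>The character of \<open>l\<close> on the Gabor lattice splits into a factor in
  \<open>m\<close> and a factor in \<open>n\<close>. Hence the joint limit exists however
  \<open>M\<close> and \<open>N\<close> grow relative to each other.\<close>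

lemma gabor_avg_TF:
  fixes g gt :: "real^'n \<Rightarrow> complex"
  assumes g: "g \<in> sqint" and gt: "gt \<in> sqint"
  shows "gabor_avg \<alpha> \<beta> g gt (TF l) M N = of_real (1 / (\<alpha> * \<beta>) ^ CARD('n)) * l2inner (TF l g) gt *
    ((\<Sum>m\<in>Defs.box M. chr (- fst l) (lat (2 * pi * \<alpha>) m)) / of_nat ((2 * M + 1) ^ CARD('n)) *
     ((\<Sum>n\<in>Defs.box N. chr (snd l) (lat \<beta> n)) / of_nat ((2 * N + 1) ^ CARD('n))))"
proof -
  have "l2inner (TF l (gabor \<alpha> \<beta> g (m, n))) (gabor \<alpha> \<beta> gt (m, n))
      = chr (- fst l) (lat (2 * pi * \<alpha>) m) * chr (snd l) (lat \<beta> n) * l2inner (TF l g) gt" for m n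
  proof -
    have "exp (\<i> * complex_of_real (sympl l (lat \<beta> n, lat (2 * pi * \<alpha>) m)))
      = chr (- fst l) (lat (2 * pi * \<alpha>) m) * chr (snd l) (lat \<beta> n)"
      unfolding chr_def exp_add[symmetric] sympl_def by (simp add: inner_commute algebra_simps)
    then show ?thesis by (simp add: gabor_def l2inner_TF_conj g gt)
  qed
  then have "(\<Sum>m\<in>Defs.box M. \<Sum>n\<in>Defs.box N. l2inner (TF l (gabor \<alpha> \<beta> g (m, n))) (gabor \<alpha> \<beta> gt (m, n)))
     = (\<Sum>m\<in>Defs.box M. chr (- fst l) (lat (2 * pi * \<alpha>) m)) * (\<Sum>n\<in>Defs.box N. chr (snd l) (lat \<beta> n)) * l2inner (TF l g) gt"
    by (subst sum_product) (simp only: sum_distrib_right)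
  moreover have "(2 * real K + 1) ^ CARD('n) = real ((2 * K + 1) ^ CARD('n))" for K by (simp add: add.commute)
  ultimately show ?thesis unfolding gabor_avg_def by (simp add: mult_ac)
qed

lemma gabor_avg_TF_tendsto:
  fixes g gt :: "real^'n \<Rightarrow> complex"
  assumes \<alpha>: "0 < \<alpha>" and \<beta>: "0 < \<beta>" and \<alpha>\<beta>: "\<alpha> * \<beta> \<le> 1" and g: "g \<in> sqint" and gt: "gt \<in> sqint"
    and dual: "is_dual_frame (gabor \<alpha> \<beta> g) (gabor \<alpha> \<beta> gt)"
  shows "((\<lambda>(M, N). gabor_avg \<alpha> \<beta> g gt (TF l) M N) \<longlongrightarrow> (if l = 0 then 1 else 0)) (at_top \<times>\<^sub>F at_top)"
proof -
  define K where "K = complex_of_real (1 / (\<alpha> * \<beta>) ^ CARD('n)) * l2inner (TF l g) gt"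
  define X where "X M = (\<Sum>m\<in>Defs.box M. chr (- fst l) (lat (2 * pi * \<alpha>) m)) / of_nat ((2 * M + 1) ^ CARD('n))" for M
  define Y where "Y N = (\<Sum>n\<in>Defs.box N. chr (snd l) (lat \<beta> n)) / of_nat ((2 * N + 1) ^ CARD('n))" for N
  define x :: complex where "x = (if \<forall>i. exp (\<i> * complex_of_real (2 * pi * \<alpha> * (- fst l) $ i)) = 1 then 1 else 0)"
  define y :: complex where "y = (if \<forall>i. exp (\<i> * complex_of_real (\<beta> * snd l $ i)) = 1 then 1 else 0)"
  have X: "X \<longlonglongrightarrow> x" unfolding X_def x_def by (rule box_mean_tendsto)
  have Y: "Y \<longlonglongrightarrow> y" unfolding Y_def y_def by (rule box_mean_tendsto)
  have "((\<lambda>p. K * (X (fst p) * Y (snd p))) \<longlongrightarrow> K * (x * y)) (sequentially \<times>\<^sub>F sequentially)"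
    by (intro tendsto_intros filterlim_compose[OF X filterlim_fst] filterlim_compose[OF Y filterlim_snd])
  moreover have "K * (x * y) = (if l = 0 then 1 else 0)"
  proof (cases "x * y = 0")
    case True
    moreover have "l \<noteq> 0"
    proof
      assume "l = 0"
      then have "x = 1" "y = 1" by (auto simp: x_def y_def)
      then show False using True by simp
    qed
    ultimately show ?thesis by simp
  next
    \<comment> \<open>Both means survive only for \<open>l\<close> in the adjoint lattice. There
      \<open>Wexler_Raz\<close> gives 0 for \<open>l \<noteq> 0\<close>, and for
      \<open>l = 0\<close> the constant that cancels the normalization.\<close>
    case False
    then have hx: "\<forall>i. exp (\<i> * complex_of_real (2 * pi * \<alpha> * (- fst l) $ i)) = 1"
      and hy: "\<forall>i. exp (\<i> * complex_of_real (\<beta> * snd l $ i)) = 1"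
      by (auto simp: x_def y_def split: if_splits)
    obtain j where j: "- fst l = lat (2 * pi / (2 * pi * \<alpha>)) j" using exp_eq_1_lattice[OF _ hx] \<alpha> by auto
    obtain k where k: "snd l = lat (2 * pi / \<beta>) k" using exp_eq_1_lattice[OF _ hy] \<beta> by auto
    have j': "fst l = lat (1 / \<alpha>) (- j)" using j by (simp add: lat_minus minus_equation_iff[of "fst l"])
    have l: "l = (lat (1 / \<alpha>) (- j), lat (2 * pi / \<beta>) k)" using j' k by (simp add: prod_eq_iff)
    have inj: "lat s m = 0 \<longleftrightarrow> m = 0" if "s \<noteq> 0" for s and m :: "int^'n" using that by (simp add: lat_def vec_eq_iff)
    have l0: "l = 0 \<longleftrightarrow> - j = 0 \<and> k = 0" using \<alpha> \<beta> by (simp add: l zero_prod_def inj del: neg_equal_0_iff_equal)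
    have "l2inner (TF l g) gt = (if l = 0 then of_real ((\<alpha> * \<beta>) ^ CARD('n)) else 0)"
      unfolding l0 unfolding l by (rule Wexler_Raz[OF \<alpha> \<beta> \<alpha>\<beta> g gt dual])
    moreover have "x = 1" "y = 1" using hx hy by (auto simp: x_def y_def)
    ultimately show ?thesis using \<alpha> \<beta> by (simp add: K_def)
  qed
  ultimately show ?thesis by (simp add: gabor_avg_TF[OF g gt] K_def X_def Y_def case_prod_unfold)
qed

lemma gabor_avg_Fop:
  fixes g gt :: "real^'n \<Rightarrow> complex"
  assumes g: "g \<in> sqint" and gt: "gt \<in> sqint"
  shows "gabor_avg \<alpha> \<beta> g gt (Fop F c) M N = (\<Sum>l\<in>F. c l * gabor_avg \<alpha> \<beta> g gt (TF l) M N)"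
proof -
  have gs: "gabor \<alpha> \<beta> g p \<in> sqint" "gabor \<alpha> \<beta> gt p \<in> sqint" for p unfolding gabor_def by (auto intro: TF_sqint g gt)
  have "l2inner (Fop F c (gabor \<alpha> \<beta> g p)) (gabor \<alpha> \<beta> gt p) = (\<Sum>l\<in>F. c l * l2inner (TF l (gabor \<alpha> \<beta> g p)) (gabor \<alpha> \<beta> gt p))" for p
    unfolding Fop_def by (simp add: l2inner_sum_left sqint_cmul TF_sqint gs l2inner_cmul_left)
  then have "(\<Sum>m\<in>Defs.box M. \<Sum>n\<in>Defs.box N. l2inner (Fop F c (gabor \<alpha> \<beta> g (m, n))) (gabor \<alpha> \<beta> gt (m, n)))
      = (\<Sum>m\<in>Defs.box M. \<Sum>n\<in>Defs.box N. \<Sum>l\<in>F. c l * l2inner (TF l (gabor \<alpha> \<beta> g (m, n))) (gabor \<alpha> \<beta> gt (m, n)))" by simp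
  also have "\<dots> = (\<Sum>m\<in>Defs.box M. \<Sum>l\<in>F. \<Sum>n\<in>Defs.box N. c l * l2inner (TF l (gabor \<alpha> \<beta> g (m, n))) (gabor \<alpha> \<beta> gt (m, n)))"
    by (rule sum.cong[OF refl], rule sum.swap)
  also have "\<dots> = (\<Sum>l\<in>F. \<Sum>m\<in>Defs.box M. \<Sum>n\<in>Defs.box N. c l * l2inner (TF l (gabor \<alpha> \<beta> g (m, n))) (gabor \<alpha> \<beta> gt (m, n)))"
    by (rule sum.swap)
  also have "\<dots> = (\<Sum>l\<in>F. c l * (\<Sum>m\<in>Defs.box M. \<Sum>n\<in>Defs.box N. l2inner (TF l (gabor \<alpha> \<beta> g (m, n))) (gabor \<alpha> \<beta> gt (m, n))))"
    by (simp only: sum_distrib_left)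
  finally have *: "(\<Sum>m\<in>Defs.box M. \<Sum>n\<in>Defs.box N. l2inner (Fop F c (gabor \<alpha> \<beta> g (m, n))) (gabor \<alpha> \<beta> gt (m, n)))
      = (\<Sum>l\<in>F. c l * (\<Sum>m\<in>Defs.box M. \<Sum>n\<in>Defs.box N. l2inner (TF l (gabor \<alpha> \<beta> g (m, n))) (gabor \<alpha> \<beta> gt (m, n))))" .
  show ?thesis unfolding gabor_avg_def * sum_distrib_left by (rule sum.cong[OF refl]) (simp only: mult_ac)
qed

text \<open>Gabor atoms have the norms of their windows, so Cauchy--Schwarz bounds every term
  equally and the number of terms cancels the normalization. Uniformity in \<open>M\<close> and
  \<open>N\<close> is what permits exchanging the limits.\<close>

lemma gabor_avg_near:
  fixes g gt :: "real^'n \<Rightarrow> complex"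
  assumes \<alpha>: "0 < \<alpha>" and \<beta>: "0 < \<beta>" and g: "g \<in> sqint" and gt: "gt \<in> sqint"
    and S: "maps_l2 S" and T: "maps_l2 T" and near: "near S T e"
  shows "cmod (gabor_avg \<alpha> \<beta> g gt S M N - gabor_avg \<alpha> \<beta> g gt T M N) \<le> 1 / (\<alpha> * \<beta>) ^ CARD('n) * (e * l2norm g * l2norm gt)"
proof -
  define B where "B = e * l2norm g * l2norm gt"
  define W where "W = (2 * real M + 1) ^ CARD('n) * (2 * real N + 1) ^ CARD('n)"
  have W: "W > 0" by (simp add: W_def add_pos_nonneg)
  let ?D = "\<lambda>m n. l2inner (S (gabor \<alpha> \<beta> g (m, n))) (gabor \<alpha> \<beta> gt (m, n)) - l2inner (T (gabor \<alpha> \<beta> g (m, n))) (gabor \<alpha> \<beta> gt (m, n))"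
  have D: "cmod (?D m n) \<le> B" for m n
  proof -
    let ?u = "gabor \<alpha> \<beta> g (m, n)" and ?v = "gabor \<alpha> \<beta> gt (m, n)"
    have u: "?u \<in> sqint" and v: "?v \<in> sqint" unfolding gabor_def by (auto intro: TF_sqint g gt)
    have nu: "l2norm ?u = l2norm g" and nv: "l2norm ?v = l2norm gt" unfolding gabor_def by (auto intro: l2norm_TF g gt)
    have Su: "S ?u \<in> sqint" and Tu: "T ?u \<in> sqint" using S T u by (auto simp: maps_l2_def)
    have "cmod (?D m n) = cmod (l2inner (\<lambda>x. S ?u x - T ?u x) ?v)" by (simp add: l2inner_diff_left Su Tu v)
    also have "\<dots> \<le> l2norm (\<lambda>x. S ?u x - T ?u x) * l2norm ?v" by (rule l2_Cauchy_Schwarz[OF sqint_diff[OF Su Tu] v])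
    also have "\<dots> \<le> (e * l2norm ?u) * l2norm ?v"
      using near u by (intro mult_right_mono l2norm_nonneg) (auto simp: near_def)
    finally show ?thesis by (simp add: B_def nu nv)
  qed
  have "cmod (\<Sum>m\<in>Defs.box M. \<Sum>n\<in>Defs.box N. ?D m n) \<le> (\<Sum>m\<in>(Defs.box M :: (int^'n) set). \<Sum>n\<in>(Defs.box N :: (int^'n) set). B)"
    by (intro sum_norm_le D)
  also have "\<dots> = W * B"
    by (simp add: card_box W_def mult.assoc add.commute)
  finally have le: "cmod (\<Sum>m\<in>Defs.box M. \<Sum>n\<in>Defs.box N. ?D m n) \<le> W * B" .
  have "gabor_avg \<alpha> \<beta> g gt S M N - gabor_avg \<alpha> \<beta> g gt T M N
      = complex_of_real (1 / (\<alpha> * \<beta>) ^ CARD('n)) * (complex_of_real (1 / W) * (\<Sum>m\<in>Defs.box M. \<Sum>n\<in>Defs.box N. ?D m n))"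
    unfolding gabor_avg_def W_def[symmetric] sum_subtractf right_diff_distrib ..
  also have "cmod \<dots> = 1 / (\<alpha> * \<beta>) ^ CARD('n) * (1 / W * cmod (\<Sum>m\<in>Defs.box M. \<Sum>n\<in>Defs.box N. ?D m n))"
    unfolding norm_mult norm_of_real using \<alpha> \<beta> W by simp
  also have "\<dots> \<le> 1 / (\<alpha> * \<beta>) ^ CARD('n) * (1 / W * (W * B))"
    using le \<alpha> \<beta> W by (intro mult_left_mono) auto
  also have "\<dots> = 1 / (\<alpha> * \<beta>) ^ CARD('n) * B" using W by simp
  finally show ?thesis by (simp add: B_def)
qed

lemma gabor_avg_tendsto_trace_state:
  fixes g gt :: "real^'n \<Rightarrow> complex"
  assumes \<alpha>: "0 < \<alpha>" and \<beta>: "0 < \<beta>" and \<alpha>\<beta>: "\<alpha> * \<beta> \<le> 1" and g: "g \<in> sqint" and gt: "gt \<in> sqint"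
    and dual: "is_dual_frame (gabor \<alpha> \<beta> g) (gabor \<alpha> \<beta> gt)" and T: "finitely_approx T"
  shows "((\<lambda>(M, N). gabor_avg \<alpha> \<beta> g gt T M N) \<longlongrightarrow> trace_state T) (at_top \<times>\<^sub>F at_top)"
proof (rule tendstoI)
  fix r :: real assume r: "r > 0"
  define K where "K = 1 / (\<alpha> * \<beta>) ^ CARD('n) * (l2norm g * l2norm gt)"
  have K: "K \<ge> 0" using \<alpha> \<beta> by (simp add: K_def l2norm_nonneg)
  \<comment> \<open>Chosen so that replacing \<open>T\<close> in the averages (\<open>d * K\<close>)
    and in the trace (\<open>d\<close>) costs \<open>r / 3\<close> together; another
    \<open>r / 3\<close> pays for the convergence of the averages.\<close>
  define d where "d = r / 3 * inverse (K + 1)"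
  have d: "d > 0" using r K by (simp add: d_def)
  have "d * (K + 1) = r / 3" using K by (simp add: d_def mult.assoc)
  then have dK: "d * K + d = r / 3" by (simp add: distrib_left)
  obtain F c where F: "finite F" "0 \<in> F" "near T (Fop F c) d" by (rule finitely_approxE[OF T d])
  have "((\<lambda>p. \<Sum>l\<in>F. c l * (case p of (M, N) \<Rightarrow> gabor_avg \<alpha> \<beta> g gt (TF l) M N)) \<longlongrightarrow> (\<Sum>l\<in>F. c l * (if l = 0 then 1 else 0))) (at_top \<times>\<^sub>F at_top)"
    by (intro tendsto_intros gabor_avg_TF_tendsto[OF \<alpha> \<beta> \<alpha>\<beta> g gt dual])
  moreover have "(\<Sum>l\<in>F. c l * (if l = 0 then 1 else 0)) = c 0"
    using F by (simp add: if_distrib[of "\<lambda>z. _ * z"] cong: if_cong)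
  ultimately have "((\<lambda>(M, N). gabor_avg \<alpha> \<beta> g gt (Fop F c) M N) \<longlongrightarrow> c 0) (at_top \<times>\<^sub>F at_top)"
    by (simp add: gabor_avg_Fop[OF g gt] case_prod_unfold)
  then have "\<forall>\<^sub>F p in at_top \<times>\<^sub>F at_top. dist (case p of (M, N) \<Rightarrow> gabor_avg \<alpha> \<beta> g gt (Fop F c) M N) (c 0) < r / 3"
    by (rule tendstoD) (use r in simp)
  then show "\<forall>\<^sub>F p in at_top \<times>\<^sub>F at_top. dist (case p of (M, N) \<Rightarrow> gabor_avg \<alpha> \<beta> g gt T M N) (trace_state T) < r"
  proof eventually_elim
    case (elim p)
    obtain M N where p: "p = (M, N)" by (cases p)
    have "cmod (gabor_avg \<alpha> \<beta> g gt T M N - gabor_avg \<alpha> \<beta> g gt (Fop F c) M N) \<le> d * K"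
      using gabor_avg_near[OF \<alpha> \<beta> g gt finitely_approx_maps[OF T] maps_l2_Fop F(3), of M N] by (simp add: K_def mult_ac)
    then have 1: "dist (gabor_avg \<alpha> \<beta> g gt T M N) (gabor_avg \<alpha> \<beta> g gt (Fop F c) M N) \<le> d * K" by (simp add: dist_norm)
    have 2: "dist (c 0) (trace_state T) \<le> d" using trace_state_near[OF T F] d by (simp add: dist_norm)
    have "dist (gabor_avg \<alpha> \<beta> g gt T M N) (trace_state T) \<le> dist (gabor_avg \<alpha> \<beta> g gt T M N) (gabor_avg \<alpha> \<beta> g gt (Fop F c) M N)
        + (dist (gabor_avg \<alpha> \<beta> g gt (Fop F c) M N) (c 0) + dist (c 0) (trace_state T))"
      by (meson dist_triangle add_left_mono order_trans)
    then show ?case using 1 2 elim dK r by (simp add: p)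
  qed
qed

text \<open>Independence of \<alpha>, \<beta>, \<open>g\<close> and \<open>gt\<close> is expressed
  by choosing \<open>\<gamma>\<close> before them, and the product filter lets \<open>M\<close> and
  \<open>N\<close> tend to infinity independently.\<close>

theorem theorem4:
  "\<exists>\<gamma> :: (((real^'n::finite) \<Rightarrow> complex) \<Rightarrow> ((real^'n) \<Rightarrow> complex)) \<Rightarrow> complex.
     (\<forall>\<alpha> \<beta> g gt. 0 < \<alpha> \<and> 0 < \<beta> \<and> \<alpha> * \<beta> \<le> 1 \<and> g \<in> sqint \<and> gt \<in> sqint \<and>
        is_dual_frame (gabor \<alpha> \<beta> g) (gabor \<alpha> \<beta> gt) \<longrightarrow>
        (\<forall>T. in_boldA T \<longrightarrow>
           ((\<lambda>(M, N). gabor_avg \<alpha> \<beta> g gt T M N) \<longlongrightarrow> \<gamma> T) (at_top \<times>\<^sub>F at_top))) \<and>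
     (\<forall>c. (\<lambda>l. norm (c l)) summable_on UNIV \<longrightarrow> \<gamma> (Aop c) = c 0) \<and>
     faithful_tracial_state \<gamma>"
proof (intro exI[of _ trace_state] conjI allI impI faithful_tracial_state_trace_state trace_state_Aop)
  fix \<alpha> \<beta> and g gt :: "real^'n \<Rightarrow> complex" and T :: "((real^'n) \<Rightarrow> complex) \<Rightarrow> ((real^'n) \<Rightarrow> complex)"
  assume "0 < \<alpha> \<and> 0 < \<beta> \<and> \<alpha> * \<beta> \<le> 1 \<and> g \<in> sqint \<and> gt \<in> sqint \<and>
    is_dual_frame (gabor \<alpha> \<beta> g) (gabor \<alpha> \<beta> gt)" and "in_boldA T"
  then show "((\<lambda>(M, N). gabor_avg \<alpha> \<beta> g gt T M N) \<longlongrightarrow> trace_state T) (at_top \<times>\<^sub>F at_top)"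
    using gabor_avg_tendsto_trace_state in_boldA_finitely_approx by blast
qed

end
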